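(* The elementary coincidence spectrum of the $\mathbb{Z}[\sqrt2]$-module $\operatorname{Im}(\mathbb{K})$ is $$\Sigma\bigl(\mathrm{SO}(3,\mathbb{Q}(\sqrt2))\bigr)=\{m\in\mathbb{N}\mid m=k^2-2\ell^2\text{ with }k,\ell\in\mathbb{Z}\}=\{1,2,4,7,8,9,14,16,17,18,23,25,\ldots\}.$$ The spectrum is a (multiplicative) monoid and consists of all natural numbers that have all primes congruent to $\pm3\pmod 8$ in their factorizations occurring with an even power.
   Context: $\mathbb{K}=\bigl\langle1,\frac{1+\mathrm{i}}{\sqrt2},\frac{1+\mathrm{j}}{\sqrt2},\frac{1+\mathrm{i}+\mathrm{j}+\mathrm{k}}{2}\bigr\rangle_{\mathbb{Z}[\sqrt2]}$ is the octahedral (or cubian) ring, a maximal order in the quaternion algebra $\mathbb{H}(\mathbb{Q}(\sqrt2))$ (Hamilton's quaternions with coefficients in $\mathbb{Q}(\sqrt2)$). The imaginary part of $x_0+\mathrm{i}x_1+\mathrm{j}x_2+\mathrm{k}x_3$ is identified with $(x_1,x_2,x_3)^t\in\mathbb{R}^3$, so that $$\Gamma:=\operatorname{Im}(\mathbb{K})=\tfrac{1}{\sqrt2}\bigl\langle(1,0,0)^t,(0,1,0)^t,\tfrac1{\sqrt2}(1,1,1)^t\bigr\rangle_{\mathbb{Z}[\sqrt2]}\subset\mathbb{R}^3.$$ Two $\mathbb{Z}$-modules in $\mathbb{R}^3$ are commensurate ($\sim$) if their intersection has finite index in both. $\mathrm{SOC}(\Gamma)=\{R\in\mathrm{SO}(3,\mathbb{R})\mid\Gamma\sim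 R\Gamma\}$, which equals $\mathrm{SO}(3,\mathbb{Q}(\sqrt2))$; for $R\in\mathrm{SOC}(\Gamma)$, $\Sigma(R)=[\Gamma:(\Gamma\cap R\Gamma)]$. The elementary coincidence spectrum of $\Gamma$ is $\Sigma(\mathrm{SOC}(\Gamma))$. $\mathbb{N}=\{1,2,3,\ldots\}$. *)

theory Defs
  imports
    "HOL-Analysis.Analysis"
    "HOL-Number_Theory.Cong"
    "HOL-Algebra.Coset"
begin

definition Z_sqrt2 :: "real set" where
  "Z_sqrt2 = {a + b * sqrt 2 | a b. a \<in> \<int> \<and> b \<in> \<int>}"

definition Q_sqrt2 :: "real set" where
  "Q_sqrt2 = {a + b * sqrt 2 | a b. a \<in> \<rat> \<and> b \<in> \<rat>}"

definition module_span :: "real set \<Rightarrow> 'a::real_vector list \<Rightarrow> 'a set" where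
  "module_span S vs =
     {(\<Sum>n<length vs. c n *\<^sub>R vs ! n) | c. \<forall>n<length vs. c n \<in> S}"

text \<open>
  The quaternion \<open>x0 + i x1 + j x2 + k x3\<close> is represented by the pair \<open>(x0, (x1, x2, x3))\<close>
  of its real part and its imaginary part. Only the additive structure and the scaling by real
  numbers are needed below, and these are the ones of the product space.
\<close>

type_synonym quaternion = "real \<times> (real ^ 3)"

definition quat_1 :: quaternion where "quat_1 = (1, 0)"
definition quat_i :: quaternion where "quat_i = (0, axis 1 1)"
definition quat_j :: quaternion where "quat_j = (0, axis 2 1)"
definition quat_k :: quaternion where "quat_k = (0, axis 3 1)"

definition quat_Im :: "quaternion \<Rightarrow> real ^ 3" where
  "quat_Im q = snd q"

definition octahedral_ring :: "quaternion set" where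
  "octahedral_ring = module_span Z_sqrt2
     [quat_1,
      (1 / sqrt 2) *\<^sub>R (quat_1 + quat_i),
      (1 / sqrt 2) *\<^sub>R (quat_1 + quat_j),
      (1 / 2) *\<^sub>R (quat_1 + quat_i + quat_j + quat_k)]"

definition Im_K :: "(real ^ 3) set" where
  "Im_K = quat_Im ` octahedral_ring"

definition additive_group :: "'a::ab_group_add set \<Rightarrow> 'a monoid" where
  "additive_group G = \<lparr>carrier = G, monoid.mult = (+), one = 0\<rparr>"

text \<open>
  The index of an additive subgroup \<open>H\<close> of \<open>G\<close>. It is meaningful only under \<open>finite_index G H\<close>;
  an infinite index is rendered as \<open>0\<close>.
\<close>

definition finite_index :: "'a::ab_group_add set \<Rightarrow> 'a set \<Rightarrow> bool" where
  "finite_index G H \<longleftrightarrow> finite (rcosets\<^bsub>additive_group G\<^esub> H)"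

definition add_index :: "'a::ab_group_add set \<Rightarrow> 'a set \<Rightarrow> nat" where
  "add_index G H = card (rcosets\<^bsub>additive_group G\<^esub> H)"

definition commensurate :: "'a::ab_group_add set \<Rightarrow> 'a set \<Rightarrow> bool" where
  "commensurate M N \<longleftrightarrow> finite_index M (M \<inter> N) \<and> finite_index N (M \<inter> N)"

definition SO3 :: "real set \<Rightarrow> (real ^ 3 ^ 3) set" where
  "SO3 F = {R. rotation_matrix R \<and> (\<forall>a b. R $ a $ b \<in> F)}"

definition SOC :: "(real ^ 3) set \<Rightarrow> (real ^ 3 ^ 3) set" where
  "SOC M = {R \<in> SO3 UNIV. commensurate M ((*v) R ` M)}"

definition coincidence_index :: "(real ^ 3) set \<Rightarrow> real ^ 3 ^ 3 \<Rightarrow> nat" where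
  "coincidence_index M R = add_index M (M \<inter> (*v) R ` M)"

definition coincidence_spectrum :: "(real ^ 3) set \<Rightarrow> nat set" where
  "coincidence_spectrum M = coincidence_index M ` SOC M"

lemma Z_sqrt2_0: "0 \<in> Z_sqrt2"
  unfolding Z_sqrt2_def by (auto intro!: exI[of _ 0])

lemma module_spanI:
  assumes "\<And>n. n < length vs \<Longrightarrow> c n \<in> S"
  shows "(\<Sum>n<length vs. c n *\<^sub>R vs ! n) \<in> module_span S vs"
  using assms unfolding module_span_def by blast

lemma module_spanE:
  assumes "x \<in> module_span S vs"
  obtains c where "\<And>n. n < length vs \<Longrightarrow> c n \<in> S"
    and "x = (\<Sum>n<length vs. c n *\<^sub>R vs ! n)"
  using assms unfolding module_span_def by blast

lemma Im_K_eq: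
  "Im_K = (\<lambda>x. (1 / sqrt 2) *\<^sub>R x) ` module_span Z_sqrt2
     [vector [1, 0, 0], vector [0, 1, 0], (1 / sqrt 2) *\<^sub>R vector [1, 1, 1]]"
  (is "_ = ?h ` module_span _ ?vs")
proof -
  let ?qs = "[quat_1, (1 / sqrt 2) *\<^sub>R (quat_1 + quat_i), (1 / sqrt 2) *\<^sub>R (quat_1 + quat_j),
      (1 / 2) *\<^sub>R (quat_1 + quat_i + quat_j + quat_k)]"
  have comb: "quat_Im (\<Sum>n<length ?qs. c n *\<^sub>R ?qs ! n)
      = ?h (\<Sum>n<length ?vs. c (Suc n) *\<^sub>R ?vs ! n)" for c
  proof -
    have "snd quat_1 = 0" "snd quat_i = vector [1, 0, 0]" "snd quat_j = vector [0, 1, 0]"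
      "snd quat_k = vector [0, 0, 1]"
      by (simp_all add: quat_1_def quat_i_def quat_j_def quat_k_def vec_eq_iff forall_3 axis_def)
    moreover have "(x / sqrt 2 + y) / sqrt 2 = x / 2 + y / sqrt 2" for x y :: real
      by (simp only: add_divide_distrib divide_divide_eq_left real_sqrt_mult_self abs_numeral)
    ultimately show ?thesis
      by (simp add: quat_Im_def lessThan_Suc vec_eq_iff forall_3)
  qed
  show ?thesis
  proof (intro equalityI subsetI)
    fix x assume "x \<in> Im_K"
    then obtain y where y: "y \<in> module_span Z_sqrt2 ?qs" and xy: "x = quat_Im y"
      unfolding Im_K_def octahedral_ring_def by (rule imageE)
    from y obtain c where c: "\<And>n. n < length ?qs \<Longrightarrow> c n \<in> Z_sqrt2"
      and yc: "y = (\<Sum>n<length ?qs. c n *\<^sub>R ?qs ! n)"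
      by (rule module_spanE) iprover
    have x: "x = ?h (\<Sum>n<length ?vs. c (Suc n) *\<^sub>R ?vs ! n)"
      using comb[of c] unfolding xy yc .
    show "x \<in> ?h ` module_span Z_sqrt2 ?vs"
      unfolding x by (rule imageI, rule module_spanI, rule c) simp
  next
    fix x assume "x \<in> ?h ` module_span Z_sqrt2 ?vs"
    then obtain y where y: "y \<in> module_span Z_sqrt2 ?vs" and xy: "x = ?h y"
      by (rule imageE)
    from y obtain c where c: "\<And>n. n < length ?vs \<Longrightarrow> c n \<in> Z_sqrt2"
      and yc: "y = (\<Sum>n<length ?vs. c n *\<^sub>R ?vs ! n)"
      by (rule module_spanE) iprover
    define d where "d = case_nat 0 c"
    have d_Suc: "d (Suc n) = c n" for n
      by (simp add: d_def)
    have d: "d n \<in> Z_sqrt2" if "n < length ?qs" for n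
    proof (cases n)
      case 0
      then show ?thesis using Z_sqrt2_0 by (simp add: d_def)
    next
      case (Suc m)
      with that show ?thesis using c[of m] by (simp add: d_Suc)
    qed
    have x: "x = quat_Im (\<Sum>n<length ?qs. d n *\<^sub>R ?qs ! n)"
      using comb[of d] unfolding d_Suc xy yc by (rule sym)
    show "x \<in> Im_K"
      unfolding x Im_K_def octahedral_ring_def by (rule imageI, rule module_spanI, rule d)
  qed
qed

end

theory Submission
  imports Defs "HOL-Number_Theory.Gauss"
begin

text \<open>
  Write \<open>O\<close> for \<open>\<int>[\<surd>2]\<close> and \<open>N\<close> for its norm \<open>k + l \<surd>2 \<mapsto> k\<^sup>2 - 2 l\<^sup>2\<close>, and let \<open>K\<close> be the octahedral ring,
  so that \<open>Im_K\<close> is an \<open>O\<close>-lattice of rank three.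

  Every coincidence index is a norm, for a reason that has nothing to do with quaternions:
  \<open>Im_K \<inter> R Im_K\<close> is an \<open>O\<close>-submodule of finite index of \<open>Im_K\<close>, and \<open>O\<close> is a principal ideal domain.
  Filling up a submodule by one element after the other, each step has the index of an ideal of \<open>O\<close>,
  which is \<open>|N(a)|\<close> for a generator \<open>a\<close>; and \<open>N(1 + \<surd>2) = -1\<close> takes care of the sign
  (\<open>index_submodule_in_norm_values\<close>). The same argument, applied to the kernel of a homomorphism from
  \<open>O\<close> to the integers modulo \<open>p\<close>, shows that a prime \<open>p\<close> for which \<open>2\<close> is a square modulo \<open>p\<close> is a norm;
  with the lemma of Gauss this yields the description of the norms by prime factors
  (\<open>norm_values_prime_characterisation\<close>).

  Conversely, let \<open>m = N(\<alpha>)\<close> be positive. A rotation of index \<open>m\<close> is \<open>x \<mapsto> q x q\<^sup>-\<^sup>1\<close> for an element \<open>q\<close>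
  of \<open>K\<close> whose norm \<open>q q\<^sup>*\<close> is \<open>\<alpha>\<close> up to a unit, and which is not divisible by any prime divisor of \<open>\<alpha>\<close>.
  The index is found from the inverse rotation \<open>S\<close>: the matrix \<open>\<alpha> S\<close> is integral, it is not zero modulo any prime
  divisor of \<open>\<alpha>\<close>, and its two by two minors are entries of \<open>\<alpha>\<^sup>2 S\<close> and so divisible by \<open>\<alpha>\<close>. It has
  rank one modulo \<open>\<alpha>\<close>, so that \<open>S x \<in> Im_K\<close> is a single linear condition with values in \<open>O/\<alpha>\<close>
  (\<open>index_of_rank_one\<close>).

  To find \<open>q\<close>, one first solves the problem modulo \<open>m\<close>, that is, one finds \<open>x\<close> in \<open>K\<close> with norm divisible by \<open>m\<close> but
  not divisible by any prime divisor of \<open>m\<close> itself (\<open>has_primitive_zero_nat\<close>). For a prime \<open>p\<close> an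
  \<open>x\<close> that is idempotent modulo \<open>p\<close> is explicit, its powers serve for powers of \<open>p\<close>, and the Chinese
  remainder theorem does the rest. Then the left ideal \<open>K \<alpha> + K x\<close> is generated by one element
  \<open>q\<close>, as \<open>K\<close> is norm-Euclidean, and this \<open>q\<close> has the required properties
  (\<open>rotation_of_primitive_zero\<close>). That \<open>K\<close> is norm-Euclidean rests on the decomposition of \<open>K\<close> into a
  copy of the root lattice \<open>D\<^sub>4\<close> and a copy of its dual, and on their covering radii (\<open>octa_approx\<close>).

  Finally, the rotations with entries in \<open>\<rat>(\<surd>2)\<close> are those that preserve \<open>\<rat> Im_K\<close>, which is to say that
  \<open>Im_K\<close> and its image are commensurate (\<open>SOC_Im_K\<close>).
\<close>

section \<open>Indices of additive subgroups\<close>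

definition is_add_subgroup :: "'a::ab_group_add set \<Rightarrow> bool" where
  "is_add_subgroup H \<longleftrightarrow> 0 \<in> H \<and> (\<forall>x\<in>H. \<forall>y\<in>H. x - y \<in> H)"

lemma add_subgroup_zero: "is_add_subgroup H \<Longrightarrow> 0 \<in> H"
  and add_subgroup_diff: "is_add_subgroup H \<Longrightarrow> x \<in> H \<Longrightarrow> y \<in> H \<Longrightarrow> x - y \<in> H"
  by (auto simp: is_add_subgroup_def)

lemma add_subgroup_uminus: "is_add_subgroup H \<Longrightarrow> x \<in> H \<Longrightarrow> - x \<in> H"
  using add_subgroup_diff[of H 0 x] add_subgroup_zero[of H] by simp

lemma add_subgroup_add: "is_add_subgroup H \<Longrightarrow> x \<in> H \<Longrightarrow> y \<in> H \<Longrightarrow> x + y \<in> H"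
  using add_subgroup_diff[of H x "- y"] add_subgroup_uminus[of H y] by simp

lemma add_subgroup_Int: "is_add_subgroup G \<Longrightarrow> is_add_subgroup H \<Longrightarrow> is_add_subgroup (G \<inter> H)"
  by (auto simp: is_add_subgroup_def)

definition add_coset :: "'a::ab_group_add set \<Rightarrow> 'a \<Rightarrow> 'a set" where
  "add_coset H x = (\<lambda>h. h + x) ` H"

lemma add_coset_eq_iff:
  assumes "is_add_subgroup H"
  shows "add_coset H x = add_coset H y \<longleftrightarrow> x - y \<in> H"
proof
  assume "add_coset H x = add_coset H y"
  moreover have "x \<in> add_coset H x"
    using add_subgroup_zero[OF assms] unfolding add_coset_def by force
  ultimately show "x - y \<in> H" by (auto simp: add_coset_def)
next
  have sub: "add_coset H x \<subseteq> add_coset H y" if "x - y \<in> H" for x y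
  proof
    fix z assume "z \<in> add_coset H x"
    then obtain h where "h \<in> H" "z = h + x" by (auto simp: add_coset_def)
    moreover have "h + (x - y) \<in> H" using add_subgroup_add[OF assms] that \<open>h \<in> H\<close> by blast
    ultimately show "z \<in> add_coset H y"
      unfolding add_coset_def by (intro image_eqI[where x = "h + (x - y)"]) simp_all
  qed
  assume "x - y \<in> H"
  moreover from this have "y - x \<in> H" using add_subgroup_uminus[OF assms] by fastforce
  ultimately show "add_coset H x = add_coset H y" using sub by blast
qed

lemma rcosets_additive_group: "rcosets\<^bsub>additive_group G\<^esub> H = add_coset H ` G"
  by (auto simp: RCOSETS_def r_coset_def additive_group_def add_coset_def)

lemma bij_betw_images_same_kernel:
  assumes "\<And>x y. x \<in> A \<Longrightarrow> y \<in> A \<Longrightarrow> f x = f y \<longleftrightarrow> g x = g y"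
  shows "bij_betw (\<lambda>c. g (inv_into A f c)) (f ` A) (g ` A)"
proof -
  have key: "g (inv_into A f (f x)) = g x" if "x \<in> A" for x
    using assms[of "inv_into A f (f x)" x] that by (simp add: f_inv_into_f inv_into_into)
  show ?thesis
  proof (rule bij_betw_imageI)
    show "inj_on (\<lambda>c. g (inv_into A f c)) (f ` A)"
    proof (rule inj_onI)
      fix c d assume "c \<in> f ` A" "d \<in> f ` A"
        and eq: "g (inv_into A f c) = g (inv_into A f d)"
      then obtain x y where "x \<in> A" "y \<in> A" "c = f x" "d = f y" by blast
      with eq show "c = d" using key assms[of x y] by simp
    qed
    show "(\<lambda>c. g (inv_into A f c)) ` f ` A = g ` A"
      unfolding image_image by (rule image_cong[OF refl key])
  qed
qed

text \<open>Any function that separates exactly the cosets of \<open>H\<close> computes the index, so that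
  the cosets themselves rarely have to be handled.\<close>

lemma index_via_function:
  assumes "is_add_subgroup H"
    and "\<And>x y. x \<in> G \<Longrightarrow> y \<in> G \<Longrightarrow> g x = g y \<longleftrightarrow> x - y \<in> H"
  shows "add_index G H = card (g ` G)" "finite_index G H \<longleftrightarrow> finite (g ` G)"
proof -
  have "bij_betw (\<lambda>c. g (inv_into G (add_coset H) c)) (add_coset H ` G) (g ` G)"
    by (rule bij_betw_images_same_kernel) (simp add: assms add_coset_eq_iff)
  from bij_betw_same_card[OF this] bij_betw_finite[OF this]
  show "add_index G H = card (g ` G)" "finite_index G H \<longleftrightarrow> finite (g ` G)"
    unfolding add_index_def finite_index_def rcosets_additive_group by auto
qed

lemma finite_index_iff_pos:
  assumes "G \<noteq> {}"
  shows "finite_index G H \<longleftrightarrow> add_index G H > 0"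
  using assms unfolding add_index_def finite_index_def rcosets_additive_group
  by (auto simp: card_gt_0_iff)

lemma index_tower:
  assumes G: "is_add_subgroup G" and H: "is_add_subgroup H" and K: "is_add_subgroup K"
    and "K \<subseteq> H" "H \<subseteq> G"
  shows "add_index G K = add_index G H * add_index H K"
proof -
  \<comment> \<open>\<open>r\<close> chooses a representative in each coset of \<open>H\<close>; a coset of \<open>K\<close> in \<open>G\<close> is then determined
    by a coset of \<open>H\<close> and by the coset of \<open>K\<close> in \<open>H\<close> that contains the deviation from \<open>r\<close>.\<close>
  define r where "r C = inv_into G (add_coset H) C" for C
  have r: "r (add_coset H x) \<in> G" "x - r (add_coset H x) \<in> H" if "x \<in> G" for x
  proof -
    from that have "add_coset H x \<in> add_coset H ` G" by blast
    then have "r (add_coset H x) \<in> G" "add_coset H (r (add_coset H x)) = add_coset H x"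
      unfolding r_def by (rule inv_into_into, rule f_inv_into_f)
    then show "r (add_coset H x) \<in> G" "x - r (add_coset H x) \<in> H"
      using add_coset_eq_iff[OF H, of x] by auto
  qed
  define g where "g x = (add_coset H x, add_coset K (x - r (add_coset H x)))" for x
  have "add_index G K = card (g ` G)"
  proof (rule index_via_function(1)[OF K])
    fix x y assume xy: "x \<in> G" "y \<in> G"
    have "x - y \<in> K \<Longrightarrow> add_coset H x = add_coset H y"
      using \<open>K \<subseteq> H\<close> add_coset_eq_iff[OF H] by blast
    then show "g x = g y \<longleftrightarrow> x - y \<in> K"
      unfolding g_def prod.inject add_coset_eq_iff[OF K]
      by (metis (no_types, lifting) add_diff_cancel_right' diff_add_cancel diff_diff_eq2)
  qed
  also have "g ` G = (add_coset H ` G) \<times> (add_coset K ` H)"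
  proof (intro equalityI subsetI)
    fix z assume "z \<in> g ` G"
    then show "z \<in> (add_coset H ` G) \<times> (add_coset K ` H)"
      using r by (auto simp: g_def)
  next
    fix z assume "z \<in> (add_coset H ` G) \<times> (add_coset K ` H)"
    then obtain x h where x: "x \<in> G" and h: "h \<in> H" and z: "z = (add_coset H x, add_coset K h)"
      by auto
    define y where "y = r (add_coset H x) + h"
    have "y \<in> G" using r(1)[OF x] h \<open>H \<subseteq> G\<close> add_subgroup_add[OF G] unfolding y_def by blast
    moreover have "add_coset H y = add_coset H x"
      using add_subgroup_diff[OF H h r(2)[OF x]] unfolding add_coset_eq_iff[OF H] y_def
      by (simp add: algebra_simps)
    then have "g y = z" by (simp add: g_def z y_def)
    ultimately show "z \<in> g ` G" by blast
  qed
  finally show ?thesis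
    by (simp add: card_cartesian_product add_index_def rcosets_additive_group)
qed

text \<open>The hypothesis on differences says at once that \<open>f\<close> is additive modulo \<open>H'\<close> and that \<open>H\<close> is the
  preimage of \<open>H'\<close>. In this form the lemma covers scalings, linear functionals, matrices and the automorphism
  of \<open>\<rat>(\<surd>2)\<close> alike.\<close>

lemma index_preimage:
  assumes H: "is_add_subgroup H" and H': "is_add_subgroup H'" and G': "is_add_subgroup G'"
    and "H' \<subseteq> G'"
    and diff: "\<And>x y. x \<in> G \<Longrightarrow> y \<in> G \<Longrightarrow> f x - f y \<in> H' \<longleftrightarrow> x - y \<in> H"
    and into: "\<And>x. x \<in> G \<Longrightarrow> f x \<in> G'"
    and onto: "\<And>y. y \<in> G' \<Longrightarrow> \<exists>x\<in>G. f x - y \<in> H'"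
  shows "add_index G H = add_index G' H'"
proof -
  have "add_index G H = card ((\<lambda>x. add_coset H' (f x)) ` G)"
    by (rule index_via_function(1)[OF H]) (simp add: add_coset_eq_iff[OF H'] diff)
  also have "(\<lambda>x. add_coset H' (f x)) ` G = add_coset H' ` G'"
  proof (intro equalityI subsetI)
    fix z assume "z \<in> add_coset H' ` G'"
    then obtain y where y: "y \<in> G'" "z = add_coset H' y" by auto
    with onto obtain x where "x \<in> G" "f x - y \<in> H'" by blast
    then show "z \<in> (\<lambda>x. add_coset H' (f x)) ` G"
      using y add_coset_eq_iff[OF H'] by blast
  qed (use into in auto)
  finally show ?thesis by (simp add: add_index_def rcosets_additive_group)
qed

lemma index_self:
  assumes "is_add_subgroup G"
  shows "add_index G G = 1"
proof -
  have "add_index G G = card ((\<lambda>_. ()) ` G)"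
    by (rule index_via_function(1)[OF assms]) (simp add: add_subgroup_diff[OF assms])
  also have "(\<lambda>_. ()) ` G = {()}" using add_subgroup_zero[OF assms] by blast
  finally show ?thesis by simp
qed

lemma index_eq_1_imp:
  assumes G: "is_add_subgroup G" and H: "is_add_subgroup H" and "add_index G H = 1" "H \<subseteq> G"
  shows "H = G"
proof -
  have "card (add_coset H ` G) = 1"
    using assms by (simp add: add_index_def rcosets_additive_group)
  then obtain C where C: "add_coset H ` G = {C}" by (auto simp: card_1_singleton_iff)
  have "x \<in> H" if "x \<in> G" for x
  proof -
    have "add_coset H x = add_coset H 0" using C that add_subgroup_zero[OF G] by blast
    then show ?thesis using add_coset_eq_iff[OF H, of x 0] by simp
  qed
  then show ?thesis using \<open>H \<subseteq> G\<close> by blast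
qed

section \<open>The ring \<open>\<int>[\<surd>2]\<close>\<close>

lemma sqrt2_irrational: "sqrt 2 \<notin> \<rat>"
proof
  assume "sqrt 2 \<in> \<rat>"
  then obtain m n :: nat where n: "n \<noteq> 0" and mn: "\<bar>sqrt 2\<bar> = real m / real n" and "coprime m n"
    by (rule Rats_abs_nat_div_natE)
  have "real m = sqrt 2 * real n" using mn n by (simp add: field_simps)
  then have "(real m)\<^sup>2 = 2 * (real n)\<^sup>2" by (simp add: power_mult_distrib)
  then have eq: "m\<^sup>2 = 2 * n\<^sup>2" by (metis of_nat_eq_iff of_nat_mult of_nat_numeral of_nat_power)
  then have "even m" by (metis dvd_triv_left even_power)
  then obtain k where "m = 2 * k" by (elim dvdE)
  with eq have "n\<^sup>2 = 2 * k\<^sup>2" by (simp add: power2_eq_square)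
  then have "even n" by (metis dvd_triv_left even_power)
  with \<open>even m\<close> \<open>coprime m n\<close> show False by (metis coprime_common_divisor odd_one)
qed

lemma sqrt2_coordinates_unique:
  assumes "a \<in> \<rat>" "b \<in> \<rat>" "c \<in> \<rat>" "d \<in> \<rat>" "a + b * sqrt 2 = c + d * sqrt 2"
  shows "a = c \<and> b = d"
proof -
  have "b = d"
  proof (rule ccontr)
    assume "b \<noteq> d"
    then have "sqrt 2 = (c - a) / (b - d)" using assms(5) by (simp add: field_simps)
    moreover have "(c - a) / (b - d) \<in> \<rat>" using assms by simp
    ultimately show False using sqrt2_irrational by simp
  qed
  with assms(5) show ?thesis by simp
qed

lemma sqrt2_mult_self: "sqrt 2 * sqrt 2 = 2" "sqrt 2 * (sqrt 2 * x) = 2 * x"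
  by (simp_all flip: mult.assoc)

lemma sqrt2_prod: "(a + b * sqrt 2) * (c + d * sqrt 2) = (a * c + 2 * b * d) + (a * d + b * c) * sqrt 2"
  by (simp add: algebra_simps sqrt2_mult_self)

lemma Z_sqrt2E:
  assumes "x \<in> Z_sqrt2"
  obtains a b :: int where "x = of_int a + of_int b * sqrt 2"
  using assms unfolding Z_sqrt2_def by (auto elim!: Ints_cases)

lemma Z_sqrt2I: "of_int a + of_int b * sqrt 2 \<in> Z_sqrt2"
  unfolding Z_sqrt2_def by (rule CollectI) (metis Ints_of_int)

lemma Q_sqrt2E:
  assumes "x \<in> Q_sqrt2"
  obtains a b where "a \<in> \<rat>" "b \<in> \<rat>" "x = a + b * sqrt 2"
  using assms unfolding Q_sqrt2_def by auto

lemma Q_sqrt2I: "a \<in> \<rat> \<Longrightarrow> b \<in> \<rat> \<Longrightarrow> a + b * sqrt 2 \<in> Q_sqrt2"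
  unfolding Q_sqrt2_def by auto

lemma Z_sqrt2_of_int [simp]: "of_int a \<in> Z_sqrt2"
  using Z_sqrt2I[of a 0] by simp

lemma Z_sqrt2_consts [simp]: "0 \<in> Z_sqrt2" "1 \<in> Z_sqrt2" "numeral n \<in> Z_sqrt2" "of_nat k \<in> Z_sqrt2"
  using Z_sqrt2_of_int[of 0] Z_sqrt2_of_int[of 1] Z_sqrt2_of_int[of "numeral n"]
    Z_sqrt2_of_int[of "int k"] by simp_all

lemma Z_sqrt2_sqrt [simp]: "sqrt 2 \<in> Z_sqrt2"
  using Z_sqrt2I[of 0 1] by simp

lemma Z_sqrt2_add [intro]: "x \<in> Z_sqrt2 \<Longrightarrow> y \<in> Z_sqrt2 \<Longrightarrow> x + y \<in> Z_sqrt2"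
proof (elim Z_sqrt2E)
  fix a b c d :: int
  assume "x = of_int a + of_int b * sqrt 2" "y = of_int c + of_int d * sqrt 2"
  then have "x + y = of_int (a + c) + of_int (b + d) * sqrt 2" by (simp add: algebra_simps)
  then show ?thesis by (simp only: Z_sqrt2I)
qed

lemma Z_sqrt2_mult [intro]: "x \<in> Z_sqrt2 \<Longrightarrow> y \<in> Z_sqrt2 \<Longrightarrow> x * y \<in> Z_sqrt2"
proof (elim Z_sqrt2E)
  fix a b c d :: int
  assume "x = of_int a + of_int b * sqrt 2" "y = of_int c + of_int d * sqrt 2"
  then have "x * y = of_int (a * c + 2 * b * d) + of_int (a * d + b * c) * sqrt 2"
    by (simp only: sqrt2_prod) simp
  then show ?thesis by (simp only: Z_sqrt2I)
qed

lemma Z_sqrt2_uminus [intro]: "x \<in> Z_sqrt2 \<Longrightarrow> - x \<in> Z_sqrt2"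
  using Z_sqrt2_mult[of "of_int (-1)" x] Z_sqrt2_of_int[of "-1"] by simp

lemma Z_sqrt2_diff [intro]: "x \<in> Z_sqrt2 \<Longrightarrow> y \<in> Z_sqrt2 \<Longrightarrow> x - y \<in> Z_sqrt2"
  using Z_sqrt2_add[of x "- y"] by auto

lemma Z_sqrt2_power [intro]: "x \<in> Z_sqrt2 \<Longrightarrow> x ^ n \<in> Z_sqrt2"
  by (induction n) auto

lemma Z_sqrt2_subset_Q_sqrt2: "Z_sqrt2 \<subseteq> Q_sqrt2"
  unfolding Z_sqrt2_def Q_sqrt2_def using Ints_subset_Rats by blast

lemma Q_sqrt2_consts [simp]: "0 \<in> Q_sqrt2" "1 \<in> Q_sqrt2" "numeral n \<in> Q_sqrt2" "sqrt 2 \<in> Q_sqrt2"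
  using Z_sqrt2_subset_Q_sqrt2 by auto

lemma Q_sqrt2_add [intro]: "x \<in> Q_sqrt2 \<Longrightarrow> y \<in> Q_sqrt2 \<Longrightarrow> x + y \<in> Q_sqrt2"
proof (elim Q_sqrt2E)
  fix a b c d assume q: "a \<in> \<rat>" "b \<in> \<rat>" "c \<in> \<rat>" "d \<in> \<rat>"
    and "x = a + b * sqrt 2" "y = c + d * sqrt 2"
  then have "x + y = (a + c) + (b + d) * sqrt 2" by (simp add: algebra_simps)
  with q show ?thesis by (auto intro: Q_sqrt2I)
qed

lemma Q_sqrt2_mult [intro]: "x \<in> Q_sqrt2 \<Longrightarrow> y \<in> Q_sqrt2 \<Longrightarrow> x * y \<in> Q_sqrt2"
proof (elim Q_sqrt2E)
  fix a b c d assume "a \<in> \<rat>" "b \<in> \<rat>" "c \<in> \<rat>" "d \<in> \<rat>"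
    "x = a + b * sqrt 2" "y = c + d * sqrt 2"
  then show ?thesis by (simp only: sqrt2_prod) (auto intro!: Q_sqrt2I)
qed

lemma Q_sqrt2_uminus [intro]: "x \<in> Q_sqrt2 \<Longrightarrow> - x \<in> Q_sqrt2"
  using Q_sqrt2_mult[of "-1" x] Z_sqrt2_of_int[of "-1"] Z_sqrt2_subset_Q_sqrt2 by auto

lemma Q_sqrt2_diff [intro]: "x \<in> Q_sqrt2 \<Longrightarrow> y \<in> Q_sqrt2 \<Longrightarrow> x - y \<in> Q_sqrt2"
  using Q_sqrt2_add[of x "- y"] by auto

text \<open>The nontrivial automorphism of \<open>\<rat>(\<surd>2)\<close> and the norm of \<open>\<rat>(\<surd>2)\<close> over \<open>\<rat>\<close>. Outside of
  \<open>\<rat>(\<surd>2)\<close> the values are arbitrary.\<close>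

definition conj_sqrt2 :: "real \<Rightarrow> real" where
  "conj_sqrt2 x = (THE y. \<exists>a\<in>\<rat>. \<exists>b\<in>\<rat>. x = a + b * sqrt 2 \<and> y = a - b * sqrt 2)"

definition norm_sqrt2 :: "real \<Rightarrow> real" where
  "norm_sqrt2 x = x * conj_sqrt2 x"

lemma conj_sqrt2_eq:
  assumes "a \<in> \<rat>" "b \<in> \<rat>"
  shows "conj_sqrt2 (a + b * sqrt 2) = a - b * sqrt 2"
  unfolding conj_sqrt2_def
  by (rule the_equality) (use assms sqrt2_coordinates_unique in blast)+

lemma norm_sqrt2_eq:
  assumes "a \<in> \<rat>" "b \<in> \<rat>"
  shows "norm_sqrt2 (a + b * sqrt 2) = a\<^sup>2 - 2 * b\<^sup>2"
  unfolding norm_sqrt2_def conj_sqrt2_eq[OF assms]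
  by (simp add: algebra_simps power2_eq_square sqrt2_mult_self)

lemma conj_sqrt2_add:
  assumes "x \<in> Q_sqrt2" "y \<in> Q_sqrt2"
  shows "conj_sqrt2 (x + y) = conj_sqrt2 x + conj_sqrt2 y"
  using assms
proof (elim Q_sqrt2E)
  fix a b c d assume q: "a \<in> \<rat>" "b \<in> \<rat>" "c \<in> \<rat>" "d \<in> \<rat>"
    and xy: "x = a + b * sqrt 2" "y = c + d * sqrt 2"
  then have "x + y = (a + c) + (b + d) * sqrt 2" by (simp add: algebra_simps)
  then have "conj_sqrt2 (x + y) = (a + c) - (b + d) * sqrt 2"
    using q by (simp only: conj_sqrt2_eq Rats_add)
  with q show ?thesis by (simp add: xy conj_sqrt2_eq algebra_simps)
qed

lemma conj_sqrt2_mult: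
  assumes "x \<in> Q_sqrt2" "y \<in> Q_sqrt2"
  shows "conj_sqrt2 (x * y) = conj_sqrt2 x * conj_sqrt2 y"
  using assms
proof (elim Q_sqrt2E)
  fix a b c d assume q: "a \<in> \<rat>" "b \<in> \<rat>" "c \<in> \<rat>" "d \<in> \<rat>"
    and xy: "x = a + b * sqrt 2" "y = c + d * sqrt 2"
  have "x * y = (a * c + 2 * b * d) + (a * d + b * c) * sqrt 2"
    unfolding xy by (rule sqrt2_prod)
  then have "conj_sqrt2 (x * y) = (a * c + 2 * b * d) - (a * d + b * c) * sqrt 2"
    using q by (simp only: conj_sqrt2_eq Rats_add Rats_mult Rats_number_of)
  also have "\<dots> = conj_sqrt2 x * conj_sqrt2 y"
    using q unfolding xy by (simp add: conj_sqrt2_eq algebra_simps sqrt2_mult_self)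
  finally show ?thesis .
qed

lemma norm_sqrt2_mult:
  "x \<in> Q_sqrt2 \<Longrightarrow> y \<in> Q_sqrt2 \<Longrightarrow> norm_sqrt2 (x * y) = norm_sqrt2 x * norm_sqrt2 y"
  by (simp add: norm_sqrt2_def conj_sqrt2_mult)

lemma conj_sqrt2_Z_sqrt2:
  assumes "x \<in> Z_sqrt2"
  shows "conj_sqrt2 x \<in> Z_sqrt2" "conj_sqrt2 (conj_sqrt2 x) = x"
proof -
  obtain a b where x: "x = of_int a + of_int b * sqrt 2" using assms by (rule Z_sqrt2E)
  have c: "conj_sqrt2 x = of_int a + of_int (- b) * sqrt 2" using conj_sqrt2_eq x by simp
  then show "conj_sqrt2 x \<in> Z_sqrt2" by (simp only: Z_sqrt2I)
  show "conj_sqrt2 (conj_sqrt2 x) = x"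
    unfolding c using conj_sqrt2_eq[of "of_int a" "of_int (- b)"] x by simp
qed

lemma norm_sqrt2_Z_sqrt2:
  assumes "x \<in> Z_sqrt2"
  obtains k l :: int where "norm_sqrt2 x = of_int (k\<^sup>2 - 2 * l\<^sup>2)"
  using assms by (elim Z_sqrt2E) (simp add: norm_sqrt2_eq)

lemma conj_sqrt2_eq_0:
  assumes "x \<in> Q_sqrt2" "conj_sqrt2 x = 0"
  shows "x = 0"
proof -
  obtain a b where q: "a \<in> \<rat>" "b \<in> \<rat>" and x: "x = a + b * sqrt 2" using assms(1) by (rule Q_sqrt2E)
  then have "a + (- b) * sqrt 2 = 0 + 0 * sqrt 2" using assms(2) by (simp add: conj_sqrt2_eq)
  then have "a = 0 \<and> - b = 0" using sqrt2_coordinates_unique[of a "-b" 0 0] q by simp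
  with x show ?thesis by simp
qed

lemma norm_sqrt2_eq_0: "x \<in> Q_sqrt2 \<Longrightarrow> norm_sqrt2 x = 0 \<Longrightarrow> x = 0"
  using conj_sqrt2_eq_0 by (auto simp: norm_sqrt2_def)

lemma Q_sqrt2_inverse [intro]:
  assumes "x \<in> Q_sqrt2"
  shows "inverse x \<in> Q_sqrt2"
proof (cases "x = 0")
  case False
  obtain a b where q: "a \<in> \<rat>" "b \<in> \<rat>" and x: "x = a + b * sqrt 2" using assms by (rule Q_sqrt2E)
  define n where "n = norm_sqrt2 x"
  have "n \<noteq> 0" using norm_sqrt2_eq_0[OF assms] False unfolding n_def by blast
  moreover have "n \<in> \<rat>" using q unfolding n_def x by (simp add: norm_sqrt2_eq)
  moreover have "n = x * (a - b * sqrt 2)" using q unfolding n_def norm_sqrt2_def by (simp add: x conj_sqrt2_eq)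
  ultimately have n: "n \<noteq> 0" "n \<in> \<rat>" "n = x * (a - b * sqrt 2)" by blast+
  have "inverse x = (a - b * sqrt 2) / n"
    by (rule inverse_unique) (use n(1,3) in simp)
  also have "\<dots> = (a / n) + (- b / n) * sqrt 2" by (simp add: diff_divide_distrib)
  finally have "inverse x = (a / n) + (- b / n) * sqrt 2" .
  moreover have "a / n \<in> \<rat>" "- b / n \<in> \<rat>" using q n(2) by simp_all
  ultimately show ?thesis by (simp only: Q_sqrt2I)
qed auto

lemma Q_sqrt2_divide [intro]: "x \<in> Q_sqrt2 \<Longrightarrow> y \<in> Q_sqrt2 \<Longrightarrow> x / y \<in> Q_sqrt2"
  by (auto simp: divide_inverse)

text \<open>Rounding both coordinates leaves a remainder \<open>u + v \<surd>2\<close> with \<open>|u|, |v| \<le> 1/2\<close>, of norm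
  \<open>u\<^sup>2 - 2 v\<^sup>2\<close>.\<close>

lemma Z_sqrt2_approx:
  assumes "x \<in> Q_sqrt2"
  shows "\<exists>y\<in>Z_sqrt2. \<bar>norm_sqrt2 (x - y)\<bar> < 1"
proof -
  obtain a b where q: "a \<in> \<rat>" "b \<in> \<rat>" and x: "x = a + b * sqrt 2" using assms by (rule Q_sqrt2E)
  define u v where "u = a - of_int (round a)" and "v = b - of_int (round b)"
  have uv: "\<bar>u\<bar> \<le> 1/2" "\<bar>v\<bar> \<le> 1/2"
    unfolding u_def v_def using of_int_round_abs_le by (metis abs_minus_commute)+
  have "u\<^sup>2 \<le> (1/2)\<^sup>2" "v\<^sup>2 \<le> (1/2)\<^sup>2" using power_mono[OF uv(1), of 2] power_mono[OF uv(2), of 2] by simp_all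
  then have "u\<^sup>2 \<le> 1/4" "v\<^sup>2 \<le> 1/4" by (simp_all add: power_divide)
  then have bd: "\<bar>u\<^sup>2 - 2 * v\<^sup>2\<bar> < 1" using zero_le_power2[of u] zero_le_power2[of v]
    by linarith
  have "x - (of_int (round a) + of_int (round b) * sqrt 2) = u + v * sqrt 2"
    by (simp add: x u_def v_def algebra_simps)
  moreover have "u \<in> \<rat>" "v \<in> \<rat>" using q by (simp_all add: u_def v_def)
  ultimately have "\<bar>norm_sqrt2 (x - (of_int (round a) + of_int (round b) * sqrt 2))\<bar> < 1"
    using bd by (simp add: norm_sqrt2_eq)
  then show ?thesis using Z_sqrt2I by blast
qed

definition multiples :: "real \<Rightarrow> real set" where
  "multiples a = (\<lambda>x. a * x) ` Z_sqrt2"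

lemma multiplesI: "x \<in> Z_sqrt2 \<Longrightarrow> a * x \<in> multiples a"
  unfolding multiples_def by (rule imageI)

lemma multiplesE:
  assumes "y \<in> multiples a"
  obtains x where "x \<in> Z_sqrt2" "y = a * x"
  using assms by (auto simp: multiples_def)

lemma Z_sqrt2_subgroup: "is_add_subgroup Z_sqrt2"
  by (auto simp: is_add_subgroup_def)

lemma multiples_subgroup: "is_add_subgroup (multiples a)"
proof -
  have "a * x - a * y \<in> multiples a" if "x \<in> Z_sqrt2" "y \<in> Z_sqrt2" for x y
    using multiplesI[of "x - y" a] that by (auto simp: right_diff_distrib)
  then show ?thesis
    using multiplesI[of 0 a] unfolding is_add_subgroup_def by (auto elim!: multiplesE)
qed

lemma multiples_mult: "x \<in> multiples a \<Longrightarrow> y \<in> Z_sqrt2 \<Longrightarrow> x * y \<in> multiples a"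
  by (auto elim!: multiplesE intro!: multiplesI simp: mult.assoc)

lemma multiples_subset: "a \<in> Z_sqrt2 \<Longrightarrow> multiples a \<subseteq> Z_sqrt2"
  by (auto elim!: multiplesE)

text \<open>An element of least norm generates the ideal, since a remainder modulo it has smaller norm.\<close>

lemma ideal_principal:
  assumes J: "is_add_subgroup J" "J \<subseteq> Z_sqrt2"
    and ideal: "\<And>c x. c \<in> Z_sqrt2 \<Longrightarrow> x \<in> J \<Longrightarrow> c * x \<in> J"
  shows "\<exists>a\<in>Z_sqrt2. J = multiples a"
proof (cases "J \<subseteq> {0}")
  case True
  then have "J = {0}" using add_subgroup_zero[OF J(1)] by blast
  moreover have "multiples 0 = {0}"
    unfolding multiples_def mult_zero_left by (rule image_constant[OF Z_sqrt2_0])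
  ultimately have "J = multiples 0" by simp
  then show ?thesis using Z_sqrt2_0 by (rule bexI)
next
  case False
  define \<mu> where "\<mu> x = nat \<lfloor>\<bar>norm_sqrt2 x\<bar>\<rfloor>" for x
  have \<mu>: "real (\<mu> x) = \<bar>norm_sqrt2 x\<bar>" if "x \<in> Z_sqrt2" for x
    using that unfolding \<mu>_def by (elim norm_sqrt2_Z_sqrt2) (simp del: of_int_diff of_int_mult of_int_power flip: of_int_abs)
  define a where "a = arg_min \<mu> (\<lambda>x. x \<in> J \<and> x \<noteq> 0)"
  have a: "a \<in> J" "a \<noteq> 0" and amin: "\<And>x. x \<in> J \<Longrightarrow> x \<noteq> 0 \<Longrightarrow> \<mu> a \<le> \<mu> x"
  proof -
    obtain x where "x \<in> J \<and> x \<noteq> 0" using False by blast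
    then show "a \<in> J" "a \<noteq> 0" unfolding a_def using arg_min_natI[of "\<lambda>x. x \<in> J \<and> x \<noteq> 0" x \<mu>] by auto
    show "\<And>x. x \<in> J \<Longrightarrow> x \<noteq> 0 \<Longrightarrow> \<mu> a \<le> \<mu> x" unfolding a_def by (rule arg_min_nat_le) simp
  qed
  have aZ: "a \<in> Z_sqrt2" and aQ: "a \<in> Q_sqrt2" using a J(2) Z_sqrt2_subset_Q_sqrt2 by auto
  have "x \<in> multiples a" if x: "x \<in> J" for x
  proof -
    have xQ: "x \<in> Q_sqrt2" using x J(2) Z_sqrt2_subset_Q_sqrt2 by auto
    obtain y where y: "y \<in> Z_sqrt2" "\<bar>norm_sqrt2 (x / a - y)\<bar> < 1"
      using Z_sqrt2_approx[of "x / a"] xQ aQ by blast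
    have r: "x - y * a \<in> J" using ideal[OF y(1) a(1)] x add_subgroup_diff[OF J(1)] by blast
    have "x - y * a = (x / a - y) * a" using a by (simp add: field_simps)
    moreover have "x / a - y \<in> Q_sqrt2" using xQ aQ y Z_sqrt2_subset_Q_sqrt2 by blast
    ultimately have "\<bar>norm_sqrt2 (x - y * a)\<bar> = \<bar>norm_sqrt2 (x / a - y)\<bar> * \<bar>norm_sqrt2 a\<bar>"
      using norm_sqrt2_mult aQ by (simp add: abs_mult)
    also have "\<dots> < \<bar>norm_sqrt2 a\<bar>"
    proof -
      have "norm_sqrt2 a \<noteq> 0" using norm_sqrt2_eq_0[OF aQ] a(2) by blast
      then have "0 < \<bar>norm_sqrt2 a\<bar>" by simp
      from mult_strict_right_mono[OF y(2) this] show ?thesis by (simp only: mult_1_left)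
    qed
    finally have "\<mu> (x - y * a) < \<mu> a" using \<mu>[of a] \<mu>[of "x - y * a"] r aZ J(2)
      by (metis of_nat_less_iff subsetD)
    with amin[OF r] have "x = y * a" by (cases "x - y * a = 0") auto
    then show ?thesis using multiplesI[OF y(1), of a] by (simp add: mult.commute)
  qed
  moreover have "multiples a \<subseteq> J" using ideal a(1) by (auto elim!: multiplesE simp: mult.commute)
  ultimately show ?thesis using aZ by blast
qed

lemma index_multiples_mult:
  assumes "a \<in> Z_sqrt2" "b \<in> Z_sqrt2" "a \<noteq> 0"
  shows "add_index Z_sqrt2 (multiples (a * b))
    = add_index Z_sqrt2 (multiples a) * add_index Z_sqrt2 (multiples b)"
proof -
  have iff: "a * x \<in> multiples (a * b) \<longleftrightarrow> x \<in> multiples b" for x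
    using \<open>a \<noteq> 0\<close> by (auto simp: multiples_def image_iff mult.assoc)
  have sub: "multiples (a * b) \<subseteq> multiples a"
    using assms by (auto simp: mult.assoc elim!: multiplesE intro!: multiplesI)
  have "add_index Z_sqrt2 (multiples b) = add_index (multiples a) (multiples (a * b))"
    by (rule index_preimage[where f = "\<lambda>x. a * x"])
      (auto simp: multiples_subgroup iff sub multiplesI
        simp flip: right_diff_distrib elim!: multiplesE intro!: bexI add_subgroup_zero)
  then show ?thesis
    using index_tower[OF Z_sqrt2_subgroup multiples_subgroup multiples_subgroup sub multiples_subset] assms
    by simp
qed

lemma index_multiples_conj:
  assumes "a \<in> Z_sqrt2"
  shows "add_index Z_sqrt2 (multiples (conj_sqrt2 a)) = add_index Z_sqrt2 (multiples a)"
proof (rule index_preimage[where f = conj_sqrt2])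
  note Q = subsetD[OF Z_sqrt2_subset_Q_sqrt2]
  have one: "conj_sqrt2 x \<in> multiples (conj_sqrt2 b)" if "x \<in> multiples b" "b \<in> Z_sqrt2" for x b
    using that by (elim multiplesE) (simp add: conj_sqrt2_mult Q conj_sqrt2_Z_sqrt2 multiplesI)
  have iff: "conj_sqrt2 x \<in> multiples a \<longleftrightarrow> x \<in> multiples (conj_sqrt2 a)" if "x \<in> Z_sqrt2" for x
    using one[of x "conj_sqrt2 a"] one[of "conj_sqrt2 x" a] that assms by (auto simp: conj_sqrt2_Z_sqrt2)
  show "(conj_sqrt2 x - conj_sqrt2 y \<in> multiples a) = (x - y \<in> multiples (conj_sqrt2 a))"
    if "x \<in> Z_sqrt2" "y \<in> Z_sqrt2" for x y
  proof -
    have "conj_sqrt2 (x - y) = conj_sqrt2 x - conj_sqrt2 y"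
      using conj_sqrt2_add[of "x - y" y] that Q by force
    then show ?thesis using iff[of "x - y"] that by auto
  qed
  show "\<exists>x\<in>Z_sqrt2. conj_sqrt2 x - y \<in> multiples a" if "y \<in> Z_sqrt2" for y
    using that by (intro bexI[of _ "conj_sqrt2 y"]) (auto simp: conj_sqrt2_Z_sqrt2 add_subgroup_zero multiples_subgroup)
qed (use assms in \<open>auto simp: multiples_subgroup Z_sqrt2_subgroup multiples_subset conj_sqrt2_Z_sqrt2\<close>)

lemma index_multiples_int:
  assumes "n > 0"
  shows "add_index Z_sqrt2 (multiples (of_int n)) = nat n ^ 2"
proof -
  \<comment> \<open>The residues of the two integer coordinates separate the cosets.\<close>
  define co :: "real \<Rightarrow> int \<times> int" where
    "co x = (SOME p. x = of_int (fst p) + of_int (snd p) * sqrt 2)" for x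
  have co: "co (of_int a + of_int b * sqrt 2) = (a, b)" for a b
  proof -
    have "of_int a + of_int b * sqrt 2 = of_int (fst (co (of_int a + of_int b * sqrt 2)))
        + of_int (snd (co (of_int a + of_int b * sqrt 2))) * sqrt 2"
      unfolding co_def by (rule someI[of _ "(a, b)"]) simp
    from sqrt2_coordinates_unique[OF _ _ _ _ this] show ?thesis by (simp add: prod_eq_iff)
  qed
  define g where "g x = (fst (co x) mod n, snd (co x) mod n)" for x
  have iff: "of_int a + of_int b * sqrt 2 \<in> multiples (of_int n) \<longleftrightarrow> n dvd a \<and> n dvd b" for a b
  proof
    assume "of_int a + of_int b * sqrt 2 \<in> multiples (of_int n)"
    then obtain c d where "of_int a + of_int b * sqrt 2 = of_int n * (of_int c + of_int d * sqrt 2)"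
      by (auto elim!: multiplesE Z_sqrt2E)
    then have "of_int a + of_int b * sqrt 2 = of_int (n * c) + of_int (n * d) * sqrt 2"
      by (simp add: algebra_simps)
    from sqrt2_coordinates_unique[OF _ _ _ _ this] have "a = n * c \<and> b = n * d"
      by (simp only: Rats_of_int of_int_eq_iff)
    then show "n dvd a \<and> n dvd b" by simp
  next
    assume "n dvd a \<and> n dvd b"
    then obtain c d where "a = n * c" "b = n * d" by (auto elim!: dvdE)
    then have "of_int a + of_int b * sqrt 2 = of_int n * (of_int c + of_int d * sqrt 2)"
      by (simp add: algebra_simps)
    then show "of_int a + of_int b * sqrt 2 \<in> multiples (of_int n)"
      by (simp only: multiplesI Z_sqrt2I)
  qed
  have "add_index Z_sqrt2 (multiples (of_int n)) = card (g ` Z_sqrt2)"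
  proof (rule index_via_function(1)[OF multiples_subgroup])
    fix x y assume "x \<in> Z_sqrt2" "y \<in> Z_sqrt2"
    then obtain a b c d where x: "x = of_int a + of_int b * sqrt 2" and y: "y = of_int c + of_int d * sqrt 2"
      by (elim Z_sqrt2E) blast
    have "x - y = of_int (a - c) + of_int (b - d) * sqrt 2" by (simp add: x y algebra_simps)
    then have "x - y \<in> multiples (of_int n) \<longleftrightarrow> n dvd a - c \<and> n dvd b - d" by (simp only: iff)
    then show "g x = g y \<longleftrightarrow> x - y \<in> multiples (of_int n)"
      unfolding g_def x y co by (simp add: mod_eq_dvd_iff)
  qed
  also have "g ` Z_sqrt2 = {0..<n} \<times> {0..<n}"
  proof (intro equalityI subsetI)
    fix z assume "z \<in> {0..<n} \<times> {0..<n}"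
    then have "z = g (of_int (fst z) + of_int (snd z) * sqrt 2)" by (auto simp: g_def co)
    then show "z \<in> g ` Z_sqrt2" using Z_sqrt2I by blast
  qed (use assms in \<open>auto simp: g_def\<close>)
  also have "card \<dots> = nat n ^ 2" by (simp add: card_cartesian_product power2_eq_square)
  finally show ?thesis .
qed

text \<open>Since \<open>a\<close> and its conjugate generate ideals of the same index, and their product is the
  integer \<open>N(a)\<close> with an ideal of index \<open>N(a)\<^sup>2\<close>, the index of \<open>a\<close> itself must be \<open>|N(a)|\<close>.\<close>

theorem index_multiples:
  assumes "a \<in> Z_sqrt2" "a \<noteq> 0"
  shows "real (add_index Z_sqrt2 (multiples a)) = \<bar>norm_sqrt2 a\<bar>"
proof -
  obtain n :: int where n: "norm_sqrt2 a = of_int n" using norm_sqrt2_Z_sqrt2[OF assms(1)] by blast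
  have "n \<noteq> 0" using norm_sqrt2_eq_0[of a] assms n Z_sqrt2_subset_Q_sqrt2 by auto
  have "multiples (of_int n) = multiples (of_int \<bar>n\<bar>)"
  proof (cases "n \<ge> 0")
    case False
    have "multiples (- b) = multiples b" for b
      unfolding multiples_def
      by (auto simp: image_iff intro!: bexI[of _ "- x" for x])
    from this[of "of_int n"] False show ?thesis by simp
  qed simp
  then have "nat \<bar>n\<bar> ^ 2 = add_index Z_sqrt2 (multiples (a * conj_sqrt2 a))"
    using index_multiples_int[of "\<bar>n\<bar>"] \<open>n \<noteq> 0\<close> n by (simp add: norm_sqrt2_def)
  also have "\<dots> = add_index Z_sqrt2 (multiples a) ^ 2"
    using assms by (simp add: index_multiples_mult index_multiples_conj conj_sqrt2_Z_sqrt2 power2_eq_square)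
  finally have "add_index Z_sqrt2 (multiples a) = nat \<bar>n\<bar>" by simp
  then show ?thesis by (simp add: n)
qed

section \<open>Indices of submodules are norms\<close>

definition norm_values :: "nat set" where
  "norm_values = {m::nat. m \<ge> 1 \<and> (\<exists>k l::int. int m = k\<^sup>2 - 2 * l\<^sup>2)}"

lemma norm_values_mult:
  assumes "m \<in> norm_values" "n \<in> norm_values"
  shows "m * n \<in> norm_values"
proof -
  obtain a b c d :: int where "int m = a\<^sup>2 - 2 * b\<^sup>2" "int n = c\<^sup>2 - 2 * d\<^sup>2"
    using assms unfolding norm_values_def by blast
  then have "int (m * n) = (a\<^sup>2 - 2 * b\<^sup>2) * (c\<^sup>2 - 2 * d\<^sup>2)" by simp
  also have "\<dots> = (a * c + 2 * b * d)\<^sup>2 - 2 * (a * d + b * c)\<^sup>2"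
    by (simp add: algebra_simps power2_eq_square)
  finally have "int (m * n) = (a * c + 2 * b * d)\<^sup>2 - 2 * (a * d + b * c)\<^sup>2" .
  then show ?thesis using assms unfolding norm_values_def by fastforce
qed

text \<open>The unit \<open>1 + \<surd>2\<close> has norm \<open>-1\<close>, so the absolute value of a norm is again a norm.\<close>

lemma abs_norm_in_norm_values:
  assumes "a \<in> Z_sqrt2" "a \<noteq> 0" "real m = \<bar>norm_sqrt2 a\<bar>"
  shows "m \<in> norm_values"
proof -
  obtain k l :: int where kl: "norm_sqrt2 a = of_int (k\<^sup>2 - 2 * l\<^sup>2)"
    using norm_sqrt2_Z_sqrt2[OF assms(1)] by blast
  have "norm_sqrt2 a \<noteq> 0" using norm_sqrt2_eq_0 assms Z_sqrt2_subset_Q_sqrt2 by blast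
  then have "m \<ge> 1" using assms(3) by (cases m) auto
  moreover have "real_of_int (int m) = of_int \<bar>k\<^sup>2 - 2 * l\<^sup>2\<bar>" using assms(3) kl by simp
  then have "int m = \<bar>k\<^sup>2 - 2 * l\<^sup>2\<bar>" by linarith
  then have "int m = k\<^sup>2 - 2 * l\<^sup>2 \<or> int m = (k + 2 * l)\<^sup>2 - 2 * (k + l)\<^sup>2"
    by (auto simp: abs_if algebra_simps power2_eq_square)
  ultimately show ?thesis unfolding norm_values_def by blast
qed

lemma index_multiples_in_norm_values:
  "a \<in> Z_sqrt2 \<Longrightarrow> a \<noteq> 0 \<Longrightarrow> add_index Z_sqrt2 (multiples a) \<in> norm_values"
  using abs_norm_in_norm_values index_multiples by blast

definition is_submodule :: "'a::real_vector set \<Rightarrow> bool" where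
  "is_submodule M \<longleftrightarrow> is_add_subgroup M \<and> (\<forall>c\<in>Z_sqrt2. \<forall>x\<in>M. c *\<^sub>R x \<in> M)"

lemma index_Z_sqrt2_zero: "add_index Z_sqrt2 (multiples 0) = 0"
proof -
  have "(\<lambda>n::int. (of_int n :: real)) ` UNIV \<subseteq> Z_sqrt2" by auto
  moreover have "infinite ((\<lambda>n::int. (of_int n :: real)) ` UNIV)"
    by (simp add: finite_image_iff inj_on_def)
  ultimately have "infinite Z_sqrt2" using finite_subset by blast
  moreover have "add_index Z_sqrt2 (multiples 0) = card ((\<lambda>x. x) ` Z_sqrt2)"
    by (rule index_via_function(1)[OF multiples_subgroup])
      (simp add: multiples_def image_constant[OF Z_sqrt2_0])
  ultimately show ?thesis by simp
qed

text \<open>Adjoining one element \<open>x\<close> to \<open>M\<close> changes the index by that of the ideal of all \<open>c\<close> with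
  \<open>c x \<in> M\<close>, which is the norm of a generator; repeating this fills up \<open>G\<close>.\<close>

theorem index_submodule_in_norm_values:
  fixes G M :: "'a::real_vector set"
  assumes G: "is_submodule G" and "is_submodule M" "M \<subseteq> G" "add_index G M > 0"
  shows "add_index G M \<in> norm_values"
  using assms(2-)
proof (induction "add_index G M" arbitrary: M rule: less_induct)
  case less
  have Gs: "is_add_subgroup G" and Ms: "is_add_subgroup M"
    using G less.prems by (auto simp: is_submodule_def)
  have Gm: "\<And>c y. c \<in> Z_sqrt2 \<Longrightarrow> y \<in> G \<Longrightarrow> c *\<^sub>R y \<in> G"
    and Mm: "\<And>c y. c \<in> Z_sqrt2 \<Longrightarrow> y \<in> M \<Longrightarrow> c *\<^sub>R y \<in> M"
    using G less.prems by (auto simp: is_submodule_def)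
  show ?case
  proof (cases "M = G")
    case True
    then have "int (add_index G M) = 1\<^sup>2 - 2 * 0\<^sup>2" "add_index G M \<ge> 1" using index_self[OF Gs] by simp_all
    then show ?thesis unfolding norm_values_def by blast
  next
    case False
    then obtain x where x: "x \<in> G" "x \<notin> M" using less.prems by blast
    define M' where "M' = {y + c *\<^sub>R x | y c. y \<in> M \<and> c \<in> Z_sqrt2}"
    define J where "J = {c \<in> Z_sqrt2. c *\<^sub>R x \<in> M}"
    have M'I: "y + c *\<^sub>R x \<in> M'" if "y \<in> M" "c \<in> Z_sqrt2" for y c using that unfolding M'_def by blast
    have M's: "is_add_subgroup M'"
      unfolding is_add_subgroup_def
    proof (intro conjI ballI)
      show "0 \<in> M'" using M'I[of 0 0] add_subgroup_zero[OF Ms] by simp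
      fix u v assume "u \<in> M'" "v \<in> M'"
      then obtain y c z d where "u = y + c *\<^sub>R x" "v = z + d *\<^sub>R x" "y \<in> M" "z \<in> M" "c \<in> Z_sqrt2" "d \<in> Z_sqrt2"
        unfolding M'_def by blast
      moreover from this have "(y - z) + (c - d) *\<^sub>R x \<in> M'"
        using add_subgroup_diff[OF Ms] by (intro M'I) auto
      ultimately show "u - v \<in> M'" by (simp add: algebra_simps)
    qed
    have M'm: "is_submodule M'"
      unfolding is_submodule_def
    proof (intro conjI ballI M's)
      fix e u assume "e \<in> Z_sqrt2" "u \<in> M'"
      then obtain y c where "u = y + c *\<^sub>R x" "y \<in> M" "c \<in> Z_sqrt2" unfolding M'_def by blast
      moreover have "e *\<^sub>R y + (e * c) *\<^sub>R x \<in> M'"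
        using Mm \<open>e \<in> Z_sqrt2\<close> \<open>y \<in> M\<close> \<open>c \<in> Z_sqrt2\<close> by (intro M'I) auto
      ultimately show "e *\<^sub>R u \<in> M'" by (simp add: algebra_simps)
    qed
    have sub: "M \<subseteq> M'" "M' \<subseteq> G" "x \<in> M'"
    proof -
      show "M \<subseteq> M'" using M'I[where c = 0] by auto
      show "M' \<subseteq> G" using less.prems x Gm add_subgroup_add[OF Gs] unfolding M'_def by blast
      show "x \<in> M'" using M'I[of 0 1] add_subgroup_zero[OF Ms] by simp
    qed
    have Js: "is_add_subgroup J"
      using add_subgroup_zero[OF Ms] add_subgroup_diff[OF Ms]
      unfolding J_def is_add_subgroup_def by (auto simp: scaleR_left_diff_distrib)
    have "\<exists>a\<in>Z_sqrt2. J = multiples a"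
      by (rule ideal_principal[OF Js]) (auto simp: J_def Mm simp flip: scaleR_scaleR)
    then obtain a where a: "a \<in> Z_sqrt2" "J = multiples a" by blast
    have "add_index Z_sqrt2 J = add_index M' M"
    proof (rule index_preimage[where f = "\<lambda>c. c *\<^sub>R x"])
      show "\<exists>c\<in>Z_sqrt2. c *\<^sub>R x - u \<in> M" if "u \<in> M'" for u
        using that add_subgroup_uminus[OF Ms] unfolding M'_def by force
      show "c *\<^sub>R x \<in> M'" if "c \<in> Z_sqrt2" for c
        using M'I[OF add_subgroup_zero[OF Ms] that] by simp
    qed (use Js Ms M's sub in \<open>auto simp: J_def scaleR_left_diff_distrib\<close>)
    with index_tower[OF Gs M's Ms sub(1,2)] a
    have eq: "add_index G M = add_index G M' * add_index Z_sqrt2 (multiples a)" by simp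
    have "a \<noteq> 0" using eq less.prems index_Z_sqrt2_zero by (auto intro: ccontr)
    then have "add_index Z_sqrt2 (multiples a) \<in> norm_values"
      using a index_multiples_in_norm_values by blast
    moreover have "add_index M' M \<noteq> 1" using index_eq_1_imp[OF M's Ms] sub x by blast
    then have "add_index Z_sqrt2 (multiples a) \<noteq> 1"
      using \<open>add_index Z_sqrt2 J = add_index M' M\<close> a by simp
    then have "add_index G M' < add_index G M" "0 < add_index G M'"
      using less.prems(3) unfolding eq
      by (auto simp: nat_0_less_mult_iff)
    then have "add_index G M' \<in> norm_values" using less.hyps M'm sub by blast
    ultimately show ?thesis unfolding eq by (rule norm_values_mult[rotated])
  qed
qed

section \<open>The norms from \<open>\<int>[\<surd>2]\<close>\<close>

text \<open>If \<open>t\<^sup>2 = 2\<close> modulo \<open>p\<close>, then \<open>\<surd>2 \<mapsto> t\<close> is a homomorphism onto the integers modulo \<open>p\<close>, and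
  its kernel is an ideal of index \<open>p\<close>.\<close>

lemma norm_value_if_two_square:
  assumes "p > 0" and t: "int p dvd t\<^sup>2 - 2"
  shows "p \<in> norm_values"
proof -
  define J where "J = {of_int a + of_int b * sqrt 2 | a b. int p dvd a + b * t}"
  have JI: "of_int a + of_int b * sqrt 2 \<in> J" if "int p dvd a + b * t" for a b
    using that unfolding J_def by blast
  have Js: "is_add_subgroup J"
    unfolding is_add_subgroup_def
  proof (intro conjI ballI)
    show "0 \<in> J" using JI[of 0 0] by simp
    fix x y assume "x \<in> J" "y \<in> J"
    then obtain a b c d where "x = of_int a + of_int b * sqrt 2" "y = of_int c + of_int d * sqrt 2"
      "int p dvd a + b * t" "int p dvd c + d * t" unfolding J_def by blast
    moreover from this have "of_int (a - c) + of_int (b - d) * sqrt 2 \<in> J"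
      using dvd_diff[of "int p" "a + b * t" "c + d * t"] by (intro JI) (simp add: algebra_simps)
    ultimately show "x - y \<in> J" by (simp add: algebra_simps)
  qed
  have Jm: "is_submodule J"
    unfolding is_submodule_def
  proof (intro conjI ballI Js)
    fix c x assume "c \<in> Z_sqrt2" "x \<in> J"
    then obtain a b d e where x: "x = of_int a + of_int b * sqrt 2" "int p dvd a + b * t"
      and c: "c = of_int d + of_int e * sqrt 2"
      unfolding J_def by (auto elim!: Z_sqrt2E)
    \<comment> \<open>multiplicativity of \<open>\<surd>2 \<mapsto> t\<close>, up to a multiple of \<open>t\<^sup>2 - 2\<close>\<close>
    have "(d * a + 2 * e * b) + (d * b + e * a) * t = (d + e * t) * (a + b * t) - e * b * (t\<^sup>2 - 2)"
      by (simp add: algebra_simps power2_eq_square)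
    then have "int p dvd (d * a + 2 * e * b) + (d * b + e * a) * t" using x t by simp
    from JI[OF this] have "c * x \<in> J" by (simp add: c x sqrt2_prod)
    then show "c *\<^sub>R x \<in> J" by simp
  qed
  have iff: "of_int a \<in> J \<longleftrightarrow> int p dvd a" for a
  proof
    assume "of_int a \<in> J"
    then obtain c d where eq: "of_int a + of_int 0 * sqrt 2 = of_int c + of_int d * sqrt 2"
      and "int p dvd c + d * t" unfolding J_def by auto
    from sqrt2_coordinates_unique[OF _ _ _ _ eq] have "a = c" "d = 0" by auto
    then show "int p dvd a" using \<open>int p dvd c + d * t\<close> by simp
  qed (use JI[of a 0] in simp)
  have ps: "is_add_subgroup {a. int p dvd a}" unfolding is_add_subgroup_def by auto
  have JZ: "J \<subseteq> Z_sqrt2" using Z_sqrt2I unfolding J_def by blast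
  have "p = card ((\<lambda>a. a mod int p) ` UNIV)"
  proof -
    have "(\<lambda>a. a mod int p) ` UNIV = {0..<int p}"
    proof (intro equalityI subsetI)
      fix x assume "x \<in> {0..<int p}"
      then have "x = x mod int p" by simp
      then show "x \<in> range (\<lambda>a. a mod int p)" by blast
    qed (use \<open>p > 0\<close> in auto)
    then show ?thesis by simp
  qed
  also have "\<dots> = add_index (UNIV :: int set) {a. int p dvd a}"
    by (rule index_via_function(1)[OF ps, symmetric]) (simp add: mod_eq_dvd_iff)
  also have "\<dots> = add_index Z_sqrt2 J"
  proof (rule index_preimage[where f = of_int, OF ps Js Z_sqrt2_subgroup JZ])
    fix y assume "y \<in> Z_sqrt2"
    then obtain a b where y: "y = of_int a + of_int b * sqrt 2" by (rule Z_sqrt2E)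
    have "of_int (b * t) + of_int (- b) * sqrt 2 \<in> J" by (intro JI) simp
    then show "\<exists>x\<in>UNIV. of_int x - y \<in> J" unfolding y by (intro bexI[of _ "a + b * t"]) simp_all
  qed (use iff in \<open>simp_all flip: of_int_diff\<close>)
  finally have "p = add_index Z_sqrt2 J" .
  moreover have "is_submodule Z_sqrt2" using Z_sqrt2_subgroup by (auto simp: is_submodule_def)
  ultimately show ?thesis using index_submodule_in_norm_values[OF _ Jm JZ] \<open>p > 0\<close> by simp
qed

text \<open>In the lemma of Gauss for \<open>2\<close>, the products \<open>2 a\<close> with \<open>1 \<le> a \<le> (p - 1)/2\<close> are already reduced modulo
  \<open>p\<close>, so that the sign is determined by the number of those that exceed \<open>(p - 1)/2\<close>.\<close>

lemma two_is_square_mod_prime: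
  assumes "prime p" and p8: "p mod 8 = 1 \<or> p mod 8 = 7"
  shows "\<exists>t. int p dvd t\<^sup>2 - 2"
proof -
  have "p \<noteq> 2" using p8 by auto
  then have p2: "2 < p" using prime_ge_2_nat[OF assms(1)] by simp
  interpret GAUSS p 2
  proof
    show "[2 \<noteq> 0] (mod int p)"
      using p2 zdvd_not_zless[of 2 "int p"] by (simp add: cong_0_iff)
  qed (use assms p2 in auto)
  have E: "E = (\<lambda>a. a * 2) ` {a \<in> A. (int p - 1) div 2 < a * 2}"
  proof -
    have C: "C = (\<lambda>a. a * 2) ` A"
      unfolding C_def B_def image_image
    proof (rule image_cong[OF refl])
      fix a assume "a \<in> A"
      then have "0 < a" "a \<le> (int p - 1) div 2" by (auto simp: A_def)
      then have "0 < a" "a * 2 < int p" using p_eq2 by linarith+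
      then show "a * 2 mod int p = a * 2" by simp
    qed
    then show ?thesis unfolding E_def by auto
  qed
  have "card E = card {a \<in> A. (int p - 1) div 2 < a * 2}"
    unfolding E by (rule card_image) (simp add: inj_on_def)
  moreover have "even (card {a \<in> A. (int p - 1) div 2 < a * 2})"
  proof -
    define k where "k = int (p div 8)"
    from p8 have "int p = 8 * k + 1 \<or> int p = 8 * k + 7" unfolding k_def by presburger
    then show ?thesis
    proof
      assume "int p = 8 * k + 1"
      then have "{a \<in> A. (int p - 1) div 2 < a * 2} = {2 * k + 1..4 * k}" by (auto simp: A_def k_def)
      then show ?thesis by (simp add: k_def even_nat_iff)
    next
      assume "int p = 8 * k + 7"
      then have "{a \<in> A. (int p - 1) div 2 < a * 2} = {2 * k + 2..4 * k + 3}" by (auto simp: A_def k_def)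
      then show ?thesis by (simp add: k_def even_nat_iff)
    qed
  qed
  ultimately have "Legendre 2 (int p) = 1" using gauss_lemma by simp
  then have "QuadRes (int p) 2" by (auto simp: Legendre_def split: if_splits)
  then show ?thesis by (auto simp: QuadRes_def cong_iff_dvd_diff)
qed

lemma norm_value_mod_8:
  assumes "m \<in> norm_values" "odd m"
  shows "m mod 8 = 1 \<or> m mod 8 = 7"
proof -
  obtain k l :: int where kl: "int m = k\<^sup>2 - 2 * l\<^sup>2" using assms unfolding norm_values_def by blast
  moreover have "odd (int m)" using assms(2) by simp
  ultimately have "odd k" by simp
  then obtain i where i: "k = 2 * i + 1" by (elim oddE)
  obtain j where j: "l = 2 * j \<or> l = 2 * j + 1" by (metis evenE oddE)
  have ii: "\<exists>n. i * i + i = 2 * n" using evenE[of "i * (i + 1)"] by (auto simp: algebra_simps)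
  then obtain n where n: "i * i + i = 2 * n" by blast
  have jj: "\<exists>n. j * j + j = 2 * n" using evenE[of "j * (j + 1)"] by (auto simp: algebra_simps)
  then obtain n' where n': "j * j + j = 2 * n'" by blast
  have "k\<^sup>2 = 8 * n + 1" using i n by (simp add: algebra_simps power2_eq_square)
  moreover have "2 * l\<^sup>2 = 8 * (j * j) \<or> 2 * l\<^sup>2 = 16 * n' + 2"
    using j n' by (auto simp: algebra_simps power2_eq_square)
  ultimately show ?thesis using kl by presburger
qed

text \<open>If \<open>p\<close> did not divide \<open>l\<close>, then \<open>k/l\<close> would be a square root of \<open>2\<close> modulo \<open>p\<close>, and \<open>p\<close> would be a norm.
  But odd norms are \<open>1\<close> or \<open>7\<close> modulo \<open>8\<close>.\<close>

lemma inert_prime_dvd_norm: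
  assumes "prime p" "p mod 8 = 3 \<or> p mod 8 = 5" "int p dvd k\<^sup>2 - 2 * l\<^sup>2"
  shows "int p dvd k \<and> int p dvd l"
proof -
  have pp: "prime (int p)" using assms(1) by simp
  have "int p dvd l"
  proof (rule ccontr)
    assume "\<not> int p dvd l"
    then have "coprime l (int p)" using pp prime_imp_coprime coprime_commute by blast
    then obtain h where h: "[l * h = 1] (mod int p)" using cong_solve_coprime_int by blast
    have "int p dvd (k * h)\<^sup>2 - 2 * (l * h)\<^sup>2"
      using dvd_mult2[OF assms(3), of "h\<^sup>2"] by (simp add: algebra_simps power_mult_distrib)
    moreover have "[2 * (l * h)\<^sup>2 = 2 * 1\<^sup>2] (mod int p)"
      by (rule cong_scalar_left[OF cong_pow[OF h]])
    ultimately have "int p dvd (k * h)\<^sup>2 - 2"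
      by (metis cong_iff_dvd_diff cong_trans mult_1_right one_power2)
    then have "p \<in> norm_values" using norm_value_if_two_square prime_gt_0_nat[OF assms(1)] by blast
    moreover have "odd p" using assms(2) by presburger
    ultimately show False using norm_value_mod_8 assms(2) by fastforce
  qed
  moreover from this have "int p dvd 2 * l\<^sup>2" by (simp add: power2_eq_square)
  from dvd_add[OF assms(3) this] have "int p dvd k\<^sup>2" by simp
  ultimately show ?thesis using pp prime_dvd_power by blast
qed

lemma inert_prime_norm_value:
  assumes "prime p" "p mod 8 = 3 \<or> p mod 8 = 5" "m \<in> norm_values" "p dvd m"
  obtains m' where "m' \<in> norm_values" "m = p\<^sup>2 * m'"
proof -
  obtain k l :: int where kl: "int m = k\<^sup>2 - 2 * l\<^sup>2" using assms unfolding norm_values_def by blast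
  then have "int p dvd k \<and> int p dvd l"
    using inert_prime_dvd_norm[OF assms(1,2)] assms(4) by (metis int_dvd_int_iff)
  then obtain k' l' where k: "k = int p * k'" and l: "l = int p * l'" by (auto elim!: dvdE)
  have eq: "int m = (int p)\<^sup>2 * (k'\<^sup>2 - 2 * l'\<^sup>2)"
    unfolding kl k l by (simp add: algebra_simps power2_eq_square)
  define m' where "m' = nat (k'\<^sup>2 - 2 * l'\<^sup>2)"
  have "int m > 0" using assms(3) by (simp add: norm_values_def)
  then have "k'\<^sup>2 - 2 * l'\<^sup>2 > 0" unfolding eq using zero_less_mult_pos by (metis not_sum_power2_lt_zero zero_le_power2 zero_less_mult_iff not_less)
  then have m': "int m' = k'\<^sup>2 - 2 * l'\<^sup>2" "m' \<ge> 1" unfolding m'_def by simp_all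
  then have "m' \<in> norm_values" unfolding norm_values_def by blast
  moreover have "int m = int (p\<^sup>2 * m')" unfolding eq m'(1)[symmetric] by simp
  then have "m = p\<^sup>2 * m'" by (simp only: of_nat_eq_iff)
  ultimately show thesis using that by blast
qed

theorem norm_values_prime_characterisation:
  "norm_values = {m. m \<ge> 1 \<and> (\<forall>p::nat. prime p \<and> (p mod 8 = 3 \<or> p mod 8 = 5) \<longrightarrow> even (multiplicity p m))}"
proof (intro equalityI subsetI CollectI conjI allI impI)
  fix m p :: nat assume "m \<in> norm_values" and p: "prime p \<and> (p mod 8 = 3 \<or> p mod 8 = 5)"
  then show "even (multiplicity p m)"
  proof (induction m rule: less_induct)
    case (less m)
    show ?case
    proof (cases "p dvd m")
      case True
      then obtain m' where m': "m' \<in> norm_values" "m = p\<^sup>2 * m'"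
        using inert_prime_norm_value less.prems by blast
      then have "m' > 0" by (simp add: norm_values_def)
      moreover have "1 < p\<^sup>2" using p prime_gt_1_nat[of p] one_less_power[of p 2] by simp
      ultimately have "m' < m" unfolding m' by simp
      then have "even (multiplicity p m')" using less.IH m' p by blast
      moreover have "multiplicity p m = 2 + multiplicity p m'"
      proof -
        have "prime_elem p" "p \<noteq> 0" "\<not> p dvd 1" using p prime_gt_1_nat[of p] by auto
        then show ?thesis
          using \<open>m' > 0\<close> unfolding m'(2)
          by (subst prime_elem_multiplicity_mult_distrib) (simp_all add: multiplicity_same_power')
      qed
      ultimately show ?thesis by simp
    qed (simp add: not_dvd_imp_multiplicity_0)
  qed
next
  fix m :: nat
  assume "m \<in> {m. m \<ge> 1 \<and> (\<forall>p::nat. prime p \<and> (p mod 8 = 3 \<or> p mod 8 = 5) \<longrightarrow> even (multiplicity p m))}"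
  then show "m \<in> norm_values"
  proof (induction m rule: less_induct)
    case (less m)
    then have "m \<ge> 1" by simp
    show ?case
    proof (cases "m = 1")
      case True
      have "int 1 = 1\<^sup>2 - 2 * 0\<^sup>2" by simp
      then show ?thesis unfolding True norm_values_def by blast
    next
      case False
      then obtain p where p: "prime p" "p dvd m" using prime_factor_nat by blast
      have "p > 1" using p prime_gt_1_nat by blast
      \<comment> \<open>Split off \<open>q = p\<^sup>2\<close> if \<open>p\<close> is inert, and \<open>q = p\<close> otherwise; the parities in \<open>par\<close> are unaffected.\<close>
      obtain q where q: "q \<in> norm_values" "q dvd m" "q > 1"
        and par: "\<And>r m'. prime r \<Longrightarrow> (r mod 8 = 3 \<or> r mod 8 = 5) \<Longrightarrow> m' > 0 \<Longrightarrow>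
          even (multiplicity r (q * m')) \<longleftrightarrow> even (multiplicity r m')"
      proof (cases "p mod 8 = 3 \<or> p mod 8 = 5")
        case True
        then have "even (multiplicity p m)" using less.prems p by blast
        moreover have "multiplicity p m > 0" using p \<open>m \<ge> 1\<close> prime_multiplicity_gt_zero_iff[of p m] by simp
        ultimately have "multiplicity p m \<ge> 2" by (cases "multiplicity p m = 1") auto
        then have "p\<^sup>2 dvd m" using multiplicity_dvd' by blast
        moreover have "int (p\<^sup>2) = (int p)\<^sup>2 - 2 * 0\<^sup>2" by simp
        then have "p\<^sup>2 \<in> norm_values" using \<open>p > 1\<close> unfolding norm_values_def
          by (intro CollectI conjI) (simp, blast)
        moreover have "even (multiplicity r (p\<^sup>2 * m')) \<longleftrightarrow> even (multiplicity r m')"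
          if "prime r" "m' > 0" for r m'
          using that p(1) by (simp add: prime_elem_multiplicity_mult_distrib prime_elem_multiplicity_power_distrib not_prime_0)
        ultimately show ?thesis using that[of "p\<^sup>2"] one_less_power[OF \<open>p > 1\<close>, of 2] by simp
      next
        case np: False
        have "p \<in> norm_values"
        proof (cases "p = 2")
          case True
          show ?thesis unfolding True norm_values_def
            by (intro CollectI conjI exI[of _ 2] exI[of _ 1]) simp_all
        next
          case False
          then have "odd p" using p(1) prime_odd_nat prime_ge_2_nat[OF p(1)] by auto
          then have "p mod 8 = 1 \<or> p mod 8 = 7" using np by presburger
          then show ?thesis using two_is_square_mod_prime[OF p(1)] norm_value_if_two_square \<open>p > 1\<close> by auto
        qed
        moreover have "multiplicity r (p * m') = multiplicity r m'"
          if "prime r" "r mod 8 = 3 \<or> r mod 8 = 5" "m' > 0" for r m'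
        proof -
          have "r \<noteq> p" using that np by blast
          then have "multiplicity r p = 0" using that(1) p(1) by (simp add: prime_multiplicity_other)
          then show ?thesis using that p(1) by (simp add: prime_elem_multiplicity_mult_distrib not_prime_0)
        qed
        ultimately show ?thesis using that[of p] p \<open>p > 1\<close> by auto
      qed
      from q obtain m' where m': "m = q * m'" by (elim dvdE)
      have "m' > 0" "m' < m" using m' \<open>m \<ge> 1\<close> q(3) by auto
      moreover have "even (multiplicity r m')" if "prime r \<and> (r mod 8 = 3 \<or> r mod 8 = 5)" for r
        using less.prems par[of r m'] that \<open>m' > 0\<close> unfolding m' by blast
      ultimately have "m' \<in> norm_values" using less.IH[of m'] by simp
      then show ?thesis unfolding m' using norm_values_mult q by blast
    qed
  qed
qed (simp add: norm_values_def)

section \<open>Quaternions\<close>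

datatype hquat = HQuat (h0: real) (h1: real) (h2: real) (h3: real)

lemma hquat_eq_iff: "x = y \<longleftrightarrow> h0 x = h0 y \<and> h1 x = h1 y \<and> h2 x = h2 y \<and> h3 x = h3 y"
  by (cases x; cases y) simp

instantiation hquat :: ring_1
begin

definition "0 = HQuat 0 0 0 0"
definition "1 = HQuat 1 0 0 0"
definition "x + y = HQuat (h0 x + h0 y) (h1 x + h1 y) (h2 x + h2 y) (h3 x + h3 y)"
definition "x - y = HQuat (h0 x - h0 y) (h1 x - h1 y) (h2 x - h2 y) (h3 x - h3 y)"
definition "- x = HQuat (- h0 x) (- h1 x) (- h2 x) (- h3 x)"
definition "x * y = HQuat
  (h0 x * h0 y - h1 x * h1 y - h2 x * h2 y - h3 x * h3 y)
  (h0 x * h1 y + h1 x * h0 y + h2 x * h3 y - h3 x * h2 y)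
  (h0 x * h2 y - h1 x * h3 y + h2 x * h0 y + h3 x * h1 y)
  (h0 x * h3 y + h1 x * h2 y - h2 x * h1 y + h3 x * h0 y)"

lemmas hquat_ops = zero_hquat_def one_hquat_def plus_hquat_def minus_hquat_def uminus_hquat_def
  times_hquat_def

instance
  by standard (simp_all add: hquat_ops algebra_simps)

end

definition hreal :: "real \<Rightarrow> hquat" where "hreal c = HQuat c 0 0 0"

definition hconj :: "hquat \<Rightarrow> hquat" where "hconj x = HQuat (h0 x) (- h1 x) (- h2 x) (- h3 x)"

definition hnr :: "hquat \<Rightarrow> real" where "hnr x = (h0 x)\<^sup>2 + (h1 x)\<^sup>2 + (h2 x)\<^sup>2 + (h3 x)\<^sup>2"

lemma hreal_simps:
  "hreal 0 = 0" "hreal 1 = 1" "hreal c + hreal d = hreal (c + d)" "hreal c - hreal d = hreal (c - d)"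
  "hreal c * hreal d = hreal (c * d)" "hreal c = hreal d \<longleftrightarrow> c = d" "h0 (hreal c) = c"
  by (simp_all add: hreal_def hquat_ops)

lemma hreal_commute: "x * hreal c = hreal c * x"
  by (simp add: hreal_def hquat_ops algebra_simps)

lemma hconj_simps:
  "hconj (x * y) = hconj y * hconj x" "hconj (x + y) = hconj x + hconj y" "hconj (hconj x) = x"
  "hconj (hreal c) = hreal c"
  by (simp_all add: hconj_def hreal_def hquat_ops algebra_simps)

lemma mult_hconj: "x * hconj x = hreal (hnr x)" "hconj x * x = hreal (hnr x)"
  by (simp_all add: hconj_def hreal_def hnr_def hquat_ops algebra_simps power2_eq_square)

lemma add_hconj: "x + hconj x = hreal (2 * h0 x)"
  by (simp add: hconj_def hreal_def hquat_ops)

lemma hnr_simps: "hnr (hreal c) = c\<^sup>2" "hnr (hconj x) = hnr x" "hnr 0 = 0"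
  by (simp_all add: hnr_def hreal_def hconj_def hquat_ops)

lemma hnr_mult: "hnr (x * y) = hnr x * hnr y"
  by (simp add: hnr_def times_hquat_def power2_eq_square algebra_simps)

lemma hnr_add: "hnr (x + y) = hnr x + 2 * h0 (x * hconj y) + hnr y"
  by (simp add: hnr_def hconj_def hquat_ops power2_eq_square algebra_simps)

lemma hnr_eq_0_iff: "hnr x = 0 \<longleftrightarrow> x = 0"
proof
  assume "hnr x = 0"
  moreover have "0 \<le> (h0 x)\<^sup>2" "0 \<le> (h1 x)\<^sup>2" "0 \<le> (h2 x)\<^sup>2" "0 \<le> (h3 x)\<^sup>2" by simp_all
  ultimately have "(h0 x)\<^sup>2 = 0" "(h1 x)\<^sup>2 = 0" "(h2 x)\<^sup>2 = 0" "(h3 x)\<^sup>2 = 0"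
    unfolding hnr_def by linarith+
  then show "x = 0" by (simp add: hquat_eq_iff zero_hquat_def)
qed (simp add: hnr_simps)

section \<open>The octahedral ring\<close>

text \<open>The four conditions express the coordinates with respect to the basis
  \<open>1, (1 + i)/\<surd>2, (1 + j)/\<surd>2, (1 + i + j + k)/2\<close>.\<close>

definition octa :: "hquat set" where
  "octa = {x. h0 x - h1 x - h2 x + h3 x \<in> Z_sqrt2 \<and> sqrt 2 * (h1 x - h3 x) \<in> Z_sqrt2
    \<and> sqrt 2 * (h2 x - h3 x) \<in> Z_sqrt2 \<and> 2 * h3 x \<in> Z_sqrt2}"

definition zeta_i :: hquat where "zeta_i = HQuat (1 / sqrt 2) (1 / sqrt 2) 0 0"
definition zeta_j :: hquat where "zeta_j = HQuat (1 / sqrt 2) 0 (1 / sqrt 2) 0"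

lemma inverse_sqrt2: "1 / sqrt 2 = sqrt 2 / 2"
  by (simp add: real_div_sqrt divide_simps)

lemma octaE:
  assumes "x \<in> octa"
  obtains a b c d where "a \<in> Z_sqrt2" "b \<in> Z_sqrt2" "c \<in> Z_sqrt2" "d \<in> Z_sqrt2"
    "x = HQuat (a + (b + c) * sqrt 2 / 2 + d / 2) (b * sqrt 2 / 2 + d / 2) (c * sqrt 2 / 2 + d / 2) (d / 2)"
proof -
  define a b c d where "a = h0 x - h1 x - h2 x + h3 x" and "b = sqrt 2 * (h1 x - h3 x)"
    and "c = sqrt 2 * (h2 x - h3 x)" and "d = 2 * h3 x"
  note defs = this
  have "b * sqrt 2 = 2 * (h1 x - h3 x)" "c * sqrt 2 = 2 * (h2 x - h3 x)"
    unfolding defs by (simp_all add: mult.commute sqrt2_mult_self)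
  then have "x = HQuat (a + (b + c) * sqrt 2 / 2 + d / 2) (b * sqrt 2 / 2 + d / 2) (c * sqrt 2 / 2 + d / 2) (d / 2)"
    unfolding hquat_eq_iff hquat.sel by (simp add: distrib_right a_def d_def) (simp add: field_simps)
  moreover have "a \<in> Z_sqrt2" "b \<in> Z_sqrt2" "c \<in> Z_sqrt2" "d \<in> Z_sqrt2"
    using assms unfolding octa_def defs by simp_all
  ultimately show thesis by (rule that[rotated 4])
qed

lemma octaI:
  assumes "a \<in> Z_sqrt2" "b \<in> Z_sqrt2" "c \<in> Z_sqrt2" "d \<in> Z_sqrt2"
  shows "HQuat (a + (b + c) * sqrt 2 / 2 + d / 2) (b * sqrt 2 / 2 + d / 2) (c * sqrt 2 / 2 + d / 2) (d / 2) \<in> octa"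
  using assms unfolding octa_def by (simp add: algebra_simps add_divide_distrib sqrt2_mult_self)

lemma octa_add: "x \<in> octa \<Longrightarrow> y \<in> octa \<Longrightarrow> x + y \<in> octa"
  using Z_sqrt2_add[of "h0 x - h1 x - h2 x + h3 x" "h0 y - h1 y - h2 y + h3 y"]
    Z_sqrt2_add[of "sqrt 2 * (h1 x - h3 x)" "sqrt 2 * (h1 y - h3 y)"]
    Z_sqrt2_add[of "sqrt 2 * (h2 x - h3 x)" "sqrt 2 * (h2 y - h3 y)"]
    Z_sqrt2_add[of "2 * h3 x" "2 * h3 y"]
  by (simp add: octa_def plus_hquat_def algebra_simps)

lemma octa_scale: "e \<in> Z_sqrt2 \<Longrightarrow> x \<in> octa \<Longrightarrow> hreal e * x \<in> octa"
  using Z_sqrt2_mult[of e "h0 x - h1 x - h2 x + h3 x"] Z_sqrt2_mult[of e "sqrt 2 * (h1 x - h3 x)"]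
    Z_sqrt2_mult[of e "sqrt 2 * (h2 x - h3 x)"] Z_sqrt2_mult[of e "2 * h3 x"]
  by (simp add: octa_def hreal_def times_hquat_def algebra_simps)

lemma octa_zeta:
  assumes "x \<in> octa"
  shows "x * zeta_i \<in> octa" "x * zeta_j \<in> octa"
proof -
  obtain a b c d where z: "a \<in> Z_sqrt2" "b \<in> Z_sqrt2" "c \<in> Z_sqrt2" "d \<in> Z_sqrt2"
   and x: "x = HQuat (a + (b + c) * sqrt 2 / 2 + d / 2) (b * sqrt 2 / 2 + d / 2) (c * sqrt 2 / 2 + d / 2) (d / 2)"
    using assms by (rule octaE)
  let ?Q = "\<lambda>a b c d. HQuat (a + (b + c) * sqrt 2 / 2 + d / 2) (b * sqrt 2 / 2 + d / 2) (c * sqrt 2 / 2 + d / 2) (d / 2)"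
  have i: "x * zeta_i = ?Q (- (b + c) - sqrt 2 * d) (a + sqrt 2 * b + sqrt 2 * c + d) (sqrt 2 * c + d) (- c)"
    unfolding x zeta_i_def inverse_sqrt2 times_hquat_def
    by (simp add: algebra_simps sqrt2_mult_self)
  show "x * zeta_i \<in> octa" unfolding i using z by (intro octaI Z_sqrt2_add Z_sqrt2_diff Z_sqrt2_mult Z_sqrt2_uminus) auto
  have j: "x * zeta_j = ?Q (- c) (- d) (a + sqrt 2 * c) (b + sqrt 2 * d)"
    unfolding x zeta_j_def inverse_sqrt2 times_hquat_def
    by (simp add: field_simps sqrt2_mult_self)
  show "x * zeta_j \<in> octa" unfolding j using z by (intro octaI Z_sqrt2_add Z_sqrt2_diff Z_sqrt2_mult Z_sqrt2_uminus) auto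
qed

text \<open>As a ring, \<open>octa\<close> is generated over \<open>\<int>[\<surd>2]\<close> by \<open>zeta_i\<close> and \<open>zeta_j\<close>, since the fourth basis
  element is their product.\<close>

lemma octa_mult:
  assumes "x \<in> octa" "y \<in> octa"
  shows "x * y \<in> octa"
proof -
  obtain a b c d where z: "a \<in> Z_sqrt2" "b \<in> Z_sqrt2" "c \<in> Z_sqrt2" "d \<in> Z_sqrt2"
   and y: "y = HQuat (a + (b + c) * sqrt 2 / 2 + d / 2) (b * sqrt 2 / 2 + d / 2) (c * sqrt 2 / 2 + d / 2) (d / 2)"
    using assms(2) by (rule octaE)
  have "y = hreal a + hreal b * zeta_i + hreal c * zeta_j + hreal d * (zeta_i * zeta_j)"
    unfolding y zeta_i_def zeta_j_def inverse_sqrt2 hreal_def times_hquat_def plus_hquat_def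
    by (simp add: distrib_right add_divide_distrib)
  moreover have "x * (hreal e * z) = hreal e * (x * z)" for e z
    by (metis hreal_commute mult.assoc)
  ultimately have "x * y = hreal a * x + hreal b * (x * zeta_i) + hreal c * (x * zeta_j) + hreal d * (x * zeta_i * zeta_j)"
    by (simp add: distrib_left mult.assoc hreal_commute[of x])
  then show ?thesis using z assms(1) by (simp add: octa_add octa_scale octa_zeta)
qed

lemma hreal_in_octa_iff: "hreal c \<in> octa \<longleftrightarrow> c \<in> Z_sqrt2"
  by (simp add: octa_def hreal_def)

lemma octa_one: "1 \<in> octa" and octa_zero: "0 \<in> octa"
  using hreal_in_octa_iff[of 1] hreal_in_octa_iff[of 0] by (simp_all add: hreal_simps)

lemma octa_uminus: "x \<in> octa \<Longrightarrow> - x \<in> octa"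
  using octa_scale[of "-1" x] Z_sqrt2_of_int[of "-1"] by (simp add: hreal_def hquat_ops)

lemma octa_diff: "x \<in> octa \<Longrightarrow> y \<in> octa \<Longrightarrow> x - y \<in> octa"
  using octa_add[of x "- y"] octa_uminus by simp

lemma octa_trace: "x \<in> octa \<Longrightarrow> 2 * h0 x \<in> Z_sqrt2"
proof (elim octaE)
  fix a b c d assume z: "a \<in> Z_sqrt2" "b \<in> Z_sqrt2" "c \<in> Z_sqrt2" "d \<in> Z_sqrt2"
   and x: "x = HQuat (a + (b + c) * sqrt 2 / 2 + d / 2) (b * sqrt 2 / 2 + d / 2) (c * sqrt 2 / 2 + d / 2) (d / 2)"
  have "2 * h0 x = 2 * a + (b + c) * sqrt 2 + d" by (simp add: x)
  then show ?thesis using z by (simp add: Z_sqrt2_add Z_sqrt2_mult)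
qed

lemma octa_hconj: "x \<in> octa \<Longrightarrow> hconj x \<in> octa"
  using octa_diff[of "hreal (2 * h0 x)" x] octa_trace[of x] add_hconj[of x]
  by (simp add: hreal_in_octa_iff) (metis add_diff_cancel_left')

lemma octa_hnr: "x \<in> octa \<Longrightarrow> hnr x \<in> Z_sqrt2"
  using octa_mult[OF _ octa_hconj, of x x] by (simp add: mult_hconj hreal_in_octa_iff)

lemma octa_power: "x \<in> octa \<Longrightarrow> x ^ n \<in> octa"
  by (induction n) (simp_all add: octa_one octa_mult)

definition hquat_Q_sqrt2 :: "hquat set" where
  "hquat_Q_sqrt2 = {x. h0 x \<in> Q_sqrt2 \<and> h1 x \<in> Q_sqrt2 \<and> h2 x \<in> Q_sqrt2 \<and> h3 x \<in> Q_sqrt2}"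

lemma octa_subset_hquat_Q_sqrt2: "octa \<subseteq> hquat_Q_sqrt2"
proof
  fix x assume "x \<in> octa"
  then obtain a b c d where "a \<in> Z_sqrt2" "b \<in> Z_sqrt2" "c \<in> Z_sqrt2" "d \<in> Z_sqrt2"
   and x: "x = HQuat (a + (b + c) * sqrt 2 / 2 + d / 2) (b * sqrt 2 / 2 + d / 2) (c * sqrt 2 / 2 + d / 2) (d / 2)"
    by (rule octaE)
  then have "a \<in> Q_sqrt2" "b \<in> Q_sqrt2" "c \<in> Q_sqrt2" "d \<in> Q_sqrt2"
    using Z_sqrt2_subset_Q_sqrt2 by auto
  then show "x \<in> hquat_Q_sqrt2" unfolding x hquat_Q_sqrt2_def
    by (simp add: Q_sqrt2_add Q_sqrt2_mult Q_sqrt2_divide)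
qed

lemma hquat_Q_sqrt2_mult: "x \<in> hquat_Q_sqrt2 \<Longrightarrow> y \<in> hquat_Q_sqrt2 \<Longrightarrow> x * y \<in> hquat_Q_sqrt2"
  by (simp add: hquat_Q_sqrt2_def times_hquat_def Q_sqrt2_add Q_sqrt2_diff Q_sqrt2_mult)

lemma hquat_Q_sqrt2_diff: "x \<in> hquat_Q_sqrt2 \<Longrightarrow> y \<in> hquat_Q_sqrt2 \<Longrightarrow> x - y \<in> hquat_Q_sqrt2"
  by (simp add: hquat_Q_sqrt2_def minus_hquat_def Q_sqrt2_diff)

lemma hquat_Q_sqrt2_hreal: "c \<in> Q_sqrt2 \<Longrightarrow> hreal c \<in> hquat_Q_sqrt2"
  by (simp add: hquat_Q_sqrt2_def hreal_def)

lemma hquat_Q_sqrt2_hnr: "x \<in> hquat_Q_sqrt2 \<Longrightarrow> hnr x \<in> Q_sqrt2"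
  by (simp add: hquat_Q_sqrt2_def hnr_def power2_eq_square Q_sqrt2_add Q_sqrt2_mult)

section \<open>The octahedral ring is norm-Euclidean\<close>

text \<open>Writing the coordinates as \<open>(a\<^sub>n + b\<^sub>n \<surd>2)/2\<close> splits \<open>octa\<close> into two rank four lattices: the \<open>a\<close> are
  integers of the same parity, which is twice the dual of \<open>D\<^sub>4\<close>, and the \<open>b\<close> have even sum, which is \<open>D\<^sub>4\<close>.\<close>

lemma octa_half_integers:
  fixes a0 a1 a2 a3 b0 b1 b2 b3 :: int
  assumes "even (a0 + a1)" "even (a0 + a2)" "even (a0 + a3)" "even (b0 + b1 + b2 + b3)"
  shows "HQuat ((of_int a0 + of_int b0 * sqrt 2) / 2) ((of_int a1 + of_int b1 * sqrt 2) / 2)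
    ((of_int a2 + of_int b2 * sqrt 2) / 2) ((of_int a3 + of_int b3 * sqrt 2) / 2) \<in> octa"
proof -
  have ev: "even (a1 - a3)" "even (a2 - a3)" "even (a0 - a1 - a2 + a3)" "even (b0 - b1 - b2 + b3)"
    using assms by presburger+
  obtain c1 where c1: "a1 - a3 = 2 * c1" using ev(1) by (rule evenE)
  obtain c2 where c2: "a2 - a3 = 2 * c2" using ev(2) by (rule evenE)
  obtain c0 where c0: "a0 - a1 - a2 + a3 = 2 * c0" using ev(3) by (rule evenE)
  obtain d0 where d0: "b0 - b1 - b2 + b3 = 2 * d0" using ev(4) by (rule evenE)
  have r: "real_of_int a1 = of_int a3 + 2 * of_int c1" "real_of_int a2 = of_int a3 + 2 * of_int c2"
    "real_of_int a0 = 2 * of_int c0 + of_int a1 + of_int a2 - of_int a3"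
    "real_of_int b0 = 2 * of_int d0 + of_int b1 + of_int b2 - of_int b3"
    using c0 c1 c2 d0 by linarith+
  show ?thesis
    unfolding octa_def mem_Collect_eq hquat.sel
  proof (intro conjI)
    have "(of_int a0 + of_int b0 * sqrt 2) / 2 - (of_int a1 + of_int b1 * sqrt 2) / 2
      - (of_int a2 + of_int b2 * sqrt 2) / 2 + (of_int a3 + of_int b3 * sqrt 2) / 2 = of_int c0 + of_int d0 * sqrt 2"
      unfolding r by (simp add: field_simps)
    then show "(of_int a0 + of_int b0 * sqrt 2) / 2 - (of_int a1 + of_int b1 * sqrt 2) / 2
      - (of_int a2 + of_int b2 * sqrt 2) / 2 + (of_int a3 + of_int b3 * sqrt 2) / 2 \<in> Z_sqrt2"
      by (simp only: Z_sqrt2I)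
    have "sqrt 2 * ((of_int a1 + of_int b1 * sqrt 2) / 2 - (of_int a3 + of_int b3 * sqrt 2) / 2)
      = of_int (b1 - b3) + of_int c1 * sqrt 2"
      unfolding r by (simp add: field_simps sqrt2_mult_self)
    then show "sqrt 2 * ((of_int a1 + of_int b1 * sqrt 2) / 2 - (of_int a3 + of_int b3 * sqrt 2) / 2) \<in> Z_sqrt2"
      by (simp only: Z_sqrt2I)
    have "sqrt 2 * ((of_int a2 + of_int b2 * sqrt 2) / 2 - (of_int a3 + of_int b3 * sqrt 2) / 2)
      = of_int (b2 - b3) + of_int c2 * sqrt 2"
      unfolding r by (simp add: field_simps sqrt2_mult_self)
    then show "sqrt 2 * ((of_int a2 + of_int b2 * sqrt 2) / 2 - (of_int a3 + of_int b3 * sqrt 2) / 2) \<in> Z_sqrt2"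
      by (simp only: Z_sqrt2I)
    have "2 * ((of_int a3 + of_int b3 * sqrt 2) / 2) = of_int a3 + of_int b3 * sqrt 2" by (rule nonzero_mult_div_cancel_left[THEN trans[OF times_divide_eq_right]]) simp
    then show "2 * ((of_int a3 + of_int b3 * sqrt 2) / 2) \<in> Z_sqrt2" by (simp only: Z_sqrt2I)
  qed
qed

text \<open>Here the covering radius of \<open>D\<^sub>4\<close> is bounded by \<open>1\<close>, by rounding each coordinate.\<close>

lemma D4_covering:
  fixes w0 w1 w2 w3 :: real
  shows "\<exists>b0 b1 b2 b3 :: int. even (b0 + b1 + b2 + b3)
    \<and> (w0 - of_int b0)\<^sup>2 + (w1 - of_int b1)\<^sup>2 + (w2 - of_int b2)\<^sup>2 + (w3 - of_int b3)\<^sup>2 \<le> 1"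
proof -
  have rnd: "\<exists>n e :: int. odd e \<and> (w - of_int n)\<^sup>2 \<le> \<bar>w - of_int n\<bar> / 2 \<and> \<bar>w - of_int n\<bar> \<le> 1/2
    \<and> (w - of_int (n + e))\<^sup>2 = (w - of_int n)\<^sup>2 + 1 - 2 * \<bar>w - of_int n\<bar>" for w :: real
  proof -
    define r where "r = w - of_int (round w)"
    define e :: int where "e = (if r \<ge> 0 then 1 else - 1)"
    have "\<bar>r\<bar> \<le> 1/2" unfolding r_def using of_int_round_abs_le[of w] by (simp add: abs_minus_commute)
    moreover from this have "\<bar>r\<bar> * \<bar>r\<bar> \<le> 1/2 * \<bar>r\<bar>" by (intro mult_right_mono) auto
    then have "r\<^sup>2 \<le> \<bar>r\<bar> / 2" by (simp add: power2_eq_square)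
    moreover have "(r - of_int e)\<^sup>2 = r\<^sup>2 + 1 - 2 * \<bar>r\<bar>"
      by (auto simp: e_def power2_eq_square algebra_simps)
    then have "(w - of_int (round w + e))\<^sup>2 = r\<^sup>2 + 1 - 2 * \<bar>r\<bar>" by (simp add: r_def algebra_simps)
    moreover have "odd e" by (simp add: e_def)
    ultimately show ?thesis unfolding r_def by blast
  qed
  obtain n0 e0 n1 e1 n2 e2 n3 e3 :: int where odd: "odd e0" "odd e1" "odd e2" "odd e3"
    and sq: "(w0 - of_int n0)\<^sup>2 \<le> \<bar>w0 - of_int n0\<bar> / 2" "(w1 - of_int n1)\<^sup>2 \<le> \<bar>w1 - of_int n1\<bar> / 2"
      "(w2 - of_int n2)\<^sup>2 \<le> \<bar>w2 - of_int n2\<bar> / 2" "(w3 - of_int n3)\<^sup>2 \<le> \<bar>w3 - of_int n3\<bar> / 2"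
    and le: "\<bar>w0 - of_int n0\<bar> \<le> 1/2" "\<bar>w1 - of_int n1\<bar> \<le> 1/2" "\<bar>w2 - of_int n2\<bar> \<le> 1/2" "\<bar>w3 - of_int n3\<bar> \<le> 1/2"
    and sh: "(w0 - of_int (n0 + e0))\<^sup>2 = (w0 - of_int n0)\<^sup>2 + 1 - 2 * \<bar>w0 - of_int n0\<bar>"
      "(w1 - of_int (n1 + e1))\<^sup>2 = (w1 - of_int n1)\<^sup>2 + 1 - 2 * \<bar>w1 - of_int n1\<bar>"
      "(w2 - of_int (n2 + e2))\<^sup>2 = (w2 - of_int n2)\<^sup>2 + 1 - 2 * \<bar>w2 - of_int n2\<bar>"
      "(w3 - of_int (n3 + e3))\<^sup>2 = (w3 - of_int n3)\<^sup>2 + 1 - 2 * \<bar>w3 - of_int n3\<bar>"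
    using rnd[of w0] rnd[of w1] rnd[of w2] rnd[of w3] by metis
  define m0 m1 m2 m3 where m: "m0 = \<bar>w0 - of_int n0\<bar>" "m1 = \<bar>w1 - of_int n1\<bar>"
    "m2 = \<bar>w2 - of_int n2\<bar>" "m3 = \<bar>w3 - of_int n3\<bar>"
  define q0 q1 q2 q3 where q: "q0 = (w0 - of_int n0)\<^sup>2" "q1 = (w1 - of_int n1)\<^sup>2"
    "q2 = (w2 - of_int n2)\<^sup>2" "q3 = (w3 - of_int n3)\<^sup>2"
  note sq = sq[folded m, folded q] and le = le[folded m] and sh = sh[folded m, folded q]
  show ?thesis
  proof (cases "even (n0 + n1 + n2 + n3)")
    case True
    moreover have "q0 + q1 + q2 + q3 \<le> 1" using sq le by linarith
    ultimately show ?thesis unfolding q by blast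
  next
    case False
    \<comment> \<open>Moving one coordinate to its second nearest integer repairs the parity, and for the coordinate
      that is farthest from an integer this is cheap enough.\<close>
    have par: "even (n0 + e0 + n1 + n2 + n3)" "even (n0 + (n1 + e1) + n2 + n3)"
      "even (n0 + n1 + (n2 + e2) + n3)" "even (n0 + n1 + n2 + (n3 + e3))"
      using False odd by presburger+
    have "q0 + q1 + q2 + q3 \<le> 2 * m0 \<or> q0 + q1 + q2 + q3 \<le> 2 * m1
      \<or> q0 + q1 + q2 + q3 \<le> 2 * m2 \<or> q0 + q1 + q2 + q3 \<le> 2 * m3"
      using sq by linarith
    then have "(q0 + 1 - 2 * m0) + q1 + q2 + q3 \<le> 1 \<or> q0 + (q1 + 1 - 2 * m1) + q2 + q3 \<le> 1
      \<or> q0 + q1 + (q2 + 1 - 2 * m2) + q3 \<le> 1 \<or> q0 + q1 + q2 + (q3 + 1 - 2 * m3) \<le> 1"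
      by linarith
    then show ?thesis unfolding sh[symmetric] unfolding q using par by blast
  qed
qed

text \<open>The covering radius of the dual of \<open>D\<^sub>4\<close> is \<open>1/\<surd>2\<close>. In a deepest hole the difference vector \<open>t\<close>
  can be chosen with \<open>t\<^sub>0 = \<plusminus>1/2\<close>, and as the sign is free, \<open>t\<close> can be kept off the hyperplane orthogonal to
  a given \<open>v\<close> with \<open>v\<^sub>0 \<noteq> 0\<close>.\<close>

lemma D4_dual_covering:
  fixes u0 u1 u2 u3 v0 v1 v2 v3 :: real
  assumes "v0 \<noteq> 0"
  shows "\<exists>a0 a1 a2 a3 :: int. even (a0 + a1) \<and> even (a0 + a2) \<and> even (a0 + a3)
    \<and> (let T = (u0 - of_int a0 / 2)\<^sup>2 + (u1 - of_int a1 / 2)\<^sup>2 + (u2 - of_int a2 / 2)\<^sup>2 + (u3 - of_int a3 / 2)\<^sup>2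
       in T \<le> 1/2 \<and> (T < 1/2 \<or> (u0 - of_int a0 / 2) * v0 + (u1 - of_int a1 / 2) * v1
          + (u2 - of_int a2 / 2) * v2 + (u3 - of_int a3 / 2) * v3 \<noteq> 0))"
proof -
  have rnd: "\<exists>n e :: int. odd e \<and> (u - of_int n)\<^sup>2 \<le> \<bar>u - of_int n\<bar> / 2 \<and>
    \<bar>u - of_int (2 * n + e) / 2\<bar> = 1/2 - \<bar>u - of_int n\<bar> \<and>
    (u - of_int (2 * n + e) / 2)\<^sup>2 = (u - of_int n)\<^sup>2 + 1/4 - \<bar>u - of_int n\<bar>" for u :: real
  proof -
    define r where "r = u - of_int (round u)"
    define e :: int where "e = (if r \<ge> 0 then 1 else - 1)"
    have "\<bar>r\<bar> \<le> 1/2" unfolding r_def using of_int_round_abs_le[of u] by (simp add: abs_minus_commute)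
    moreover from this have "\<bar>r\<bar> * \<bar>r\<bar> \<le> 1/2 * \<bar>r\<bar>" by (intro mult_right_mono) auto
    then have "r\<^sup>2 \<le> \<bar>r\<bar> / 2" by (simp add: power2_eq_square)
    moreover have "u - of_int (2 * round u + e) / 2 = r - of_int e / 2" by (simp add: r_def field_simps)
    moreover have "(r - of_int e / 2)\<^sup>2 = r\<^sup>2 + 1/4 - \<bar>r\<bar>"
      by (auto simp: e_def power2_eq_square algebra_simps)
    moreover have "\<bar>r - of_int e / 2\<bar> = 1/2 - \<bar>r\<bar>" using \<open>\<bar>r\<bar> \<le> 1/2\<close> by (auto simp: e_def abs_if)
    moreover have "odd e" by (simp add: e_def)
    ultimately show ?thesis unfolding r_def by metis
  qed
  obtain n0 e0 n1 e1 n2 e2 n3 e3 :: int where odd: "odd e0" "odd e1" "odd e2" "odd e3"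
    and sq: "(u0 - of_int n0)\<^sup>2 \<le> \<bar>u0 - of_int n0\<bar> / 2" "(u1 - of_int n1)\<^sup>2 \<le> \<bar>u1 - of_int n1\<bar> / 2"
      "(u2 - of_int n2)\<^sup>2 \<le> \<bar>u2 - of_int n2\<bar> / 2" "(u3 - of_int n3)\<^sup>2 \<le> \<bar>u3 - of_int n3\<bar> / 2"
    and ab: "\<bar>u0 - of_int (2 * n0 + e0) / 2\<bar> = 1/2 - \<bar>u0 - of_int n0\<bar>"
    and sh: "(u0 - of_int (2 * n0 + e0) / 2)\<^sup>2 = (u0 - of_int n0)\<^sup>2 + 1/4 - \<bar>u0 - of_int n0\<bar>"
      "(u1 - of_int (2 * n1 + e1) / 2)\<^sup>2 = (u1 - of_int n1)\<^sup>2 + 1/4 - \<bar>u1 - of_int n1\<bar>"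
      "(u2 - of_int (2 * n2 + e2) / 2)\<^sup>2 = (u2 - of_int n2)\<^sup>2 + 1/4 - \<bar>u2 - of_int n2\<bar>"
      "(u3 - of_int (2 * n3 + e3) / 2)\<^sup>2 = (u3 - of_int n3)\<^sup>2 + 1/4 - \<bar>u3 - of_int n3\<bar>"
    using rnd[of u0] rnd[of u1] rnd[of u2] rnd[of u3] by metis
  define m0 m1 m2 m3 where m: "m0 = \<bar>u0 - of_int n0\<bar>" "m1 = \<bar>u1 - of_int n1\<bar>"
    "m2 = \<bar>u2 - of_int n2\<bar>" "m3 = \<bar>u3 - of_int n3\<bar>"
  define q0 q1 q2 q3 where q: "q0 = (u0 - of_int n0)\<^sup>2" "q1 = (u1 - of_int n1)\<^sup>2"
    "q2 = (u2 - of_int n2)\<^sup>2" "q3 = (u3 - of_int n3)\<^sup>2"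
  note sq = sq[folded m, folded q] and ab = ab[folded m] and sh = sh[folded m, folded q]
  define T where "T a0 a1 a2 a3 = (u0 - of_int a0 / 2)\<^sup>2 + (u1 - of_int a1 / 2)\<^sup>2
    + (u2 - of_int a2 / 2)\<^sup>2 + (u3 - of_int a3 / 2)\<^sup>2" for a0 a1 a2 a3 :: int
  have T1: "T (2 * n0) (2 * n1) (2 * n2) (2 * n3) = q0 + q1 + q2 + q3" unfolding T_def q by simp
  have T2: "T (2 * n0 + e0) (2 * n1 + e1) (2 * n2 + e2) (2 * n3 + e3)
    = q0 + q1 + q2 + q3 + 1 - (m0 + m1 + m2 + m3)"
    unfolding T_def sh by simp
  have "\<exists>a0 a1 a2 a3. even (a0 + a1) \<and> even (a0 + a2) \<and> even (a0 + a3)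
    \<and> T a0 a1 a2 a3 \<le> 1/2 \<and> (T a0 a1 a2 a3 < 1/2 \<or> \<bar>u0 - of_int a0 / 2\<bar> = 1/2)"
  proof (cases "q0 + q1 + q2 + q3 < 1/2 \<or> q0 + q1 + q2 + q3 = 1/2 \<and> m0 = 1/2")
    case True
    then have "T (2 * n0) (2 * n1) (2 * n2) (2 * n3) \<le> 1/2
      \<and> (T (2 * n0) (2 * n1) (2 * n2) (2 * n3) < 1/2 \<or> \<bar>u0 - of_int (2 * n0) / 2\<bar> = 1/2)"
      unfolding T1 m by auto
    then show ?thesis
      by (intro exI[of _ "2 * n0"] exI[of _ "2 * n1"] exI[of _ "2 * n2"] exI[of _ "2 * n3"]) simp
  next
    case False
    have "q0 + q1 + q2 + q3 + 1 - (m0 + m1 + m2 + m3) < 1/2 \<or> 1/2 - m0 = 1/2"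
    proof (rule disjCI)
      assume "1/2 - m0 \<noteq> 1/2"
      then have ne: "m0 \<noteq> 0" by simp
      show "q0 + q1 + q2 + q3 + 1 - (m0 + m1 + m2 + m3) < 1/2"
      proof (cases "q0 + q1 + q2 + q3 > 1/2")
        case True then show ?thesis using sq by linarith
      next
        case S: False
        then have half: "m0 \<noteq> 1/2" "q0 + q1 + q2 + q3 = 1/2" using False by auto
        have "q0 \<noteq> m0 / 2"
        proof
          assume "q0 = m0 / 2"
          then have "m0 * m0 = m0 * (1/2)" by (simp add: q m power2_eq_square)
          then show False using ne half(1) by (metis mult_left_cancel)
        qed
        then show ?thesis using sq half(2) by linarith
      qed
    qed
    moreover have "q0 + q1 + q2 + q3 + 1 - (m0 + m1 + m2 + m3) \<le> 1/2" using False sq by linarith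
    moreover have "even (2 * n0 + e0 + (2 * n1 + e1))" "even (2 * n0 + e0 + (2 * n2 + e2))"
      "even (2 * n0 + e0 + (2 * n3 + e3))" using odd by simp_all
    ultimately show ?thesis unfolding T2[symmetric] ab[symmetric] by blast
  qed
  then obtain a0 a1 a2 a3 where par: "even (a0 + a1)" "even (a0 + a2)" "even (a0 + a3)"
    and T: "T a0 a1 a2 a3 \<le> 1/2" "T a0 a1 a2 a3 < 1/2 \<or> \<bar>u0 - of_int a0 / 2\<bar> = 1/2" by blast
  define R where "R = (u1 - of_int a1 / 2) * v1 + (u2 - of_int a2 / 2) * v2 + (u3 - of_int a3 / 2) * v3"
  show ?thesis
  proof (cases "T a0 a1 a2 a3 < 1/2 \<or> (u0 - of_int a0 / 2) * v0 + R \<noteq> 0")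
    case True
    show ?thesis
      by (rule exI[of _ a0], rule exI[of _ a1], rule exI[of _ a2], rule exI[of _ a3])
        (use True T(1) par in \<open>auto simp: Let_def T_def R_def add.assoc\<close>)
  next
    case False
    \<comment> \<open>flip the sign of \<open>t\<^sub>0\<close>, which changes \<open>a0\<close> by \<open>\<plusminus>2\<close>\<close>
    define c :: int where "c = (if u0 - of_int a0 / 2 \<ge> 0 then a0 + 2 else a0 - 2)"
    have c: "u0 - of_int c / 2 = - (u0 - of_int a0 / 2)" using False T(2) by (auto simp: c_def abs_if field_simps split: if_splits)
    have ne: "(u0 - of_int a0 / 2) * v0 \<noteq> 0" using False T(2) assms by auto
    have "(u0 - of_int a0 / 2) * v0 + R = 0" using False by blast
    then have 1: "(u0 - of_int c / 2) * v0 + R \<noteq> 0" using ne unfolding c minus_mult_left[symmetric] by linarith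
    have 2: "T c a1 a2 a3 \<le> 1/2" using T(1) unfolding T_def c by (simp only: power2_minus)
    have 3: "even (c + a1)" "even (c + a2)" "even (c + a3)" using par by (auto simp: c_def)
    show ?thesis
      by (rule exI[of _ c], rule exI[of _ a1], rule exI[of _ a2], rule exI[of _ a3])
        (use 1 2 3 in \<open>auto simp: Let_def T_def R_def add.assoc\<close>)
  qed
qed

text \<open>By the symmetry of the lattice under permutations of the coordinates, any nonzero
  coordinate of \<open>v\<close> can take the place of \<open>v\<^sub>0\<close>.\<close>

lemma D4_dual_covering_off_hyperplane:
  fixes u0 u1 u2 u3 v0 v1 v2 v3 :: real
  shows "\<exists>a0 a1 a2 a3 :: int. even (a0 + a1) \<and> even (a0 + a2) \<and> even (a0 + a3)
    \<and> (let T = (u0 - of_int a0 / 2)\<^sup>2 + (u1 - of_int a1 / 2)\<^sup>2 + (u2 - of_int a2 / 2)\<^sup>2 + (u3 - of_int a3 / 2)\<^sup>2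
       in T \<le> 1/2 \<and> ((v0 = 0 \<and> v1 = 0 \<and> v2 = 0 \<and> v3 = 0) \<or> T < 1/2 \<or> (u0 - of_int a0 / 2) * v0 + (u1 - of_int a1 / 2) * v1
          + (u2 - of_int a2 / 2) * v2 + (u3 - of_int a3 / 2) * v3 \<noteq> 0))"
proof -
  consider "v0 \<noteq> 0" | "v1 \<noteq> 0" | "v2 \<noteq> 0" | "v3 \<noteq> 0" | "v0 = 0 \<and> v1 = 0 \<and> v2 = 0 \<and> v3 = 0" by blast
  then show ?thesis
  proof cases
    case 1
    from D4_dual_covering[OF this, of u0 u1 u2 u3 v1 v2 v3] show ?thesis unfolding Let_def by blast
  next
    case 2
    from D4_dual_covering[OF this, of u1 u0 u2 u3 v0 v2 v3]
    obtain a1 a0 a2 a3 :: int where "even (a1 + a0)" "even (a1 + a2)" "even (a1 + a3)"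
      "(u1 - of_int a1 / 2)\<^sup>2 + (u0 - of_int a0 / 2)\<^sup>2 + (u2 - of_int a2 / 2)\<^sup>2 + (u3 - of_int a3 / 2)\<^sup>2 \<le> 1/2"
      "(u1 - of_int a1 / 2)\<^sup>2 + (u0 - of_int a0 / 2)\<^sup>2 + (u2 - of_int a2 / 2)\<^sup>2 + (u3 - of_int a3 / 2)\<^sup>2 < 1/2
       \<or> (u1 - of_int a1 / 2) * v1 + (u0 - of_int a0 / 2) * v0 + (u2 - of_int a2 / 2) * v2 + (u3 - of_int a3 / 2) * v3 \<noteq> 0"
      unfolding Let_def by blast
    note a = this
    have "even (a0 + a1) \<and> even (a0 + a2) \<and> even (a0 + a3)" using a(1-3) by presburger
    moreover have "(u0 - of_int a0 / 2)\<^sup>2 + (u1 - of_int a1 / 2)\<^sup>2 + (u2 - of_int a2 / 2)\<^sup>2 + (u3 - of_int a3 / 2)\<^sup>2 \<le> 1/2"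
      using a(4) by linarith
    moreover have "(u0 - of_int a0 / 2)\<^sup>2 + (u1 - of_int a1 / 2)\<^sup>2 + (u2 - of_int a2 / 2)\<^sup>2 + (u3 - of_int a3 / 2)\<^sup>2 < 1/2
      \<or> (u0 - of_int a0 / 2) * v0 + (u1 - of_int a1 / 2) * v1 + (u2 - of_int a2 / 2) * v2 + (u3 - of_int a3 / 2) * v3 \<noteq> 0"
      using a(5) by linarith
    ultimately show ?thesis unfolding Let_def by blast
  next
    case 3
    from D4_dual_covering[OF this, of u2 u1 u0 u3 v1 v0 v3]
    obtain a2 a1 a0 a3 :: int where "even (a2 + a1)" "even (a2 + a0)" "even (a2 + a3)"
      "(u2 - of_int a2 / 2)\<^sup>2 + (u1 - of_int a1 / 2)\<^sup>2 + (u0 - of_int a0 / 2)\<^sup>2 + (u3 - of_int a3 / 2)\<^sup>2 \<le> 1/2"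
      "(u2 - of_int a2 / 2)\<^sup>2 + (u1 - of_int a1 / 2)\<^sup>2 + (u0 - of_int a0 / 2)\<^sup>2 + (u3 - of_int a3 / 2)\<^sup>2 < 1/2
       \<or> (u2 - of_int a2 / 2) * v2 + (u1 - of_int a1 / 2) * v1 + (u0 - of_int a0 / 2) * v0 + (u3 - of_int a3 / 2) * v3 \<noteq> 0"
      unfolding Let_def by blast
    note a = this
    have "even (a0 + a1) \<and> even (a0 + a2) \<and> even (a0 + a3)" using a(1-3) by presburger
    moreover have "(u0 - of_int a0 / 2)\<^sup>2 + (u1 - of_int a1 / 2)\<^sup>2 + (u2 - of_int a2 / 2)\<^sup>2 + (u3 - of_int a3 / 2)\<^sup>2 \<le> 1/2"
      using a(4) by linarith
    moreover have "(u0 - of_int a0 / 2)\<^sup>2 + (u1 - of_int a1 / 2)\<^sup>2 + (u2 - of_int a2 / 2)\<^sup>2 + (u3 - of_int a3 / 2)\<^sup>2 < 1/2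
      \<or> (u0 - of_int a0 / 2) * v0 + (u1 - of_int a1 / 2) * v1 + (u2 - of_int a2 / 2) * v2 + (u3 - of_int a3 / 2) * v3 \<noteq> 0"
      using a(5) by linarith
    ultimately show ?thesis unfolding Let_def by blast
  next
    case 4
    from D4_dual_covering[OF this, of u3 u1 u2 u0 v1 v2 v0]
    obtain a3 a1 a2 a0 :: int where "even (a3 + a1)" "even (a3 + a2)" "even (a3 + a0)"
      "(u3 - of_int a3 / 2)\<^sup>2 + (u1 - of_int a1 / 2)\<^sup>2 + (u2 - of_int a2 / 2)\<^sup>2 + (u0 - of_int a0 / 2)\<^sup>2 \<le> 1/2"
      "(u3 - of_int a3 / 2)\<^sup>2 + (u1 - of_int a1 / 2)\<^sup>2 + (u2 - of_int a2 / 2)\<^sup>2 + (u0 - of_int a0 / 2)\<^sup>2 < 1/2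
       \<or> (u3 - of_int a3 / 2) * v3 + (u1 - of_int a1 / 2) * v1 + (u2 - of_int a2 / 2) * v2 + (u0 - of_int a0 / 2) * v0 \<noteq> 0"
      unfolding Let_def by blast
    note a = this
    have "even (a0 + a1) \<and> even (a0 + a2) \<and> even (a0 + a3)" using a(1-3) by presburger
    moreover have "(u0 - of_int a0 / 2)\<^sup>2 + (u1 - of_int a1 / 2)\<^sup>2 + (u2 - of_int a2 / 2)\<^sup>2 + (u3 - of_int a3 / 2)\<^sup>2 \<le> 1/2"
      using a(4) by linarith
    moreover have "(u0 - of_int a0 / 2)\<^sup>2 + (u1 - of_int a1 / 2)\<^sup>2 + (u2 - of_int a2 / 2)\<^sup>2 + (u3 - of_int a3 / 2)\<^sup>2 < 1/2
      \<or> (u0 - of_int a0 / 2) * v0 + (u1 - of_int a1 / 2) * v1 + (u2 - of_int a2 / 2) * v2 + (u3 - of_int a3 / 2) * v3 \<noteq> 0"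
      using a(5) by linarith
    ultimately show ?thesis unfolding Let_def by blast
  next
    case 5
    from D4_dual_covering[of 1 u0 u1 u2 u3] show ?thesis unfolding Let_def using 5 by (metis zero_neq_one)
  qed
qed

text \<open>For \<open>w - k = t + s \<surd>2\<close> the norm of \<open>|w - k|\<^sup>2\<close> is \<open>(|t|\<^sup>2 + 2 |s|\<^sup>2)\<^sup>2 - 8 (t \<bullet> s)\<^sup>2\<close>. The covering radii
  bound the first square by \<open>1\<close>, just not strictly; the second term makes up for it.\<close>

theorem octa_approx:
  assumes "w \<in> hquat_Q_sqrt2"
  shows "\<exists>k\<in>octa. \<bar>norm_sqrt2 (hnr (w - k))\<bar> < 1"
proof -
  have wQ: "h0 w \<in> Q_sqrt2" "h1 w \<in> Q_sqrt2" "h2 w \<in> Q_sqrt2" "h3 w \<in> Q_sqrt2"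
    using assms unfolding hquat_Q_sqrt2_def by simp_all
  obtain u0 v0 where 0: "u0 \<in> \<rat>" "v0 \<in> \<rat>" "h0 w = u0 + v0 * sqrt 2" using wQ(1) by (rule Q_sqrt2E)
  obtain u1 v1 where 1: "u1 \<in> \<rat>" "v1 \<in> \<rat>" "h1 w = u1 + v1 * sqrt 2" using wQ(2) by (rule Q_sqrt2E)
  obtain u2 v2 where 2: "u2 \<in> \<rat>" "v2 \<in> \<rat>" "h2 w = u2 + v2 * sqrt 2" using wQ(3) by (rule Q_sqrt2E)
  obtain u3 v3 where 3: "u3 \<in> \<rat>" "v3 \<in> \<rat>" "h3 w = u3 + v3 * sqrt 2" using wQ(4) by (rule Q_sqrt2E)
  note rat = 0(1,2) 1(1,2) 2(1,2) 3(1,2) and w = 0(3) 1(3) 2(3) 3(3)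
  obtain b0 b1 b2 b3 :: int where b: "even (b0 + b1 + b2 + b3)"
    "(2 * v0 - of_int b0)\<^sup>2 + (2 * v1 - of_int b1)\<^sup>2 + (2 * v2 - of_int b2)\<^sup>2 + (2 * v3 - of_int b3)\<^sup>2 \<le> 1"
    using D4_covering by metis
  define s0 s1 s2 s3 where s: "s0 = v0 - of_int b0 / 2" "s1 = v1 - of_int b1 / 2" "s2 = v2 - of_int b2 / 2" "s3 = v3 - of_int b3 / 2"
  have "2 * v0 - of_int b0 = 2 * s0" "2 * v1 - of_int b1 = 2 * s1" "2 * v2 - of_int b2 = 2 * s2" "2 * v3 - of_int b3 = 2 * s3"
    by (simp_all add: s)
  with b(2) have S: "s0\<^sup>2 + s1\<^sup>2 + s2\<^sup>2 + s3\<^sup>2 \<le> 1/4" by (simp add: power_mult_distrib)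
  obtain a0 a1 a2 a3 :: int where a: "even (a0 + a1)" "even (a0 + a2)" "even (a0 + a3)"
    and T': "(u0 - of_int a0 / 2)\<^sup>2 + (u1 - of_int a1 / 2)\<^sup>2 + (u2 - of_int a2 / 2)\<^sup>2 + (u3 - of_int a3 / 2)\<^sup>2 \<le> 1/2"
      "(s0 = 0 \<and> s1 = 0 \<and> s2 = 0 \<and> s3 = 0) \<or> (u0 - of_int a0 / 2)\<^sup>2 + (u1 - of_int a1 / 2)\<^sup>2 + (u2 - of_int a2 / 2)\<^sup>2 + (u3 - of_int a3 / 2)\<^sup>2 < 1/2
       \<or> (u0 - of_int a0 / 2) * s0 + (u1 - of_int a1 / 2) * s1 + (u2 - of_int a2 / 2) * s2 + (u3 - of_int a3 / 2) * s3 \<noteq> 0"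
    using D4_dual_covering_off_hyperplane[of u0 u1 u2 u3 s0 s1 s2 s3] unfolding Let_def by blast
  define t0 t1 t2 t3 where t: "t0 = u0 - of_int a0 / 2" "t1 = u1 - of_int a1 / 2" "t2 = u2 - of_int a2 / 2" "t3 = u3 - of_int a3 / 2"
  note T = T'[folded t]
  define k where "k = HQuat ((of_int a0 + of_int b0 * sqrt 2) / 2) ((of_int a1 + of_int b1 * sqrt 2) / 2)
    ((of_int a2 + of_int b2 * sqrt 2) / 2) ((of_int a3 + of_int b3 * sqrt 2) / 2)"
  have "k \<in> octa" unfolding k_def by (rule octa_half_integers[OF a b(1)])
  define P where "P = t0\<^sup>2 + t1\<^sup>2 + t2\<^sup>2 + t3\<^sup>2 + 2 * (s0\<^sup>2 + s1\<^sup>2 + s2\<^sup>2 + s3\<^sup>2)"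
  define Q where "Q = t0 * s0 + t1 * s1 + t2 * s2 + t3 * s3"
  have wk: "w - k = HQuat (t0 + s0 * sqrt 2) (t1 + s1 * sqrt 2) (t2 + s2 * sqrt 2) (t3 + s3 * sqrt 2)"
    by (simp add: minus_hquat_def w k_def t s field_simps)
  have eq: "hnr (w - k) = P + (2 * Q) * sqrt 2"
    unfolding wk hnr_def P_def Q_def by (simp add: power2_eq_square algebra_simps sqrt2_mult_self)
  have "P \<in> \<rat>" "2 * Q \<in> \<rat>" using rat by (simp_all add: P_def Q_def t s)
  then have N: "norm_sqrt2 (hnr (w - k)) = P\<^sup>2 - 8 * Q\<^sup>2"
    unfolding eq by (simp add: norm_sqrt2_eq power_mult_distrib)
  have "P + 2 * Q * sqrt 2 = (t0 + s0 * sqrt 2)\<^sup>2 + (t1 + s1 * sqrt 2)\<^sup>2 + (t2 + s2 * sqrt 2)\<^sup>2 + (t3 + s3 * sqrt 2)\<^sup>2"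
    "P - 2 * Q * sqrt 2 = (t0 - s0 * sqrt 2)\<^sup>2 + (t1 - s1 * sqrt 2)\<^sup>2 + (t2 - s2 * sqrt 2)\<^sup>2 + (t3 - s3 * sqrt 2)\<^sup>2"
    unfolding P_def Q_def by (simp_all add: power2_eq_square algebra_simps sqrt2_mult_self)
  then have "0 \<le> (P + 2 * Q * sqrt 2) * (P - 2 * Q * sqrt 2)" by simp
  also have "\<dots> = P\<^sup>2 - 8 * Q\<^sup>2" by (simp add: power2_eq_square algebra_simps sqrt2_mult_self)
  finally have low: "0 \<le> P\<^sup>2 - 8 * Q\<^sup>2" .
  have P: "0 \<le> P" "P \<le> 1" unfolding P_def using T(1) S by simp_all
  have "P\<^sup>2 - 8 * Q\<^sup>2 < 1"
  proof (cases "P < 1")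
    case True
    then have "P\<^sup>2 < 1" using P by (simp add: power_less_one_iff abs_square_less_1)
    then show ?thesis using zero_le_power2[of Q] by linarith
  next
    case False
    then have "\<not> (s0 = 0 \<and> s1 = 0 \<and> s2 = 0 \<and> s3 = 0)" "\<not> t0\<^sup>2 + t1\<^sup>2 + t2\<^sup>2 + t3\<^sup>2 < 1/2"
      using T(1) S unfolding P_def by auto
    then have "Q \<noteq> 0" using T(2) unfolding Q_def by blast
    then have "Q\<^sup>2 > 0" by simp
    moreover have "P = 1" using False P by simp
    ultimately show ?thesis by simp
  qed
  with low have "\<bar>norm_sqrt2 (hnr (w - k))\<bar> < 1" unfolding N by (simp only: abs_of_nonneg)
  with \<open>k \<in> octa\<close> show ?thesis by blast
qed

lemma octa_division:
  assumes "y \<in> octa" "g \<in> octa" "g \<noteq> 0"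
  shows "\<exists>k\<in>octa. \<bar>norm_sqrt2 (hnr (y - k * g))\<bar> < \<bar>norm_sqrt2 (hnr g)\<bar>"
proof -
  have gQ: "hnr g \<in> Q_sqrt2" "hnr g \<noteq> 0"
    using assms octa_hnr Z_sqrt2_subset_Q_sqrt2 by (auto simp: hnr_eq_0_iff)
  define w where "w = hreal (inverse (hnr g)) * (y * hconj g)"
  have wQ: "w \<in> hquat_Q_sqrt2"
    unfolding w_def using assms gQ octa_mult octa_hconj octa_subset_hquat_Q_sqrt2
    by (intro hquat_Q_sqrt2_mult hquat_Q_sqrt2_hreal) auto
  have "w * g = hreal (inverse (hnr g)) * (y * (hconj g * g))" unfolding w_def by (simp add: mult.assoc)
  also have "\<dots> = hreal (inverse (hnr g) * hnr g) * y"
    unfolding mult_hconj hreal_commute by (simp only: hreal_simps mult.assoc[symmetric])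
  finally have wg: "w * g = y" using gQ by (simp add: hreal_simps)
  obtain k where k: "k \<in> octa" "\<bar>norm_sqrt2 (hnr (w - k))\<bar> < 1" using octa_approx[OF wQ] by blast
  have "y - k * g = (w - k) * g" using wg by (simp add: left_diff_distrib)
  then have "\<bar>norm_sqrt2 (hnr (y - k * g))\<bar> = \<bar>norm_sqrt2 (hnr (w - k))\<bar> * \<bar>norm_sqrt2 (hnr g)\<bar>"
    using norm_sqrt2_mult[OF hquat_Q_sqrt2_hnr gQ(1), of "w - k"] wQ k(1) octa_subset_hquat_Q_sqrt2 hquat_Q_sqrt2_diff
    by (auto simp: hnr_mult abs_mult)
  also have "\<dots> < \<bar>norm_sqrt2 (hnr g)\<bar>"
  proof -
    have "norm_sqrt2 (hnr g) \<noteq> 0" using norm_sqrt2_eq_0[OF gQ(1)] gQ(2) by blast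
    then have "0 < \<bar>norm_sqrt2 (hnr g)\<bar>" by simp
    from mult_strict_right_mono[OF k(2) this] show ?thesis by (simp only: mult_1_left)
  qed
  finally show ?thesis using k(1) by blast
qed

theorem octa_left_ideal_principal:
  assumes I: "is_add_subgroup I" "I \<subseteq> octa" and ideal: "\<And>k x. k \<in> octa \<Longrightarrow> x \<in> I \<Longrightarrow> k * x \<in> I"
    and "\<not> I \<subseteq> {0}"
  shows "\<exists>q\<in>I. q \<noteq> 0 \<and> (\<forall>y\<in>I. \<exists>k\<in>octa. y = k * q)"
proof -
  define \<mu> where "\<mu> x = nat \<lfloor>\<bar>norm_sqrt2 (hnr x)\<bar>\<rfloor>" for x
  have \<mu>: "real (\<mu> x) = \<bar>norm_sqrt2 (hnr x)\<bar>" if "x \<in> octa" for x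
    using octa_hnr[OF that] unfolding \<mu>_def
    by (elim norm_sqrt2_Z_sqrt2) (simp del: of_int_diff of_int_mult of_int_power flip: of_int_abs)
  define q where "q = arg_min \<mu> (\<lambda>x. x \<in> I \<and> x \<noteq> 0)"
  have q: "q \<in> I" "q \<noteq> 0" and qmin: "\<And>x. x \<in> I \<Longrightarrow> x \<noteq> 0 \<Longrightarrow> \<mu> q \<le> \<mu> x"
  proof -
    obtain x where "x \<in> I \<and> x \<noteq> 0" using assms(4) by blast
    then show "q \<in> I" "q \<noteq> 0" unfolding q_def using arg_min_natI[of "\<lambda>x. x \<in> I \<and> x \<noteq> 0" x \<mu>] by auto
    show "\<And>x. x \<in> I \<Longrightarrow> x \<noteq> 0 \<Longrightarrow> \<mu> q \<le> \<mu> x" unfolding q_def by (rule arg_min_nat_le) simp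
  qed
  have "\<exists>k\<in>octa. y = k * q" if y: "y \<in> I" for y
  proof -
    obtain k where k: "k \<in> octa" "\<bar>norm_sqrt2 (hnr (y - k * q))\<bar> < \<bar>norm_sqrt2 (hnr q)\<bar>"
      using octa_division[of y q] y q I(2) by blast
    have r: "y - k * q \<in> I" using ideal[OF k(1) q(1)] y add_subgroup_diff[OF I(1)] by blast
    have "\<mu> (y - k * q) < \<mu> q"
      using k(2) \<mu>[of q] \<mu>[of "y - k * q"] r q I(2) by (metis of_nat_less_iff subsetD)
    with qmin[OF r] have "y - k * q = 0" by fastforce
    then show ?thesis using k(1) by auto
  qed
  with q show ?thesis by blast
qed

section \<open>The module \<open>Im_K\<close> and its dual\<close>

text \<open>The three conditions express the coordinates with respect to the basis
  \<open>(\<surd>2/2) e\<^sub>1, (\<surd>2/2) e\<^sub>2, (1, 1, 1)/2\<close>.\<close>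

lemma Im_K_iff:
  "x \<in> Im_K \<longleftrightarrow> sqrt 2 * (x $ 1 - x $ 3) \<in> Z_sqrt2 \<and> sqrt 2 * (x $ 2 - x $ 3) \<in> Z_sqrt2 \<and> 2 * x $ 3 \<in> Z_sqrt2"
proof
  assume "x \<in> Im_K"
  let ?vs = "[vector [1, 0, 0], vector [0, 1, 0], (1 / sqrt 2) *\<^sub>R vector [1, 1, 1]] :: (real ^ 3) list"
  from \<open>x \<in> Im_K\<close> obtain y where y: "y \<in> module_span Z_sqrt2 ?vs" and x: "x = (1 / sqrt 2) *\<^sub>R y"
    unfolding Im_K_eq by blast
  from y obtain c where c: "\<And>n. n < length ?vs \<Longrightarrow> c n \<in> Z_sqrt2"
    and yc: "y = (\<Sum>n<length ?vs. c n *\<^sub>R ?vs ! n)"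
    by (rule module_spanE) iprover
  have "x $ 1 = c 0 * (sqrt 2 / 2) + c 2 / 2" "x $ 2 = c 1 * (sqrt 2 / 2) + c 2 / 2" "x $ 3 = c 2 / 2"
    unfolding x yc by (simp_all add: inverse_sqrt2 numeral_2_eq_2 numeral_3_eq_3 lessThan_Suc algebra_simps sqrt2_mult_self)
  then have "sqrt 2 * (x $ 1 - x $ 3) = c 0" "sqrt 2 * (x $ 2 - x $ 3) = c 1" "2 * x $ 3 = c 2"
    by (simp_all add: algebra_simps sqrt2_mult_self)
  then show "sqrt 2 * (x $ 1 - x $ 3) \<in> Z_sqrt2 \<and> sqrt 2 * (x $ 2 - x $ 3) \<in> Z_sqrt2 \<and> 2 * x $ 3 \<in> Z_sqrt2"
    using c by simp
next
  assume z: "sqrt 2 * (x $ 1 - x $ 3) \<in> Z_sqrt2 \<and> sqrt 2 * (x $ 2 - x $ 3) \<in> Z_sqrt2 \<and> 2 * x $ 3 \<in> Z_sqrt2"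
  let ?vs = "[vector [1, 0, 0], vector [0, 1, 0], (1 / sqrt 2) *\<^sub>R vector [1, 1, 1 :: real]] :: (real ^ 3) list"
  define c :: "nat \<Rightarrow> real" where "c n = (if n = 0 then sqrt 2 * (x $ 1 - x $ 3)
    else if n = 1 then sqrt 2 * (x $ 2 - x $ 3) else 2 * x $ 3)" for n
  have "(\<Sum>n<length ?vs. c n *\<^sub>R ?vs ! n) \<in> module_span Z_sqrt2 ?vs"
    by (rule module_spanI) (use z in \<open>simp add: c_def\<close>)
  moreover have "x = (1 / sqrt 2) *\<^sub>R (\<Sum>n<length ?vs. c n *\<^sub>R ?vs ! n)"
    by (simp add: vec_eq_iff forall_3 lessThan_Suc c_def inverse_sqrt2 algebra_simps sqrt2_mult_self)
  ultimately show "x \<in> Im_K" unfolding Im_K_eq by blast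
qed

lemma Im_KE:
  assumes "x \<in> Im_K"
  obtains p q r where "p \<in> Z_sqrt2" "q \<in> Z_sqrt2" "r \<in> Z_sqrt2"
    "x $ 1 = p * sqrt 2 / 2 + r / 2" "x $ 2 = q * sqrt 2 / 2 + r / 2" "x $ 3 = r / 2"
proof (rule that[of "sqrt 2 * (x $ 1 - x $ 3)" "sqrt 2 * (x $ 2 - x $ 3)" "2 * x $ 3"])
  have k: "sqrt 2 * y * sqrt 2 = 2 * y" for y by (simp add: mult.commute sqrt2_mult_self)
  show "x $ 1 = sqrt 2 * (x $ 1 - x $ 3) * sqrt 2 / 2 + 2 * x $ 3 / 2"
    "x $ 2 = sqrt 2 * (x $ 2 - x $ 3) * sqrt 2 / 2 + 2 * x $ 3 / 2" unfolding k by (simp_all add: field_simps)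
qed (use assms in \<open>simp_all add: Im_K_iff\<close>)

definition dual_Im_K :: "(real ^ 3) set" where
  "dual_Im_K = {v. \<forall>x\<in>Im_K. v \<bullet> x \<in> Z_sqrt2}"

lemma inner_3: "(v :: real ^ 3) \<bullet> x = v $ 1 * x $ 1 + v $ 2 * x $ 2 + v $ 3 * x $ 3"
  by (simp add: inner_vec_def sum_3)

lemma dual_Im_K_iff:
  "v \<in> dual_Im_K \<longleftrightarrow> v $ 1 * sqrt 2 / 2 \<in> Z_sqrt2 \<and> v $ 2 * sqrt 2 / 2 \<in> Z_sqrt2
    \<and> (v $ 1 + v $ 2 + v $ 3) / 2 \<in> Z_sqrt2"
proof
  assume v: "v \<in> dual_Im_K"
  have "vector [sqrt 2 / 2, 0, 0] \<in> Im_K" "vector [0, sqrt 2 / 2, 0] \<in> Im_K" "vector [1/2, 1/2, 1/2] \<in> Im_K"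
    by (simp_all add: Im_K_iff)
  then have "v \<bullet> vector [sqrt 2 / 2, 0, 0] \<in> Z_sqrt2" "v \<bullet> vector [0, sqrt 2 / 2, 0] \<in> Z_sqrt2"
    "v \<bullet> vector [1/2, 1/2, 1/2] \<in> Z_sqrt2" using v unfolding dual_Im_K_def by blast+
  then show "v $ 1 * sqrt 2 / 2 \<in> Z_sqrt2 \<and> v $ 2 * sqrt 2 / 2 \<in> Z_sqrt2 \<and> (v $ 1 + v $ 2 + v $ 3) / 2 \<in> Z_sqrt2"
    by (simp add: inner_3 add_divide_distrib)
next
  assume v: "v $ 1 * sqrt 2 / 2 \<in> Z_sqrt2 \<and> v $ 2 * sqrt 2 / 2 \<in> Z_sqrt2 \<and> (v $ 1 + v $ 2 + v $ 3) / 2 \<in> Z_sqrt2"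
  show "v \<in> dual_Im_K" unfolding dual_Im_K_def
  proof (intro CollectI ballI)
    fix x assume "x \<in> Im_K"
    then obtain p q r where z: "p \<in> Z_sqrt2" "q \<in> Z_sqrt2" "r \<in> Z_sqrt2"
      and x: "x $ 1 = p * sqrt 2 / 2 + r / 2" "x $ 2 = q * sqrt 2 / 2 + r / 2" "x $ 3 = r / 2" by (rule Im_KE)
    have "v \<bullet> x = p * (v $ 1 * sqrt 2 / 2) + q * (v $ 2 * sqrt 2 / 2) + r * ((v $ 1 + v $ 2 + v $ 3) / 2)"
      unfolding inner_3 x by (simp add: field_simps)
    also have "\<dots> \<in> Z_sqrt2" using v z by blast
    finally show "v \<bullet> x \<in> Z_sqrt2" .
  qed
qed

lemma dual_Im_K_inner: "v \<in> dual_Im_K \<Longrightarrow> x \<in> Im_K \<Longrightarrow> v \<bullet> x \<in> Z_sqrt2"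
  by (simp add: dual_Im_K_def)

lemma Im_K_if_dual:
  assumes "\<And>v. v \<in> dual_Im_K \<Longrightarrow> v \<bullet> x \<in> Z_sqrt2"
  shows "x \<in> Im_K"
proof -
  have "vector [sqrt 2, 0, - sqrt 2] \<in> dual_Im_K" "vector [0, sqrt 2, - sqrt 2] \<in> dual_Im_K" "vector [0, 0, 2] \<in> dual_Im_K"
    by (simp_all add: dual_Im_K_iff)
  from this[THEN assms] show ?thesis by (simp add: Im_K_iff inner_3 algebra_simps)
qed

text \<open>Cross products exchange a lattice with its dual, up to the covolume, which is \<open>1/4\<close> for
  \<open>Im_K\<close> over \<open>\<int>[\<surd>2]\<close>.\<close>

lemma cross_dual_Im_K:
  assumes "v \<in> dual_Im_K" "w \<in> dual_Im_K"
  shows "(1/4) *\<^sub>R cross3 v w \<in> Im_K"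
proof -
  define a1 a2 e where "a1 = v $ 1 * sqrt 2 / 2" "a2 = v $ 2 * sqrt 2 / 2" "e = (v $ 1 + v $ 2 + v $ 3) / 2"
  define b1 b2 f where "b1 = w $ 1 * sqrt 2 / 2" "b2 = w $ 2 * sqrt 2 / 2" "f = (w $ 1 + w $ 2 + w $ 3) / 2"
  note defs = this \<open>a1 = v $ 1 * sqrt 2 / 2\<close> \<open>a2 = v $ 2 * sqrt 2 / 2\<close> \<open>e = (v $ 1 + v $ 2 + v $ 3) / 2\<close>
  have z: "a1 \<in> Z_sqrt2" "a2 \<in> Z_sqrt2" "e \<in> Z_sqrt2" "b1 \<in> Z_sqrt2" "b2 \<in> Z_sqrt2" "f \<in> Z_sqrt2"
    using assms unfolding dual_Im_K_iff defs by blast+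
  have v: "v $ 1 = sqrt 2 * a1" "v $ 2 = sqrt 2 * a2" "v $ 3 = 2 * e - sqrt 2 * (a1 + a2)"
    and w: "w $ 1 = sqrt 2 * b1" "w $ 2 = sqrt 2 * b2" "w $ 3 = 2 * f - sqrt 2 * (b1 + b2)"
    unfolding defs by (simp_all add: algebra_simps sqrt2_mult_self add_divide_distrib)
  let ?c = "(1/4) *\<^sub>R cross3 v w"
  have "sqrt 2 * (?c $ 1 - ?c $ 3) = a2 * f - b2 * e" "sqrt 2 * (?c $ 2 - ?c $ 3) = b1 * e - a1 * f"
    "2 * ?c $ 3 = a1 * b2 - a2 * b1"
    by (simp_all add: cross3_def v w field_simps sqrt2_mult_self)
  note c = this
  show ?thesis unfolding Im_K_iff c using z by blast
qed

lemma cross_Im_K: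
  assumes "x \<in> Im_K" "y \<in> Im_K"
  shows "4 *\<^sub>R cross3 x y \<in> dual_Im_K"
proof -
  obtain p q r where z: "p \<in> Z_sqrt2" "q \<in> Z_sqrt2" "r \<in> Z_sqrt2"
    and x: "x $ 1 = p * sqrt 2 / 2 + r / 2" "x $ 2 = q * sqrt 2 / 2 + r / 2" "x $ 3 = r / 2" 
    using assms(1) by (rule Im_KE)
  obtain p' q' r' where z': "p' \<in> Z_sqrt2" "q' \<in> Z_sqrt2" "r' \<in> Z_sqrt2"
    and y: "y $ 1 = p' * sqrt 2 / 2 + r' / 2" "y $ 2 = q' * sqrt 2 / 2 + r' / 2" "y $ 3 = r' / 2" 
    using assms(2) by (rule Im_KE)
  let ?c = "4 *\<^sub>R cross3 x y"
  have "?c $ 1 * sqrt 2 / 2 = q * r' - r * q'" "?c $ 2 * sqrt 2 / 2 = r * p' - p * r'"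
    "(?c $ 1 + ?c $ 2 + ?c $ 3) / 2 = p * q' - q * p'"
    by (simp_all add: cross3_def x y field_simps sqrt2_mult_self)
  note c = this
  show ?thesis unfolding dual_Im_K_iff c using z z' by blast
qed

lemma Im_K_subgroup: "is_add_subgroup Im_K"
proof -
  have "x - y \<in> Im_K" if "x \<in> Im_K" "y \<in> Im_K" for x y
    by (rule Im_K_if_dual) (use that dual_Im_K_inner in \<open>auto simp: inner_diff_right\<close>)
  moreover have "0 \<in> Im_K" by (simp add: Im_K_iff)
  ultimately show ?thesis unfolding is_add_subgroup_def by blast
qed

lemma Im_K_scale: "c \<in> Z_sqrt2 \<Longrightarrow> x \<in> Im_K \<Longrightarrow> c *\<^sub>R x \<in> Im_K"
  by (rule Im_K_if_dual) (use dual_Im_K_inner in auto)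

lemma dual_Im_K_add_scale: "v \<in> dual_Im_K \<Longrightarrow> w \<in> dual_Im_K \<Longrightarrow> c \<in> Z_sqrt2 \<Longrightarrow> v + c *\<^sub>R w \<in> dual_Im_K"
  unfolding dual_Im_K_def by (auto simp: inner_add_left)

lemma dual_Im_K_diff: "v \<in> dual_Im_K \<Longrightarrow> w \<in> dual_Im_K \<Longrightarrow> v - w \<in> dual_Im_K"
  unfolding dual_Im_K_def by (auto simp: inner_diff_left)

lemma Im_K_submodule: "is_submodule Im_K"
  using Im_K_subgroup Im_K_scale by (auto simp: is_submodule_def)

section \<open>The coincidence index of a rotation of rank one modulo its denominator\<close>

lemma coincidence_set_eq:
  assumes "orthogonal_matrix S"
  shows "Im_K \<inter> (*v) (transpose S) ` Im_K = {x \<in> Im_K. S *v x \<in> Im_K}"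
proof -
  have inv: "S *v (transpose S *v y) = y" "transpose S *v (S *v y) = y" for y
    unfolding matrix_vector_mul_assoc using assms by (simp_all add: orthogonal_matrix_def)
  then have "x \<in> (*v) (transpose S) ` Im_K \<longleftrightarrow> S *v x \<in> Im_K" for x
    by (metis (no_types, lifting) imageE imageI)
  then show ?thesis by blast
qed

text \<open>Let \<open>\<beta> S\<close> and \<open>\<beta> S\<^sup>T\<close> be integral. The two by two minors of \<open>\<beta> S\<close> are entries of \<open>\<beta>\<^sup>2 S\<close>, hence
  divisible by \<open>\<beta>\<close>, so that \<open>\<beta> S\<close> has rank one modulo \<open>\<beta>\<close>. If moreover some value \<open>v \<bullet> \<beta> S g\<close> is \<open>1\<close>
  modulo \<open>\<beta>\<close>, then \<open>\<beta> S x\<close> is divisible by \<open>\<beta>\<close> as soon as \<open>v \<bullet> \<beta> S x\<close> is, and the index is that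
  of the ideal generated by \<open>\<beta>\<close>.\<close>

theorem index_of_rank_one:
  assumes S: "rotation_matrix S" and b: "\<beta> \<in> Z_sqrt2" "\<beta> \<noteq> 0"
    and int: "\<And>x. x \<in> Im_K \<Longrightarrow> \<beta> *\<^sub>R (S *v x) \<in> Im_K"
    and intT: "\<And>x. x \<in> Im_K \<Longrightarrow> \<beta> *\<^sub>R (transpose S *v x) \<in> Im_K"
    and g: "g \<in> Im_K" and v: "v \<in> dual_Im_K" and one: "v \<bullet> (\<beta> *\<^sub>R (S *v g)) - 1 \<in> multiples \<beta>"
  shows "coincidence_index Im_K (transpose S) = add_index Z_sqrt2 (multiples \<beta>)"
proof -
  define f where "f x = v \<bullet> (\<beta> *\<^sub>R (S *v x))" for x
  have f_diff: "f x - f y = f (x - y)" for x y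
    by (simp add: f_def matrix_vector_mult_diff_distrib inner_diff_right right_diff_distrib)
  have fZ: "f x \<in> Z_sqrt2" if "x \<in> Im_K" for x
    unfolding f_def using dual_Im_K_inner[OF v int[OF that]] .
  have iff: "f x \<in> multiples \<beta> \<longleftrightarrow> S *v x \<in> Im_K" if x: "x \<in> Im_K" for x
  proof
    assume "S *v x \<in> Im_K"
    then have "\<beta> * (v \<bullet> (S *v x)) \<in> multiples \<beta>" using dual_Im_K_inner[OF v] by (intro multiplesI)
    then show "f x \<in> multiples \<beta>" by (simp add: f_def)
  next
    assume "f x \<in> multiples \<beta>"
    then obtain c where c: "c \<in> Z_sqrt2" "f x = \<beta> * c" by (rule multiplesE)
    obtain e where e: "e \<in> Z_sqrt2" "f g = 1 + \<beta> * e" using one by (elim multiplesE) (auto simp: f_def algebra_simps)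
    show "S *v x \<in> Im_K"
    proof (rule Im_K_if_dual)
      fix w assume w: "w \<in> dual_Im_K"
      \<comment> \<open>a two by two minor of \<open>\<beta> S\<close>, divided by \<open>\<beta>\<close>\<close>
      define k where "k = ((1/4) *\<^sub>R cross3 w v) \<bullet> (\<beta> *\<^sub>R (S *v (4 *\<^sub>R cross3 x g)))"
      \<comment> \<open>\<open>k\<close> is integral because \<open>S\<close> can be moved to the left factor, as its transpose\<close>
      have "k = (\<beta> *\<^sub>R (transpose S *v ((1/4) *\<^sub>R cross3 w v))) \<bullet> (4 *\<^sub>R cross3 x g)"
      proof -
        have adj: "u \<bullet> (S *v y) = (transpose S *v u) \<bullet> y" for u y by (simp add: dot_lmul_matrix)
        show ?thesis unfolding k_def inner_scaleR_right adj inner_scaleR_left by simp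
      qed
      then have kZ: "k \<in> Z_sqrt2"
        using dual_Im_K_inner[OF cross_Im_K[OF x g] intT[OF cross_dual_Im_K[OF w v]]]
        by (simp only: inner_commute)
      have "k = \<beta> * (cross3 w v \<bullet> cross3 (S *v x) (S *v g))"
        unfolding k_def cross_rotation_matrix[OF S]
        by (simp add: matrix_vector_mult_scaleR)
      also have "\<dots> = \<beta> * ((w \<bullet> (S *v x)) * (v \<bullet> (S *v g)) - (w \<bullet> (S *v g)) * (v \<bullet> (S *v x)))"
        by (simp add: dot_cross)
      finally have k: "k = \<beta> * ((w \<bullet> (S *v x)) * (v \<bullet> (S *v g)) - (w \<bullet> (S *v g)) * (v \<bullet> (S *v x)))" .
      have "\<beta> * k = (w \<bullet> (\<beta> *\<^sub>R (S *v x))) * f g - (w \<bullet> (\<beta> *\<^sub>R (S *v g))) * f x"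
        unfolding k by (simp add: f_def algebra_simps)
      then have "\<beta> * (w \<bullet> (S *v x)) = \<beta> * (k + (w \<bullet> (\<beta> *\<^sub>R (S *v g))) * c - (w \<bullet> (\<beta> *\<^sub>R (S *v x))) * e)"
        unfolding c(2) e(2) by (simp add: algebra_simps)
      then have "w \<bullet> (S *v x) = k + (w \<bullet> (\<beta> *\<^sub>R (S *v g))) * c - (w \<bullet> (\<beta> *\<^sub>R (S *v x))) * e"
        by (rule mult_left_cancel[OF b(2), THEN iffD1])
      also have "\<dots> \<in> Z_sqrt2"
        using kZ c e dual_Im_K_inner[OF w int] x g by (intro Z_sqrt2_diff Z_sqrt2_add Z_sqrt2_mult)
      finally show "w \<bullet> (S *v x) \<in> Z_sqrt2" .
    qed
  qed
  have "is_add_subgroup {x \<in> Im_K. S *v x \<in> Im_K}"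
    using Im_K_subgroup unfolding is_add_subgroup_def by (auto simp: matrix_vector_mult_diff_distrib)
  then have "add_index Im_K {x \<in> Im_K. S *v x \<in> Im_K} = add_index Z_sqrt2 (multiples \<beta>)"
  proof (rule index_preimage[where f = f])
    show "(f x - f y \<in> multiples \<beta>) = (x - y \<in> {x \<in> Im_K. S *v x \<in> Im_K})" if "x \<in> Im_K" "y \<in> Im_K" for x y
      using iff[of "x - y"] add_subgroup_diff[OF Im_K_subgroup that] by (simp add: f_diff)
    show "\<exists>x\<in>Im_K. f x - y \<in> multiples \<beta>" if "y \<in> Z_sqrt2" for y
    proof (rule bexI[OF _ Im_K_scale[OF that g]])
      have "f (y *\<^sub>R g) - y = (f g - 1) * y" by (simp add: f_def matrix_vector_mult_scaleR algebra_simps)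
      then show "f (y *\<^sub>R g) - y \<in> multiples \<beta>" using multiples_mult[OF one that] by (simp add: f_def)
    qed
  qed (use fZ multiples_subset[OF b(1)] in \<open>auto simp: multiples_subgroup Z_sqrt2_subgroup\<close>)
  then show ?thesis
    using S coincidence_set_eq[of S] unfolding coincidence_index_def rotation_matrix_def by (simp only:)
qed

section \<open>Rotations from primitive quaternions\<close>

definition hIm :: "hquat \<Rightarrow> real ^ 3" where "hIm x = vector [h1 x, h2 x, h3 x]"

lemma hIm_nth [simp]: "hIm x $ 1 = h1 x" "hIm x $ 2 = h2 x" "hIm x $ 3 = h3 x"
  by (simp_all add: hIm_def)

lemma hIm_linear: "hIm (x + y) = hIm x + hIm y" "hIm (x - y) = hIm x - hIm y" "hIm (hreal c * x) = c *\<^sub>R hIm x"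
  by (simp_all add: vec_eq_iff forall_3 hquat_ops hreal_def)

lemma hIm_octa: "x \<in> octa \<Longrightarrow> hIm x \<in> Im_K"
  by (simp add: octa_def Im_K_iff)

lemma Im_K_lift:
  assumes "x \<in> Im_K"
  obtains z where "z \<in> octa" "x = hIm z"
proof
  show "HQuat (x $ 1 + x $ 2 - x $ 3) (x $ 1) (x $ 2) (x $ 3) \<in> octa"
    using assms by (simp add: octa_def Im_K_iff)
qed (simp add: vec_eq_iff forall_3)

text \<open>The rotation \<open>x \<mapsto> q\<^sup>-\<^sup>1 x q\<close>.\<close>

definition hrot :: "hquat \<Rightarrow> real ^ 3 ^ 3" where
  "hrot q = (let a = h0 q; b = h1 q; c = h2 q; d = h3 q in (1 / hnr q) *\<^sub>R vector [
     vector [a\<^sup>2 + b\<^sup>2 - c\<^sup>2 - d\<^sup>2, 2 * (b * c + a * d), 2 * (b * d - a * c)],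
     vector [2 * (b * c - a * d), a\<^sup>2 - b\<^sup>2 + c\<^sup>2 - d\<^sup>2, 2 * (c * d + a * b)],
     vector [2 * (b * d + a * c), 2 * (c * d - a * b), a\<^sup>2 - b\<^sup>2 - c\<^sup>2 + d\<^sup>2]])"

lemma hrot_hIm: "hrot q *v hIm z = (1 / hnr q) *\<^sub>R hIm (hconj q * z * q)"
proof -
  define e where "e = 1 / hnr q"
  show ?thesis
    unfolding hrot_def Let_def e_def[symmetric]
    by (simp add: vec_eq_iff forall_3 matrix_vector_mult_def sum_3 hquat_ops hconj_def)
      (simp add: power2_eq_square algebra_simps)
qed

lemma transpose_hrot: "transpose (hrot q) = hrot (hconj q)"
  unfolding hrot_def Let_def by (simp add: vec_eq_iff forall_3 transpose_def hconj_def hnr_simps(2)[unfolded hconj_def] mult.commute)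

lemma rotation_hrot:
  assumes "q \<noteq> 0"
  shows "rotation_matrix (hrot q)"
proof -
  define n where "n = hnr q"
  have n: "n \<noteq> 0" using assms by (simp add: n_def hnr_eq_0_iff)
  have "transpose (hrot q) ** hrot q = mat 1"
    unfolding matrix_eq
  proof
    fix x :: "real ^ 3"
    define z where "z = HQuat 0 (x $ 1) (x $ 2) (x $ 3)"
    have x: "x = hIm z" by (simp add: z_def vec_eq_iff forall_3)
    have "q * (hconj q * z * q) * hconj q = (q * hconj q) * z * (q * hconj q)" by (simp add: mult.assoc)
    also have "\<dots> = hreal (n * n) * z"
      unfolding mult_hconj n_def[symmetric] hreal_commute[of _ n] by (simp only: mult.assoc[symmetric] hreal_simps)
    finally have "hIm (hconj (hconj q) * (hconj q * z * q) * hconj q) = (n * n) *\<^sub>R hIm z"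
      by (simp add: hconj_simps hIm_linear)
    then have "hrot (hconj q) *v (hrot q *v hIm z) = hIm z"
      using n by (simp add: hrot_hIm matrix_vector_mult_scaleR hnr_simps n_def)
    then show "(transpose (hrot q) ** hrot q) *v x = mat 1 *v x"
      by (simp add: transpose_hrot x flip: matrix_vector_mul_assoc)
  qed
  then have "orthogonal_matrix (hrot q)" by (simp add: orthogonal_matrix)
  moreover have "det (hrot q) = 1"
  proof -
    have id: "(a\<^sup>2 + b\<^sup>2 - c\<^sup>2 - d\<^sup>2) * (a\<^sup>2 - b\<^sup>2 + c\<^sup>2 - d\<^sup>2) * (a\<^sup>2 - b\<^sup>2 - c\<^sup>2 + d\<^sup>2)
      + 2 * (b * c + a * d) * (2 * (c * d + a * b)) * (2 * (b * d + a * c))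
      + 2 * (b * d - a * c) * (2 * (b * c - a * d)) * (2 * (c * d - a * b))
      - (a\<^sup>2 + b\<^sup>2 - c\<^sup>2 - d\<^sup>2) * (2 * (c * d + a * b)) * (2 * (c * d - a * b))
      - 2 * (b * c + a * d) * (2 * (b * c - a * d)) * (a\<^sup>2 - b\<^sup>2 - c\<^sup>2 + d\<^sup>2)
      - 2 * (b * d - a * c) * (a\<^sup>2 - b\<^sup>2 + c\<^sup>2 - d\<^sup>2) * (2 * (b * d + a * c)) = (a\<^sup>2 + b\<^sup>2 + c\<^sup>2 + d\<^sup>2) ^ 3"
      for a b c d :: real by (simp add: power2_eq_square power3_eq_cube algebra_simps)
    define e where "e = 1 / hnr q"
    have "det (hrot q) = e ^ 3 * ((h0 q)\<^sup>2 + (h1 q)\<^sup>2 + (h2 q)\<^sup>2 + (h3 q)\<^sup>2) ^ 3"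
      unfolding id[symmetric] hrot_def Let_def e_def[symmetric] det_3
      by (simp add: power3_eq_cube algebra_simps)
    also have "\<dots> = e ^ 3 * hnr q ^ 3" by (simp add: hnr_def)
    finally show ?thesis using n by (simp add: e_def n_def flip: power_mult_distrib)
  qed
  ultimately show ?thesis by (simp add: rotation_matrix_def)
qed

lemma hrot_Q_sqrt2:
  assumes "q \<in> octa"
  shows "hrot q $ i $ j \<in> Q_sqrt2"
proof -
  have q: "h0 q \<in> Q_sqrt2" "h1 q \<in> Q_sqrt2" "h2 q \<in> Q_sqrt2" "h3 q \<in> Q_sqrt2" "hnr q \<in> Q_sqrt2"
    using assms octa_subset_hquat_Q_sqrt2 hquat_Q_sqrt2_hnr by (auto simp: hquat_Q_sqrt2_def)
  then have "\<forall>i j. hrot q $ i $ j \<in> Q_sqrt2"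
    unfolding hrot_def Let_def
    by (simp add: forall_3 power2_eq_square Q_sqrt2_add Q_sqrt2_diff Q_sqrt2_mult Q_sqrt2_divide)
  then show ?thesis by blast
qed

text \<open>Let \<open>x\<close> have a norm divisible by \<open>\<alpha>\<close> without being divisible by any prime factor of \<open>\<alpha>\<close>, which
  the last hypothesis expresses. The left ideal generated by \<open>\<alpha>\<close> and \<open>x\<close> is principal, and its generator
  \<open>q\<close> has the norm \<open>\<alpha> \<nu>\<close> for some \<open>\<nu>\<close>. As \<open>\<nu>\<close> divides \<open>q\<close>, and thereby both \<open>\<alpha>\<close> and \<open>x\<close>, it is a unit.\<close>

theorem rotation_of_primitive_zero:
  assumes x: "x \<in> octa" and \<alpha>: "\<alpha> \<in> Z_sqrt2" "\<alpha> \<noteq> 0" "hnr x \<in> multiples \<alpha>"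
    and g: "g \<in> octa" and v: "v \<in> dual_Im_K" and one: "v \<bullet> hIm (hconj x * g * x) - 1 \<in> multiples \<alpha>"
  shows "\<exists>R\<in>SO3 Q_sqrt2. coincidence_index Im_K R = add_index Z_sqrt2 (multiples \<alpha>)"
proof -
  define I where "I = {c * hreal \<alpha> + d * x | c d. c \<in> octa \<and> d \<in> octa}"
  have II: "c * hreal \<alpha> + d * x \<in> I" if "c \<in> octa" "d \<in> octa" for c d using that unfolding I_def by blast
  have "\<exists>q\<in>I. q \<noteq> 0 \<and> (\<forall>y\<in>I. \<exists>k\<in>octa. y = k * q)"
  proof (rule octa_left_ideal_principal)
    show "is_add_subgroup I"
      unfolding is_add_subgroup_def
    proof (intro conjI ballI)
      show "0 \<in> I" using II[OF octa_zero octa_zero] by simp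
      fix y z assume "y \<in> I" "z \<in> I"
      then obtain c d c' d' where "y = c * hreal \<alpha> + d * x" "z = c' * hreal \<alpha> + d' * x"
        "c \<in> octa" "d \<in> octa" "c' \<in> octa" "d' \<in> octa" unfolding I_def by blast
      moreover from this have "(c - c') * hreal \<alpha> + (d - d') * x \<in> I" by (intro II octa_diff)
      ultimately show "y - z \<in> I" by (simp add: algebra_simps)
    qed
    show "I \<subseteq> octa" unfolding I_def using x \<alpha> by (auto intro!: octa_add octa_mult simp: hreal_in_octa_iff)
    show "k * y \<in> I" if "k \<in> octa" "y \<in> I" for k y
    proof -
      from that obtain c d where "y = c * hreal \<alpha> + d * x" "c \<in> octa" "d \<in> octa" unfolding I_def by blast
      then show ?thesis using II[of "k * c" "k * d"] that octa_mult by (simp add: distrib_left mult.assoc)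
    qed
    have "hreal \<alpha> \<in> I" using II[OF octa_one octa_zero] by simp
    moreover have "hreal \<alpha> \<noteq> 0" using \<alpha> by (simp add: hreal_def hquat_ops)
    ultimately show "\<not> I \<subseteq> {0}" by blast
  qed
  then obtain q where q: "q \<in> I" "q \<noteq> 0" and gen: "\<And>y. y \<in> I \<Longrightarrow> \<exists>k\<in>octa. y = k * q" by blast
  obtain c d where cd: "c \<in> octa" "d \<in> octa" "q = c * hreal \<alpha> + d * x" using q(1) unfolding I_def by blast
  have qo: "q \<in> octa" unfolding cd using cd x \<alpha> by (auto intro!: octa_add octa_mult simp: hreal_in_octa_iff)
  obtain a where a: "a \<in> octa" "hreal \<alpha> = a * q" using gen[OF II[OF octa_one octa_zero]] by auto
  obtain b where b: "b \<in> octa" "x = b * q" using gen[OF II[OF octa_zero octa_one]] by auto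
  obtain \<nu> where \<nu>: "\<nu> \<in> Z_sqrt2" "hnr q = \<alpha> * \<nu>"
  proof -
    obtain t where t: "t \<in> Z_sqrt2" "hnr x = \<alpha> * t" using \<alpha>(3) by (rule multiplesE)
    have q': "q = hreal \<alpha> * c + d * x" unfolding cd(3) hreal_commute ..
    have "hreal \<alpha> * c * hconj (d * x) = hreal \<alpha> * (c * hconj (d * x))" by (simp add: mult.assoc)
    then have h0: "h0 (hreal \<alpha> * c * hconj (d * x)) = \<alpha> * h0 (c * hconj (d * x))"
      by (simp add: hreal_def times_hquat_def)
    have "hnr q = \<alpha> * (\<alpha> * hnr c + 2 * h0 (c * hconj (d * x)) + hnr d * t)"
      unfolding q' hnr_add h0 hnr_mult t hnr_simps by (simp add: algebra_simps power2_eq_square)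
    moreover have "2 * h0 (c * hconj (d * x)) \<in> Z_sqrt2"
      using cd x by (intro octa_trace octa_mult octa_hconj)
    then have "\<alpha> * hnr c + 2 * h0 (c * hconj (d * x)) + hnr d * t \<in> Z_sqrt2"
      using cd \<alpha> t octa_hnr by blast
    ultimately show thesis by (rule that[rotated])
  qed
  have "hreal \<alpha> * hconj q = a * hreal (hnr q)" unfolding a(2) by (simp add: mult.assoc mult_hconj)
  also have "\<dots> = hreal \<alpha> * (hreal \<nu> * a)" unfolding hreal_commute \<nu>(2) by (simp add: mult.assoc flip: hreal_simps(5))
  finally have "hreal (1 / \<alpha>) * (hreal \<alpha> * hconj q) = hreal (1 / \<alpha>) * (hreal \<alpha> * (hreal \<nu> * a))" by simp
  then have qa: "hconj q = hreal \<nu> * a"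
    using \<alpha>(2) unfolding mult.assoc[symmetric] hreal_simps(5) by (simp add: hreal_simps mult.assoc)
  define g' where "g' = hconj b * g * b"
  have g': "g' \<in> octa" unfolding g'_def using b g by (intro octa_mult octa_hconj)
  have xgx: "hconj x * g * x = hconj q * g' * q" unfolding b(2) g'_def by (simp add: hconj_simps mult.assoc)
  \<comment> \<open>\<open>\<nu>\<close> divides \<open>\<alpha>\<close> and \<open>v \<bullet> hIm (hconj x * g * x)\<close>, hence \<open>1\<close>\<close>
  have "\<exists>\<mu>\<in>Z_sqrt2. 1 = \<nu> * \<mu>"
  proof -
    have "hreal \<alpha> = a * hconj (hconj q)" unfolding a(2) by (simp add: hconj_simps)
    also have "\<dots> = hreal (hnr a * \<nu>)"
      unfolding qa hconj_simps by (simp add: mult.assoc[symmetric] mult_hconj hreal_simps)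
    finally have al: "\<alpha> = \<nu> * hnr a" by (simp add: hreal_simps)
    have "v \<bullet> hIm (hconj x * g * x) = \<nu> * (v \<bullet> hIm (a * g' * q))"
      unfolding xgx qa by (simp add: mult.assoc hIm_linear)
    moreover obtain t where t: "t \<in> Z_sqrt2" "v \<bullet> hIm (hconj x * g * x) - 1 = \<alpha> * t" using one by (rule multiplesE)
    ultimately have "1 = \<nu> * (v \<bullet> hIm (a * g' * q) - hnr a * t)" unfolding al by (simp add: algebra_simps)
    moreover have "v \<bullet> hIm (a * g' * q) \<in> Z_sqrt2"
      using v a g' qo by (intro dual_Im_K_inner hIm_octa octa_mult)
    ultimately show ?thesis using a t octa_hnr by blast
  qed
  then obtain \<mu> where \<mu>: "\<mu> \<in> Z_sqrt2" "\<nu> * \<mu> = 1" by auto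
  have eq: "multiples (hnr q) = multiples \<alpha>"
  proof (intro equalityI subsetI)
    fix y assume "y \<in> multiples (hnr q)"
    then obtain t where t: "t \<in> Z_sqrt2" "y = hnr q * t" by (rule multiplesE)
    then have y: "y = \<alpha> * (\<nu> * t)" by (simp add: \<nu> mult.assoc)
    show "y \<in> multiples \<alpha>" unfolding y by (rule multiplesI[OF Z_sqrt2_mult[OF \<nu>(1) t(1)]])
  next
    fix y assume "y \<in> multiples \<alpha>"
    then obtain t where t: "t \<in> Z_sqrt2" "y = \<alpha> * t" by (rule multiplesE)
    then have "y = \<alpha> * (\<nu> * \<mu>) * t" using \<mu> by simp
    then have y: "y = hnr q * (\<mu> * t)" by (simp add: \<nu> mult.assoc)
    show "y \<in> multiples (hnr q)" unfolding y by (rule multiplesI[OF Z_sqrt2_mult[OF \<mu>(1) t(1)]])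
  qed
  have n0: "hnr q \<noteq> 0" using q(2) by (simp add: hnr_eq_0_iff)
  have rot: "hnr q *\<^sub>R (hrot q *v hIm z) = hIm (hconj q * z * q)" for z using n0 by (simp add: hrot_hIm)
  have rotT: "hnr q *\<^sub>R (transpose (hrot q) *v hIm z) = hIm (q * z * hconj q)" for z
    using n0 by (simp add: transpose_hrot hrot_hIm hnr_simps hconj_simps)
  have "coincidence_index Im_K (transpose (hrot q)) = add_index Z_sqrt2 (multiples (hnr q))"
  proof (rule index_of_rank_one[OF rotation_hrot[OF q(2)] octa_hnr[OF qo] n0 _ _ hIm_octa[OF g'] v])
    show "hnr q *\<^sub>R (hrot q *v y) \<in> Im_K" if "y \<in> Im_K" for y
      using that qo by (elim Im_K_lift) (simp add: rot hIm_octa octa_mult octa_hconj)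
    show "hnr q *\<^sub>R (transpose (hrot q) *v y) \<in> Im_K" if "y \<in> Im_K" for y
    proof -
      from that obtain z where z: "z \<in> octa" "y = hIm z" by (rule Im_K_lift)
      then have "q * z * hconj q \<in> octa" using qo by (intro octa_mult octa_hconj)
      then show ?thesis unfolding z(2) rotT by (rule hIm_octa)
    qed
    show "v \<bullet> (hnr q *\<^sub>R (hrot q *v hIm g')) - 1 \<in> multiples (hnr q)"
      using one unfolding rot eq xgx .
  qed
  moreover have "transpose (hrot q) \<in> SO3 Q_sqrt2"
    using rotation_hrot[OF q(2)] hrot_Q_sqrt2[OF qo]
    by (simp add: SO3_def rotation_matrix_def transpose_def orthogonal_matrix_transpose[unfolded transpose_def] det_transpose[unfolded transpose_def])
  ultimately show ?thesis unfolding eq by blast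
qed

section \<open>Primitive quaternions of norm divisible by a given integer\<close>

text \<open>The values \<open>v \<bullet> hIm (hconj x * g * x)\<close> are the matrix entries of \<open>|x|\<^sup>2\<close> times the rotation
  given by \<open>x\<close>, with respect to \<open>Im_K\<close> and its dual.
  Their compatibility with congruences makes it possible to work one prime power at a time.\<close>

lemma octa_form_congruence:
  assumes x: "x \<in> octa" "y \<in> octa" and g: "g \<in> octa" "d \<in> octa" and v: "v \<in> dual_Im_K" "w \<in> dual_Im_K"
    and c: "c \<in> Z_sqrt2"
  shows "(v + c *\<^sub>R w) \<bullet> hIm (hconj (x + hreal c * y) * (g + hreal c * d) * (x + hreal c * y))
    - v \<bullet> hIm (hconj x * g * x) \<in> multiples c"
proof -
  define x' where "x' = x + hreal c * y"
  define g' where "g' = g + hreal c * d"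
  define v' where "v' = v + c *\<^sub>R w"
  have o: "x' \<in> octa" "g' \<in> octa" unfolding x'_def g'_def using x g c by (auto intro: octa_add octa_scale)
  have v': "v' \<in> dual_Im_K" unfolding v'_def by (rule dual_Im_K_add_scale[OF v c])
  define Z where "Z = hconj y * g' * x' + hconj x * d * x' + hconj x * g * y"
  have Z: "Z \<in> octa" unfolding Z_def using x g o by (intro octa_add octa_mult octa_hconj)
  have mv: "z * (hreal c * t) = hreal c * (z * t)" for z t by (metis hreal_commute mult.assoc)
  have hc: "hconj x' = hconj x + hreal c * hconj y" by (simp add: x'_def hconj_simps hreal_commute)
  have "hconj x' * g' * x' = hconj x * g' * x' + hreal c * (hconj y * g' * x')"
    unfolding hc by (simp add: distrib_right mult.assoc)
  also have "hconj x * g' * x' = hconj x * g * x' + hreal c * (hconj x * d * x')"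
    unfolding g'_def by (simp add: distrib_left distrib_right mult.assoc mv)
  also have "hconj x * g * x' = hconj x * g * x + hreal c * (hconj x * g * y)"
    unfolding x'_def by (simp add: distrib_left mult.assoc mv)
  finally have "hconj x' * g' * x' = hconj x * g * x + hreal c * Z"
    by (simp add: Z_def distrib_left)
  then have "v' \<bullet> hIm (hconj x' * g' * x') - v \<bullet> hIm (hconj x * g * x)
      = c * (w \<bullet> hIm (hconj x * g * x) + v' \<bullet> hIm Z)"
    by (simp add: hIm_linear inner_add_right) (simp add: v'_def inner_add_left algebra_simps)
  also have "\<dots> \<in> multiples c"
    using v v' x g Z by (intro multiplesI Z_sqrt2_add dual_Im_K_inner hIm_octa octa_mult octa_hconj)
  finally show ?thesis unfolding x'_def g'_def v'_def .
qed

lemma hnr_congruence: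
  assumes "x \<in> octa" "y \<in> octa" "c \<in> Z_sqrt2"
  shows "hnr (x + hreal c * y) - hnr x \<in> multiples c"
proof -
  have "hconj (hreal c * y) = hreal c * hconj y" by (simp add: hconj_simps hreal_commute)
  then have "x * hconj (hreal c * y) = hreal c * (x * hconj y)" by (metis hreal_commute mult.assoc)
  then have h: "h0 (x * hconj (hreal c * y)) = c * h0 (x * hconj y)" by (simp add: hreal_def times_hquat_def)
  have "hnr (x + hreal c * y) - hnr x = c * (2 * h0 (x * hconj y) + c * hnr y)"
    unfolding hnr_add h hnr_mult hnr_simps by (simp add: algebra_simps power2_eq_square)
  also have "\<dots> \<in> multiples c"
    using assms by (intro multiplesI Z_sqrt2_add Z_sqrt2_mult[of c] octa_trace octa_mult octa_hconj octa_hnr)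
  finally show ?thesis .
qed

text \<open>A quaternion with norm zero modulo \<open>m\<close> that is not zero modulo any prime divisor of \<open>m\<close>. The
  latter is witnessed by an entry of the matrix of conjugation that is \<open>1\<close> modulo \<open>m\<close>.\<close>

definition has_primitive_zero :: "int \<Rightarrow> bool" where
  "has_primitive_zero m \<longleftrightarrow> (\<exists>x\<in>octa. \<exists>g\<in>octa. \<exists>v\<in>dual_Im_K. hnr x \<in> multiples (of_int m)
     \<and> v \<bullet> hIm (hconj x * g * x) - 1 \<in> multiples (of_int m))"

lemma multiples_trans: "x - y \<in> multiples a \<Longrightarrow> y - z \<in> multiples a \<Longrightarrow> x - z \<in> multiples a"
  using add_subgroup_add[OF multiples_subgroup, of "x - y" a "y - z"] by simp

lemma multiples_coprime:
  assumes "coprime m n" "x \<in> multiples (of_int m)" "x \<in> multiples (of_int n)"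
  shows "x \<in> multiples (of_int (m * n))"
proof -
  obtain u v where uv: "u * m + v * n = (1 :: int)"
    using bezout_int[of m n] assms(1) by (auto simp: coprime_iff_gcd_eq_1)
  obtain s where s: "s \<in> Z_sqrt2" "x = of_int m * s" using assms(2) by (rule multiplesE)
  obtain t where t: "t \<in> Z_sqrt2" "x = of_int n * t" using assms(3) by (rule multiplesE)
  have "x = of_int (u * m + v * n) * x" unfolding uv by simp
  also have "\<dots> = of_int u * of_int m * (of_int n * t) + of_int v * of_int n * (of_int m * s)"
    unfolding s(2)[symmetric] t(2)[symmetric] by (simp add: algebra_simps)
  also have "\<dots> = of_int (m * n) * (of_int u * t + of_int v * s)" by (simp add: algebra_simps)
  also have "\<dots> \<in> multiples (of_int (m * n))" using s t by (intro multiplesI Z_sqrt2_add Z_sqrt2_mult Z_sqrt2_of_int)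
  finally show ?thesis .
qed

lemma has_primitive_zero_mult:
  assumes "coprime m n" "has_primitive_zero m" "has_primitive_zero n"
  shows "has_primitive_zero (m * n)"
proof -
  obtain u w where uw: "u * m + w * n = (1 :: int)"
    using bezout_int[of m n] assms(1) by (auto simp: coprime_iff_gcd_eq_1)
  obtain x g v where 1: "x \<in> octa" "g \<in> octa" "v \<in> dual_Im_K" "hnr x \<in> multiples (of_int m)"
     "v \<bullet> hIm (hconj x * g * x) - 1 \<in> multiples (of_int m)"
    using assms(2) unfolding has_primitive_zero_def by blast
  obtain y h z where 2: "y \<in> octa" "h \<in> octa" "z \<in> dual_Im_K" "hnr y \<in> multiples (of_int n)"
     "z \<bullet> hIm (hconj y * h * y) - 1 \<in> multiples (of_int n)"
    using assms(3) unfolding has_primitive_zero_def by blast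
  \<comment> \<open>\<open>X\<close>, \<open>G\<close> and \<open>V\<close> are congruent to the first triple modulo \<open>m\<close> and to the second one modulo \<open>n\<close>\<close>
  define X where "X = x + hreal (of_int m) * (hreal (of_int u) * (y - x))"
  define G where "G = g + hreal (of_int m) * (hreal (of_int u) * (h - g))"
  define V where "V = v + of_int m *\<^sub>R (of_int u *\<^sub>R (z - v))"
  have um: "real_of_int m * of_int u = 1 - of_int n * of_int w"
    using arg_cong[OF uw, of real_of_int] by (simp add: algebra_simps)
  have swap: "a + hreal (of_int m) * (hreal (of_int u) * (b - a))
      = b + hreal (of_int n) * (hreal (of_int w) * (a - b))" for a b
  proof -
    have "hreal (of_int m) * (hreal (of_int u) * (b - a)) = hreal (1 - of_int n * of_int w) * (b - a)"
      unfolding um[symmetric] by (simp only: hreal_simps mult.assoc[symmetric])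
    also have "\<dots> = (b - a) + hreal (of_int n) * (hreal (of_int w) * (a - b))"
      unfolding hreal_simps(4)[symmetric] hreal_simps(5)[symmetric] hreal_simps(2) by (simp add: algebra_simps)
    finally show ?thesis by simp
  qed
  have V2: "V = z + of_int n *\<^sub>R (of_int w *\<^sub>R (v - z))"
    unfolding V_def scaleR_scaleR um by (simp add: algebra_simps)
  have o: "hreal (of_int u) * (y - x) \<in> octa" "hreal (of_int u) * (h - g) \<in> octa"
    "hreal (of_int w) * (x - y) \<in> octa" "hreal (of_int w) * (g - h) \<in> octa"
    using 1 2 by (auto intro!: octa_scale octa_diff)
  have d: "of_int u *\<^sub>R (z - v) \<in> dual_Im_K" "of_int w *\<^sub>R (v - z) \<in> dual_Im_K"
    using dual_Im_K_add_scale[OF _ dual_Im_K_diff[OF 2(3) 1(3)], of 0 "of_int u"]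
      dual_Im_K_add_scale[OF _ dual_Im_K_diff[OF 1(3) 2(3)], of 0 "of_int w"]
    by (simp_all add: dual_Im_K_def)
  have XG: "X \<in> octa" "G \<in> octa" "V \<in> dual_Im_K"
    unfolding X_def G_def V_def
    by (rule octa_add[OF 1(1) octa_scale[OF Z_sqrt2_of_int o(1)]],
      rule octa_add[OF 1(2) octa_scale[OF Z_sqrt2_of_int o(2)]],
      rule dual_Im_K_add_scale[OF 1(3) d(1) Z_sqrt2_of_int])
  have m: "hnr X - hnr x \<in> multiples (of_int m)"
      "V \<bullet> hIm (hconj X * G * X) - v \<bullet> hIm (hconj x * g * x) \<in> multiples (of_int m)"
    unfolding X_def G_def V_def
    by (rule hnr_congruence[OF 1(1) o(1) Z_sqrt2_of_int],
      rule octa_form_congruence[OF 1(1) o(1) 1(2) o(2) 1(3) d(1) Z_sqrt2_of_int])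
  have n: "hnr X - hnr y \<in> multiples (of_int n)"
      "V \<bullet> hIm (hconj X * G * X) - z \<bullet> hIm (hconj y * h * y) \<in> multiples (of_int n)"
    unfolding X_def G_def V2 swap
    by (rule hnr_congruence[OF 2(1) o(3) Z_sqrt2_of_int],
      rule octa_form_congruence[OF 2(1) o(3) 2(2) o(4) 2(3) d(2) Z_sqrt2_of_int])
  have "hnr X \<in> multiples (of_int m)" "hnr X \<in> multiples (of_int n)"
    using add_subgroup_add[OF multiples_subgroup m(1) 1(4)] add_subgroup_add[OF multiples_subgroup n(1) 2(4)] by simp_all
  then have "hnr X \<in> multiples (of_int (m * n))" by (rule multiples_coprime[OF assms(1)])
  moreover have "V \<bullet> hIm (hconj X * G * X) - 1 \<in> multiples (of_int (m * n))"
    by (rule multiples_coprime[OF assms(1) multiples_trans[OF m(2) 1(5)] multiples_trans[OF n(2) 2(5)]])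
  ultimately show ?thesis unfolding has_primitive_zero_def using XG by blast
qed

text \<open>If \<open>x\<close> is idempotent modulo \<open>p\<close> and \<open>p\<close> divides its norm, then for \<open>k > 0\<close> the power \<open>x\<^sup>k\<close> is congruent
  to \<open>x\<close> modulo \<open>p\<close>, and its norm is divisible by \<open>p\<^sup>k\<close>.\<close>

lemma has_primitive_zero_power:
  assumes x: "x \<in> octa" "y \<in> octa" "x * x = x + hreal (of_int p) * y"
    and g: "g \<in> octa" and v: "v \<in> dual_Im_K"
    and nr: "hnr x \<in> multiples (of_int p)" and one: "v \<bullet> hIm (hconj x * g * x) - 1 \<in> multiples (of_int p)"
  shows "has_primitive_zero (p ^ k)"
proof (cases k)
  case 0
  have "multiples 1 = Z_sqrt2" by (auto simp: multiples_def)
  moreover have "v \<bullet> hIm (hconj x * g * x) \<in> Z_sqrt2"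
    using x g v by (intro dual_Im_K_inner hIm_octa octa_mult octa_hconj)
  ultimately show ?thesis
    unfolding has_primitive_zero_def 0 using x g v octa_hnr[OF x(1)]
    by (intro bexI[of _ x] bexI[of _ g] bexI[of _ v]) (simp_all add: Z_sqrt2_diff)
next
  case (Suc j)
  have mv: "z * (hreal c * t) = hreal c * (z * t)" for z t c by (metis hreal_commute mult.assoc)
  have "\<exists>z\<in>octa. x ^ Suc i = x + hreal (of_int p) * z" for i
  proof (induction i)
    case 0
    show ?case using octa_zero by force
  next
    case (Suc i)
    then obtain z where z: "z \<in> octa" "x ^ Suc i = x + hreal (of_int p) * z" by blast
    have "x ^ Suc (Suc i) = x * (x + hreal (of_int p) * z)" unfolding z(2)[symmetric] by simp
    also have "\<dots> = x + hreal (of_int p) * (y + x * z)" by (simp add: distrib_left x(3) mv)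
    finally show ?case using x z by (metis octa_add octa_mult)
  qed
  then obtain z where z: "z \<in> octa" "x ^ k = x + hreal (of_int p) * z" unfolding Suc by blast
  define X where "X = x ^ k"
  define w where "w = v \<bullet> hIm (hconj X * g * X)"
  have X: "X \<in> octa" unfolding X_def by (rule octa_power[OF x(1)])
  have "hnr X = hnr x ^ k" unfolding X_def
    by (induction k) (simp_all add: hnr_mult, simp add: hnr_def one_hquat_def)
  moreover obtain t where "t \<in> Z_sqrt2" "hnr x = of_int p * t" using nr by (rule multiplesE)
  ultimately have nrX: "hnr X \<in> multiples (of_int (p ^ k))"
    using multiplesI[of "t ^ k" "of_int (p ^ k)"] by (auto simp: power_mult_distrib)
  have "w - v \<bullet> hIm (hconj x * g * x) \<in> multiples (of_int p)"
    using octa_form_congruence[OF x(1) z(1) g octa_zero v v, of "of_int p"]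
      octa_form_congruence[OF x(1) z(1) g octa_zero v _, of 0 "of_int p"]
    unfolding w_def X_def z(2) by (simp add: dual_Im_K_def)
  from multiples_trans[OF this one] obtain s where s: "s \<in> Z_sqrt2" "w - 1 = of_int p * s" by (rule multiplesE)
  \<comment> \<open>\<open>w\<close> is a unit modulo \<open>p\<^sup>k\<close>, with the finite geometric series in \<open>1 - w\<close> as its inverse\<close>
  define u where "u = (\<Sum>i<k. (1 - w) ^ i)"
  have wZ: "w \<in> Z_sqrt2" unfolding w_def using X g v by (intro dual_Im_K_inner hIm_octa octa_mult octa_hconj)
  have "u \<in> Z_sqrt2"
  proof -
    have "(\<Sum>i<n. (1 - w) ^ i) \<in> Z_sqrt2" for n by (induction n) (simp_all add: Z_sqrt2_add Z_sqrt2_power Z_sqrt2_diff wZ)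
    then show ?thesis by (simp add: u_def)
  qed
  have "w * u = 1 - (1 - w) ^ k" using one_diff_power_eq[of "1 - w" k] by (simp add: u_def)
  moreover have ps: "1 - w = of_int p * (- s)" using s(2) by simp
  have "(1 - w) ^ k = of_int (p ^ k) * (- s) ^ k" unfolding ps power_mult_distrib of_int_power ..
  ultimately have "u * w - 1 = of_int (p ^ k) * (- ((- s) ^ k))" by (simp add: mult.commute)
  then have "u * w - 1 \<in> multiples (of_int (p ^ k))"
    using s multiplesI[of "- ((- s) ^ k)" "of_int (p ^ k)"] by auto
  moreover have "hconj X * (hreal u * g) * X = hreal u * (hconj X * g * X)" by (simp add: mult.assoc mv)
  then have "v \<bullet> hIm (hconj X * (hreal u * g) * X) = u * w" by (simp add: hIm_linear w_def)
  ultimately show ?thesis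
    unfolding has_primitive_zero_def using X nrX v octa_scale[OF \<open>u \<in> Z_sqrt2\<close> g] by metis
qed

lemma minus_one_sum_of_two_squares_mod_prime:
  assumes "prime p" "p > (2 :: nat)"
  shows "\<exists>r s :: int. int p dvd r\<^sup>2 + s\<^sup>2 + 1"
proof -
  define h where "h = (int p - 1) div 2"
  have "odd p" using assms prime_odd_nat by auto
  then have ph: "int p = 2 * h + 1" unfolding h_def by presburger
  have pp: "prime (int p)" using assms by simp
  \<comment> \<open>The numbers \<open>0, \<dots>, (p - 1)/2\<close> have different squares modulo \<open>p\<close>, so that the \<open>i\<^sup>2\<close> and the \<open>- 1 - i\<^sup>2\<close>
    are too many to be all different.\<close>
  have inj: "i = j" if "i \<in> {0..h}" "j \<in> {0..h}" "int p dvd i\<^sup>2 - j\<^sup>2" for i j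
  proof (rule ccontr)
    assume "i \<noteq> j"
    have "int p dvd (i - j) * (i + j)" using that(3) by (simp add: algebra_simps power2_eq_square)
    then have "int p dvd i - j \<or> int p dvd i + j" using pp prime_dvd_mult_iff by blast
    moreover have "\<bar>i - j\<bar> < int p" "i - j \<noteq> 0" "0 < i + j" "i + j < int p" using that \<open>i \<noteq> j\<close> ph by auto
    ultimately show False using zdvd_imp_le[of "int p" "i + j"] dvd_imp_le_int[of "i - j" "int p"] by auto
  qed
  define A where "A = (\<lambda>i. i\<^sup>2 mod int p) ` {0..h}"
  define B where "B = (\<lambda>i. (- 1 - i\<^sup>2) mod int p) ` {0..h}"
  have "inj_on (\<lambda>i. i\<^sup>2 mod int p) {0..h}" by (rule inj_onI) (simp add: inj mod_eq_dvd_iff)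
  moreover have "inj_on (\<lambda>i. (- 1 - i\<^sup>2) mod int p) {0..h}"
  proof (rule inj_onI)
    fix i j assume ij: "i \<in> {0..h}" "j \<in> {0..h}" "(- 1 - i\<^sup>2) mod int p = (- 1 - j\<^sup>2) mod int p"
    then have "int p dvd j\<^sup>2 - i\<^sup>2" by (simp add: mod_eq_dvd_iff)
    then show "i = j" using inj[of j i] ij by simp
  qed
  ultimately have "card A = nat (h + 1)" "card B = nat (h + 1)" unfolding A_def B_def by (simp_all add: card_image)
  moreover have sub: "A \<subseteq> {0..<int p}" "B \<subseteq> {0..<int p}" unfolding A_def B_def using assms by auto
  ultimately have "A \<inter> B \<noteq> {}"
  proof -
    assume c: "card A = nat (h + 1)" "card B = nat (h + 1)"
    show ?thesis
    proof
      assume "A \<inter> B = {}"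
      then have "card (A \<union> B) = card A + card B"
        using finite_subset[OF sub(1)] finite_subset[OF sub(2)] by (simp add: card_Un_disjoint)
      moreover have "card (A \<union> B) \<le> p" using card_mono[of "{0..<int p}" "A \<union> B"] sub by simp
      ultimately show False using c ph assms by linarith
    qed
  qed
  then obtain r s where "r\<^sup>2 mod int p = (- 1 - s\<^sup>2) mod int p" unfolding A_def B_def by auto
  then have "int p dvd r\<^sup>2 - (- 1 - s\<^sup>2)" by (simp add: mod_eq_dvd_iff)
  then show ?thesis by (intro exI[of _ r] exI[of _ s]) (simp add: algebra_simps)
qed

text \<open>For odd \<open>p\<close> and \<open>r\<^sup>2 + s\<^sup>2 = -1\<close> modulo \<open>p\<close>, the quaternion \<open>(1 + r i + s j)/2\<close> has trace \<open>1\<close> and norm \<open>0\<close>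
  modulo \<open>p\<close>, hence is idempotent there.\<close>

lemma has_primitive_zero_odd_prime_power:
  assumes "prime p" "p > (2 :: nat)"
  shows "has_primitive_zero (int p ^ k)"
proof -
  obtain r s t :: int where rs: "r\<^sup>2 + s\<^sup>2 + 1 = int p * t"
    using minus_one_sum_of_two_squares_mod_prime[OF assms] by (auto elim!: dvdE)
  define h where "h = (int p + 1) div 2"
  have "odd p" using assms prime_odd_nat by auto
  then have h: "2 * h = int p + 1" unfolding h_def by presburger
  have hR: "2 * real_of_int h = of_int (int p) + 1" using arg_cong[OF h, of real_of_int] by simp
  have rsR: "(real_of_int r)\<^sup>2 + (of_int s)\<^sup>2 = of_int (int p) * of_int t - 1"
    using arg_cong[OF rs, of real_of_int] by simp
  define P where "P = real_of_int (int p)"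
  note hR = hR[folded P_def] and rsR = rsR[folded P_def]
  define x where "x = HQuat (of_int h) (of_int h * of_int r) (of_int h * of_int s) 0"
  have lip: "HQuat (of_int a) (of_int b) (of_int c) (of_int d) \<in> octa" for a b c d :: int
    unfolding octa_def by (auto intro!: Z_sqrt2_add Z_sqrt2_diff Z_sqrt2_mult)
  have x: "x \<in> octa" using lip[of h "h * r" "h * s" 0] by (simp add: x_def)
  have "hnr x = (of_int h)\<^sup>2 * (1 + ((of_int r)\<^sup>2 + (of_int s)\<^sup>2))"
    by (simp add: x_def hnr_def power_mult_distrib algebra_simps)
  then have nr: "hnr x = P * ((of_int h)\<^sup>2 * of_int t)" unfolding rsR by (simp add: algebra_simps)
  define y where "y = x - hreal ((of_int h)\<^sup>2 * of_int t)"
  have "x * x = hreal (2 * h0 x) * x - hreal (hnr x)"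
    by (simp add: hquat_ops hreal_def hnr_def power2_eq_square algebra_simps hquat_eq_iff)
  also have "\<dots> = x + hreal P * y"
  proof -
    have "2 * h0 x = 1 + P" by (simp add: x_def hR)
    then show ?thesis unfolding nr y_def
      by (simp add: distrib_right right_diff_distrib flip: hreal_simps(3,5)) (simp add: hreal_simps)
  qed
  finally have xx: "x * x = x + hreal (of_int (int p)) * y" unfolding P_def .
  have y: "y \<in> octa" unfolding y_def by (rule octa_diff[OF x]) (simp add: hreal_in_octa_iff Z_sqrt2_mult Z_sqrt2_power)
  define g where "g = HQuat 0 0 0 1"
  define v :: "real ^ 3" where "v = vector [0, 0, 2]"
  have g: "g \<in> octa" using lip[of 0 0 0 1] by (simp add: g_def)
  have v: "v \<in> dual_Im_K" by (simp add: dual_Im_K_iff v_def)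
  have "v \<bullet> hIm (hconj x * g * x) = 2 * (of_int h)\<^sup>2 * (1 - ((of_int r)\<^sup>2 + (of_int s)\<^sup>2))"
    by (simp add: inner_3 v_def g_def x_def hconj_def times_hquat_def power2_eq_square algebra_simps)
  also have "\<dots> = (2 * of_int h)\<^sup>2 - 2 * (of_int h)\<^sup>2 * P * of_int t"
    unfolding rsR by (simp add: algebra_simps power2_eq_square)
  also have "\<dots> = 1 + P * (P + 2 - 2 * (of_int h)\<^sup>2 * of_int t)"
    unfolding hR by (simp add: algebra_simps power2_eq_square)
  finally have "v \<bullet> hIm (hconj x * g * x) - 1 = P * (P + 2 - 2 * (of_int h)\<^sup>2 * of_int t)" by simp
  moreover have "P + 2 - 2 * (of_int h)\<^sup>2 * of_int t \<in> Z_sqrt2" unfolding P_def by (intro Z_sqrt2_diff Z_sqrt2_add Z_sqrt2_mult Z_sqrt2_power) auto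
  ultimately have one: "v \<bullet> hIm (hconj x * g * x) - 1 \<in> multiples (of_int (int p))"
    unfolding P_def[symmetric] by (simp only: multiplesI)
  have "(of_int h)\<^sup>2 * of_int t \<in> Z_sqrt2" by (intro Z_sqrt2_mult Z_sqrt2_power Z_sqrt2_of_int)
  then have "hnr x \<in> multiples (of_int (int p))" unfolding nr P_def by (rule multiplesI)
  from has_primitive_zero_power[OF x y xx g v this one] show ?thesis .
qed

text \<open>For \<open>p = 2\<close> the quaternion \<open>(1 + (1 + \<surd>2) i + (1 - \<surd>2) j + k)/2\<close> has trace \<open>1\<close> and norm \<open>2\<close>,
  hence is idempotent modulo \<open>2\<close>.\<close>

lemma has_primitive_zero_two_power: "has_primitive_zero (2 ^ k)"
proof -
  let ?x = "HQuat (1/2) ((1 + sqrt 2) / 2) ((1 - sqrt 2) / 2) (1/2)"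
  let ?g = "HQuat (1/2) (1/2) (1/2) (1/2)"
  let ?v = "vector [sqrt 2, sqrt 2, 0] :: real ^ 3"
  have x: "?x \<in> octa" using octa_half_integers[of 1 1 1 1 0 1 "-1" 0] by simp
  have g: "?g \<in> octa" using octa_half_integers[of 1 1 1 1 0 0 0 0] by simp
  have y: "- 1 \<in> octa" by (rule octa_uminus[OF octa_one])
  have v: "?v \<in> dual_Im_K" by (simp add: dual_Im_K_iff)
  have xx: "?x * ?x = ?x + hreal (of_int 2) * - 1"
    by (simp add: hquat_ops hreal_def field_simps sqrt2_mult_self)
  have "hnr ?x = 2 * 1" by (simp add: hnr_def power2_eq_square field_simps sqrt2_mult_self)
  then have nr: "hnr ?x \<in> multiples (of_int 2)" by (simp only: multiplesI Z_sqrt2_consts of_int_numeral)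
  have "?v \<bullet> hIm (hconj ?x * ?g * ?x) - 1 = 2 * 0"
    by (simp add: inner_3 hconj_def times_hquat_def field_simps sqrt2_mult_self)
  then have one: "?v \<bullet> hIm (hconj ?x * ?g * ?x) - 1 \<in> multiples (of_int 2)"
    by (simp only: multiplesI Z_sqrt2_consts of_int_numeral)
  show ?thesis by (rule has_primitive_zero_power[OF x y xx g v nr one])
qed

theorem has_primitive_zero_nat:
  assumes "m > 0"
  shows "has_primitive_zero (int m)"
  using assms
proof (induction m rule: less_induct)
  case (less m)
  show ?case
  proof (cases "m = 1")
    case True
    then show ?thesis using has_primitive_zero_two_power[of 0] by simp
  next
    case False
    then obtain p where p: "prime p" "p dvd m" using prime_factor_nat by blast
    define k where "k = multiplicity p m"
    obtain n where n: "m = p ^ k * n" "\<not> p dvd n"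
    proof -
      have "m \<noteq> 0" "\<not> is_unit p" using less.prems p(1) prime_gt_1_nat[of p] by auto
      from multiplicity_decompose'[OF this] that show thesis unfolding k_def by blast
    qed
    have "k > 0" using n p by (cases k) auto
    then have "p ^ k > 1" using p(1) prime_gt_1_nat one_less_power by blast
    then have "n < m" "n > 0" using less.prems n(1) by auto
    then have "has_primitive_zero (int n)" using less.IH by blast
    moreover have "has_primitive_zero (int p ^ k)"
    proof (cases "p = 2")
      case False
      then show ?thesis using has_primitive_zero_odd_prime_power p(1) prime_ge_2_nat[OF p(1)] by simp
    qed (use has_primitive_zero_two_power in simp)
    moreover have "coprime (int p ^ k) (int n)"
      using prime_imp_coprime[OF p(1) n(2)] by simp
    ultimately show ?thesis using has_primitive_zero_mult[of "int p ^ k" "int n"] by (simp add: n(1))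
  qed
qed

text \<open>An element \<open>a\<close> of norm \<open>m\<close> divides \<open>m\<close>, so that a primitive zero modulo \<open>m\<close> is one modulo \<open>a\<close>.\<close>

theorem norm_values_are_coincidence_indices:
  assumes "m \<in> norm_values"
  shows "\<exists>R\<in>SO3 Q_sqrt2. coincidence_index Im_K R = m"
proof -
  obtain k l :: int where kl: "int m = k\<^sup>2 - 2 * l\<^sup>2" and "m \<ge> 1" using assms unfolding norm_values_def by blast
  define a where "a = real_of_int k + of_int l * sqrt 2"
  have aZ: "a \<in> Z_sqrt2" unfolding a_def by (rule Z_sqrt2I)
  have "norm_sqrt2 a = of_int (k\<^sup>2 - 2 * l\<^sup>2)" unfolding a_def by (simp add: norm_sqrt2_eq)
  then have norm: "norm_sqrt2 a = real m" unfolding kl[symmetric] by simp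
  then have a0: "a \<noteq> 0" using \<open>m \<ge> 1\<close> by (auto simp: norm_sqrt2_def)
  have "of_int (int m) = a * conj_sqrt2 a" using norm by (simp add: norm_sqrt2_def)
  then have sub: "multiples (of_int (int m)) \<subseteq> multiples a"
    using conj_sqrt2_Z_sqrt2(1)[OF aZ] by (auto elim!: multiplesE simp: mult.assoc intro!: multiplesI)
  have "has_primitive_zero (int m)" using has_primitive_zero_nat \<open>m \<ge> 1\<close> by simp
  then obtain x g v where x: "x \<in> octa" "g \<in> octa" "v \<in> dual_Im_K"
    "hnr x \<in> multiples (of_int (int m))" "v \<bullet> hIm (hconj x * g * x) - 1 \<in> multiples (of_int (int m))"
    unfolding has_primitive_zero_def by blast
  then obtain R where R: "R \<in> SO3 Q_sqrt2" "coincidence_index Im_K R = add_index Z_sqrt2 (multiples a)"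
    using rotation_of_primitive_zero[OF x(1) aZ a0 _ x(2,3)] sub by blast
  have "real (add_index Z_sqrt2 (multiples a)) = real m" using index_multiples[OF aZ a0] norm by simp
  with R show ?thesis by auto
qed

section \<open>Rotations with entries in \<open>\<rat>(\<surd>2)\<close> are the coincidence rotations\<close>

lemma finite_index_mono:
  assumes "is_add_subgroup K" "is_add_subgroup H" "K \<subseteq> H" "finite_index G K"
  shows "finite_index G H"
proof -
  \<comment> \<open>the coset of \<open>H\<close> is a function of the coset of \<open>K\<close>\<close>
  have "add_coset H x = (\<lambda>C. add_coset H (inv_into G (add_coset K) C)) (add_coset K x)" if "x \<in> G" for x
  proof -
    have "add_coset K (inv_into G (add_coset K) (add_coset K x)) = add_coset K x"
      using that by (intro f_inv_into_f) blast
    then have "inv_into G (add_coset K) (add_coset K x) - x \<in> K" using add_coset_eq_iff[OF assms(1)] by blast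
    then show ?thesis using add_coset_eq_iff[OF assms(2)] assms(3) by blast
  qed
  then have "add_coset H ` G \<subseteq> (\<lambda>C. add_coset H (inv_into G (add_coset K) C)) ` add_coset K ` G"
    by blast
  moreover have "finite (add_coset K ` G)" using assms(4) by (simp add: finite_index_def rcosets_additive_group)
  ultimately show ?thesis
    unfolding finite_index_def rcosets_additive_group by (meson finite_imageI finite_subset)
qed

lemma finite_Z_sqrt2_mod:
  assumes "n > (0 :: int)"
  shows "finite (add_coset (multiples (of_int n)) ` Z_sqrt2)"
proof -
  have "add_index Z_sqrt2 (multiples (of_int n)) > 0" using index_multiples_int[OF assms] assms by simp
  moreover have "Z_sqrt2 \<noteq> {}" using Z_sqrt2_0 by blast
  ultimately have "finite_index Z_sqrt2 (multiples (of_int n))" using finite_index_iff_pos by blast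
  then show ?thesis by (simp add: finite_index_def rcosets_additive_group)
qed

lemma scaled_Im_K_subgroup: "is_add_subgroup ((*\<^sub>R) c ` Im_K)"
  using add_subgroup_zero[OF Im_K_subgroup] add_subgroup_diff[OF Im_K_subgroup]
  unfolding is_add_subgroup_def by (auto simp: image_iff simp flip: scaleR_right_diff_distrib)

lemma finite_index_scaled_Im_K:
  assumes "n > (0 :: int)"
  shows "finite_index Im_K ((*\<^sub>R) (of_int n) ` Im_K)"
proof -
  \<comment> \<open>The three coordinates in \<open>Im_K_iff\<close>, modulo \<open>n\<close>, separate the cosets.\<close>
  define m where "m = add_coset (multiples (of_int n))"
  define g where "g x = (m (sqrt 2 * (x $ 1 - x $ 3)), m (sqrt 2 * (x $ 2 - x $ 3)), m (2 * x $ 3))" for x :: "real ^ 3"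
  have div: "a \<in> multiples (of_int n) \<longleftrightarrow> a / of_int n \<in> Z_sqrt2" for a
  proof
    assume "a / of_int n \<in> Z_sqrt2"
    then have "of_int n * (a / of_int n) \<in> multiples (of_int n)" by (rule multiplesI)
    then show "a \<in> multiples (of_int n)" using assms by simp
  qed (use assms in \<open>auto elim!: multiplesE\<close>)
  have iff: "x \<in> (*\<^sub>R) (of_int n) ` Im_K \<longleftrightarrow> (1 / of_int n) *\<^sub>R x \<in> Im_K" for x :: "real ^ 3"
  proof
    assume "(1 / of_int n) *\<^sub>R x \<in> Im_K"
    then have "of_int n *\<^sub>R (1 / of_int n) *\<^sub>R x \<in> (*\<^sub>R) (of_int n) ` Im_K" by (rule imageI)
    then show "x \<in> (*\<^sub>R) (of_int n) ` Im_K" using assms by simp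
  next
    assume "x \<in> (*\<^sub>R) (of_int n) ` Im_K"
    then obtain y where "y \<in> Im_K" "x = of_int n *\<^sub>R y" by blast
    then show "(1 / of_int n) *\<^sub>R x \<in> Im_K" using assms by simp
  qed
  have "finite_index Im_K ((*\<^sub>R) (of_int n) ` Im_K) \<longleftrightarrow> finite (g ` Im_K)"
  proof (rule index_via_function(2)[OF scaled_Im_K_subgroup])
    fix x y :: "real ^ 3"
    let ?z = "(1 / of_int n) *\<^sub>R (x - y)"
    have "(sqrt 2 * (x $ i - x $ 3) - sqrt 2 * (y $ i - y $ 3)) / of_int n = sqrt 2 * (?z $ i - ?z $ 3)" for i
      using assms by (simp add: field_simps)
    moreover have "(2 * x $ 3 - 2 * y $ 3) / of_int n = 2 * ?z $ 3" by simp
    ultimately show "g x = g y \<longleftrightarrow> x - y \<in> (*\<^sub>R) (of_int n) ` Im_K"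
      unfolding iff Im_K_iff g_def m_def prod.inject add_coset_eq_iff[OF multiples_subgroup] div
      by (simp only:)
  qed
  moreover have "g ` Im_K \<subseteq> (m ` Z_sqrt2) \<times> (m ` Z_sqrt2) \<times> (m ` Z_sqrt2)"
  proof
    fix z assume "z \<in> g ` Im_K"
    then obtain x where "x \<in> Im_K" and z: "z = g x" by blast
    then have "sqrt 2 * (x $ 1 - x $ 3) \<in> Z_sqrt2" "sqrt 2 * (x $ 2 - x $ 3) \<in> Z_sqrt2" "2 * x $ 3 \<in> Z_sqrt2"
      by (simp_all only: Im_K_iff)
    then show "z \<in> (m ` Z_sqrt2) \<times> (m ` Z_sqrt2) \<times> (m ` Z_sqrt2)"
      unfolding z g_def by (intro SigmaI imageI)
  qed
  moreover have "finite (m ` Z_sqrt2)" unfolding m_def by (rule finite_Z_sqrt2_mod[OF assms])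
  then have "finite ((m ` Z_sqrt2) \<times> (m ` Z_sqrt2) \<times> (m ` Z_sqrt2))" by (intro finite_cartesian_product)
  ultimately show ?thesis using finite_subset by blast
qed

lemma Q_sqrt2_common_denominator:
  assumes "finite A" "A \<subseteq> Q_sqrt2"
  shows "\<exists>n::int. n > 0 \<and> (\<forall>x\<in>A. of_int n * x \<in> Z_sqrt2)"
  using assms
proof (induction A rule: finite_induct)
  case empty
  show ?case by (intro exI[of _ 1]) simp
next
  case (insert x A)
  then obtain n :: int where n: "n > 0" "\<forall>x\<in>A. of_int n * x \<in> Z_sqrt2" by auto
  have rat: "\<exists>d::int. d > 0 \<and> of_int d * a \<in> \<int>" if q: "a \<in> \<rat>" for a :: real
  proof -
    obtain p q :: int where "q > 0" "a = of_int p / of_int q"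
      using q by (rule Rats_cases') blast
    then show ?thesis by (intro exI[of _ q]) auto
  qed
  obtain a b where ab: "a \<in> \<rat>" "b \<in> \<rat>" "x = a + b * sqrt 2" using insert.prems by (auto elim!: Q_sqrt2E)
  obtain d e :: int where de: "d > 0" "of_int d * a \<in> \<int>" "e > 0" "of_int e * b \<in> \<int>" using rat ab by meson
  then obtain i j :: int where ij: "of_int d * a = of_int i" "of_int e * b = of_int j" by (meson Ints_cases)
  have "of_int (d * e) * x = of_int e * (of_int d * a) + of_int d * (of_int e * b) * sqrt 2"
    unfolding ab(3) by (simp add: algebra_simps)
  then have x: "of_int (d * e) * x \<in> Z_sqrt2" unfolding ij by (auto intro!: Z_sqrt2_add Z_sqrt2_mult)
  have "of_int (n * (d * e)) * y \<in> Z_sqrt2" if "y \<in> insert x A" for y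
  proof (cases "y = x")
    case True
    then show ?thesis using Z_sqrt2_mult[OF Z_sqrt2_of_int[of n] x] by (simp add: mult.assoc)
  next
    case False
    then have "of_int n * y \<in> Z_sqrt2" using that n by blast
    from Z_sqrt2_mult[OF Z_sqrt2_of_int[of "d * e"] this] show ?thesis by (simp add: algebra_simps)
  qed
  moreover have "n * (d * e) > 0" using n de by simp
  ultimately show ?case by blast
qed

lemma matrix_clears_Im_K:
  fixes R :: "real ^ 3 ^ 3"
  assumes "\<forall>a b. R $ a $ b \<in> Q_sqrt2"
  shows "\<exists>n::int. n > 0 \<and> (\<forall>x\<in>Im_K. of_int n *\<^sub>R (R *v x) \<in> Im_K)"
proof -
  have "finite (range (\<lambda>(a, b). R $ a $ b))" by simp
  moreover have "range (\<lambda>(a, b). R $ a $ b) \<subseteq> Q_sqrt2" using assms by auto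
  ultimately obtain n :: int where n: "n > 0" "\<forall>x\<in>range (\<lambda>(a, b). R $ a $ b). of_int n * x \<in> Z_sqrt2"
    using Q_sqrt2_common_denominator by blast
  then have nR: "of_int n * R $ a $ b \<in> Z_sqrt2" for a b by (auto simp: image_iff)
  \<comment> \<open>\<open>2 Im_K\<close> is contained in, and \<open>Im_K\<close> contains, the vectors with coordinates in \<open>\<int>[\<surd>2]\<close>.\<close>
  have "of_int (2 * n) *\<^sub>R (R *v x) \<in> Im_K" if x: "x \<in> Im_K" for x
  proof -
    obtain p q r where z: "p \<in> Z_sqrt2" "q \<in> Z_sqrt2" "r \<in> Z_sqrt2"
      and xs: "x $ 1 = p * sqrt 2 / 2 + r / 2" "x $ 2 = q * sqrt 2 / 2 + r / 2" "x $ 3 = r / 2"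
      using x by (rule Im_KE)
    have "2 * x $ 1 = p * sqrt 2 + r" "2 * x $ 2 = q * sqrt 2 + r" "2 * x $ 3 = r" by (simp_all add: xs)
    then have x2: "2 * x $ 1 \<in> Z_sqrt2" "2 * x $ 2 \<in> Z_sqrt2" "2 * x $ 3 \<in> Z_sqrt2"
      using z by (simp_all add: Z_sqrt2_add Z_sqrt2_mult)
    have "(of_int (2 * n) *\<^sub>R (R *v x)) $ a = of_int n * R $ a $ 1 * (2 * x $ 1)
      + of_int n * R $ a $ 2 * (2 * x $ 2) + of_int n * R $ a $ 3 * (2 * x $ 3)" for a
      by (simp add: matrix_vector_mult_def sum_3 algebra_simps)
    then have y: "(of_int (2 * n) *\<^sub>R (R *v x)) $ a \<in> Z_sqrt2" for a
      using nR x2 by (metis Z_sqrt2_add Z_sqrt2_mult)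
    show ?thesis unfolding Im_K_iff using y by (intro conjI Z_sqrt2_mult Z_sqrt2_diff Z_sqrt2_sqrt Z_sqrt2_consts)
  qed
  then show ?thesis using n(1) by (intro exI[of _ "2 * n"]) auto
qed

lemma matrix_image_subgroup:
  fixes R :: "real ^ 'n ^ 'm"
  assumes "is_add_subgroup A"
  shows "is_add_subgroup ((*v) R ` A)"
  unfolding is_add_subgroup_def
proof (intro conjI ballI)
  show "0 \<in> (*v) R ` A"
    using add_subgroup_zero[OF assms] by (metis imageI matrix_vector_mult_0_right)
  fix x y assume "x \<in> (*v) R ` A" "y \<in> (*v) R ` A"
  then show "x - y \<in> (*v) R ` A"
    using add_subgroup_diff[OF assms] by (auto simp flip: matrix_vector_mult_diff_distrib)
qed

lemmas rotated_Im_K_subgroup = matrix_image_subgroup[OF Im_K_subgroup]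

lemma rotation_inverse:
  fixes R :: "real ^ 3 ^ 3"
  assumes "rotation_matrix R"
  shows "R *v (transpose R *v y) = y" "transpose R *v (R *v y) = y"
  using assms unfolding matrix_vector_mul_assoc rotation_matrix_def orthogonal_matrix_def by simp_all

text \<open>A suitable multiple \<open>n\<close> of a common denominator of the entries of the inverse of \<open>R\<close> gives \<open>n Im_K \<subseteq> R Im_K\<close>, and likewise
  with \<open>R\<close> and its inverse exchanged.\<close>

lemma SO3_Q_sqrt2_finite_index:
  assumes R: "R \<in> SO3 Q_sqrt2"
  shows "finite_index Im_K (Im_K \<inter> (*v) R ` Im_K)" "finite_index ((*v) R ` Im_K) (Im_K \<inter> (*v) R ` Im_K)"
proof -
  have rot: "rotation_matrix R" and ent: "\<forall>a b. R $ a $ b \<in> Q_sqrt2" using R by (auto simp: SO3_def)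
  note inv = rotation_inverse[OF rot]
  have entT: "\<forall>a b. transpose R $ a $ b \<in> Q_sqrt2" using ent by (simp add: transpose_def)
  let ?L = "Im_K \<inter> (*v) R ` Im_K"
  have L: "is_add_subgroup ?L" by (rule add_subgroup_Int[OF Im_K_subgroup rotated_Im_K_subgroup])
  have scale: "of_int n *\<^sub>R x \<in> Im_K" if "x \<in> Im_K" for x and n :: int using Im_K_scale that by simp
  obtain n :: int where n: "n > 0" "\<And>x. x \<in> Im_K \<Longrightarrow> of_int n *\<^sub>R (transpose R *v x) \<in> Im_K"
    using matrix_clears_Im_K[OF entT] by blast
  have "(*\<^sub>R) (of_int n) ` Im_K \<subseteq> ?L"
  proof
    fix y assume "y \<in> (*\<^sub>R) (of_int n) ` Im_K"
    then obtain x where x: "x \<in> Im_K" "y = of_int n *\<^sub>R x" by blast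
    have "y = R *v (of_int n *\<^sub>R (transpose R *v x))" unfolding matrix_vector_mult_scaleR inv x(2) ..
    then have "y \<in> (*v) R ` Im_K" by (rule image_eqI[OF _ n(2)[OF x(1)]])
    then show "y \<in> ?L" using scale[OF x(1), of n] unfolding x(2) by (rule IntI[rotated])
  qed
  from finite_index_mono[OF scaled_Im_K_subgroup L this finite_index_scaled_Im_K[OF n(1)]]
  show "finite_index Im_K ?L" .
  obtain m :: int where m: "m > 0" "\<And>x. x \<in> Im_K \<Longrightarrow> of_int m *\<^sub>R (R *v x) \<in> Im_K"
    using matrix_clears_Im_K[OF ent] by blast
  have K: "is_add_subgroup ((*v) R ` (*\<^sub>R) (of_int m) ` Im_K)"
    by (rule matrix_image_subgroup[OF scaled_Im_K_subgroup])
  have fin: "finite_index ((*v) R ` Im_K) ((*v) R ` (*\<^sub>R) (of_int m) ` Im_K)"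
  proof -
    have "inj ((*v) R)" using inv(2) by (rule inj_on_inverseI)
    then have mem: "R *v x \<in> (*v) R ` A \<longleftrightarrow> x \<in> A" for x A by (rule inj_image_mem_iff)
    have "add_index ((*v) R ` Im_K) ((*v) R ` (*\<^sub>R) (of_int m) ` Im_K) = add_index Im_K ((*\<^sub>R) (of_int m) ` Im_K)"
    proof (rule index_preimage[symmetric, where f = "(*v) R", OF scaled_Im_K_subgroup K rotated_Im_K_subgroup])
      show "(*v) R ` (*\<^sub>R) (of_int m) ` Im_K \<subseteq> (*v) R ` Im_K"
        using scale by (intro image_mono) blast
      show "(R *v x - R *v y \<in> (*v) R ` (*\<^sub>R) (of_int m) ` Im_K) = (x - y \<in> (*\<^sub>R) (of_int m) ` Im_K)" for x y
        unfolding matrix_vector_mult_diff_distrib[symmetric] by (rule mem)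
      show "\<exists>x\<in>Im_K. R *v x - y \<in> (*v) R ` (*\<^sub>R) (of_int m) ` Im_K" if "y \<in> (*v) R ` Im_K" for y
        using that add_subgroup_zero[OF K] by force
    qed blast
    moreover have "Im_K \<noteq> {}" using add_subgroup_zero[OF Im_K_subgroup] by blast
    ultimately show ?thesis
      using finite_index_scaled_Im_K[OF m(1)] finite_index_iff_pos[of Im_K] finite_index_iff_pos[of "(*v) R ` Im_K"] by simp
  qed
  have sub: "(*v) R ` (*\<^sub>R) (of_int m) ` Im_K \<subseteq> ?L"
    using m(2) scale by (auto simp: matrix_vector_mult_scaleR simp flip: matrix_vector_mult_scaleR)
  from finite_index_mono[OF K L sub fin]
  show "finite_index ((*v) R ` Im_K) ?L" .
qed

text \<open>Conversely, some nonzero multiple of each \<open>(\<surd>2/2) e\<^sub>j\<close> lies in \<open>R Im_K\<close>, by the pigeonhole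
  principle; applying the transpose of \<open>R\<close> exhibits the \<open>j\<close>-th row of \<open>R\<close> as a multiple of a vector
  of \<open>Im_K\<close>.\<close>

lemma SOC_imp_Q_sqrt2:
  assumes "R \<in> SOC Im_K"
  shows "R \<in> SO3 Q_sqrt2"
proof -
  have rot: "rotation_matrix R" and fin: "finite_index Im_K (Im_K \<inter> (*v) R ` Im_K)"
    using assms by (auto simp: SOC_def SO3_def commensurate_def)
  let ?L = "Im_K \<inter> (*v) R ` Im_K"
  have L: "is_add_subgroup ?L" by (rule add_subgroup_Int[OF Im_K_subgroup rotated_Im_K_subgroup])
  have "R $ j $ i \<in> Q_sqrt2" for i j
  proof -
    define e :: "real ^ 3" where "e = (sqrt 2 / 2) *\<^sub>R axis j 1"
    have "\<forall>j. (sqrt 2 / 2) *\<^sub>R axis j 1 \<in> Im_K" by (simp add: forall_3 Im_K_iff axis_def Z_sqrt2_uminus)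
    then have e: "e \<in> Im_K" unfolding e_def by blast
    have "finite (add_coset ?L ` Im_K)" using fin by (simp add: finite_index_def rcosets_additive_group)
    moreover have "(\<lambda>n::nat. add_coset ?L (of_nat n *\<^sub>R e)) ` UNIV \<subseteq> add_coset ?L ` Im_K"
      using Im_K_scale[OF Z_sqrt2_consts(4) e] by blast
    ultimately have "finite (range (\<lambda>n::nat. add_coset ?L (of_nat n *\<^sub>R e)))" by (rule finite_subset[rotated])
    then have "\<not> inj (\<lambda>n::nat. add_coset ?L (of_nat n *\<^sub>R e))" using finite_imageD infinite_UNIV_nat by blast
    then obtain m n :: nat where mn: "m \<noteq> n" "add_coset ?L (of_nat m *\<^sub>R e) = add_coset ?L (of_nat n *\<^sub>R e)"
      unfolding inj_def by blast
    define N where "N = real m - real n"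
    have "N \<noteq> 0" using mn(1) by (simp add: N_def)
    have "N *\<^sub>R e \<in> ?L" using mn(2) unfolding add_coset_eq_iff[OF L] N_def by (simp add: scaleR_left_diff_distrib)
    then obtain y where y: "y \<in> Im_K" "N *\<^sub>R e = R *v y" by blast
    have "y = N *\<^sub>R (transpose R *v e)"
      using rotation_inverse(2)[OF rot, of y] unfolding y(2)[symmetric] by (simp add: matrix_vector_mult_scaleR del: transpose_matrix_vector)
    then have "y $ i = N * (sqrt 2 / 2) * R $ j $ i"
      by (simp add: e_def matrix_vector_mult_scaleR matrix_vector_mult_basis column_def transpose_def del: transpose_matrix_vector)
    then have eq: "R $ j $ i = (2 * y $ i) / (N * sqrt 2)" using \<open>N \<noteq> 0\<close> by (simp add: field_simps)
    have "\<forall>i. 2 * y $ i \<in> Z_sqrt2"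
    proof -
      obtain p q r where z: "p \<in> Z_sqrt2" "q \<in> Z_sqrt2" "r \<in> Z_sqrt2"
        and ys: "y $ 1 = p * sqrt 2 / 2 + r / 2" "y $ 2 = q * sqrt 2 / 2 + r / 2" "y $ 3 = r / 2"
        using y(1) by (rule Im_KE)
      have "2 * y $ 1 = p * sqrt 2 + r" "2 * y $ 2 = q * sqrt 2 + r" "2 * y $ 3 = r" by (simp_all add: ys)
      then show ?thesis using z by (simp add: forall_3 Z_sqrt2_add Z_sqrt2_mult)
    qed
    then have "2 * y $ i \<in> Q_sqrt2" using Z_sqrt2_subset_Q_sqrt2 by blast
    moreover have "N \<in> Z_sqrt2" unfolding N_def by (intro Z_sqrt2_diff Z_sqrt2_consts)
    then have "N * sqrt 2 \<in> Q_sqrt2" using Z_sqrt2_subset_Q_sqrt2 by (intro Q_sqrt2_mult) auto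
    ultimately show ?thesis unfolding eq by (rule Q_sqrt2_divide)
  qed
  then show ?thesis using rot by (simp add: SO3_def)
qed

theorem SOC_Im_K: "SOC Im_K = SO3 Q_sqrt2"
proof (intro equalityI subsetI)
  fix R assume R: "R \<in> SO3 Q_sqrt2"
  then have "R \<in> SO3 UNIV" by (simp add: SO3_def)
  then show "R \<in> SOC Im_K" using SO3_Q_sqrt2_finite_index[OF R] by (simp add: SOC_def commensurate_def)
qed (rule SOC_imp_Q_sqrt2)

section \<open>The coincidence spectrum\<close>

text \<open>The intersection of \<open>Im_K\<close> with its image is again a module over \<open>\<int>[\<surd>2]\<close>.\<close>

lemma coincidence_index_in_norm_values:
  assumes R: "R \<in> SO3 Q_sqrt2"
  shows "coincidence_index Im_K R \<in> norm_values"
  unfolding coincidence_index_def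
proof (rule index_submodule_in_norm_values[OF Im_K_submodule])
  show "is_submodule (Im_K \<inter> (*v) R ` Im_K)"
    unfolding is_submodule_def
  proof (intro conjI ballI IntI)
    fix c x assume c: "c \<in> Z_sqrt2" and x: "x \<in> Im_K \<inter> (*v) R ` Im_K"
    show "c *\<^sub>R x \<in> Im_K" using c x Im_K_scale by blast
    from x obtain y where "y \<in> Im_K" "x = R *v y" by blast
    then show "c *\<^sub>R x \<in> (*v) R ` Im_K" using Im_K_scale[OF c] by (metis imageI matrix_vector_mult_scaleR)
  qed (rule add_subgroup_Int[OF Im_K_subgroup rotated_Im_K_subgroup])
  have "Im_K \<noteq> {}" using add_subgroup_zero[OF Im_K_subgroup] by blast
  then show "0 < add_index Im_K (Im_K \<inter> (*v) R ` Im_K)"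
    using SO3_Q_sqrt2_finite_index(1)[OF R] finite_index_iff_pos by blast
qed simp

lemma not_norm_value:
  assumes "prime p" "p mod 8 = 3 \<or> p mod 8 = 5" "p dvd m" "\<not> p\<^sup>2 dvd m"
  shows "m \<notin> norm_values"
  using inert_prime_norm_value[OF assms(1,2) _ assms(3)] assms(4) by (metis dvd_triv_left)

lemma norm_values_upto_25: "{m \<in> norm_values. m \<le> 25} = {1, 2, 4, 7, 8, 9, 14, 16, 17, 18, 23, 25}"
proof -
  have I: "m \<in> norm_values" if "int m = k\<^sup>2 - 2 * l\<^sup>2" "m \<ge> 1" for m k l
    using that unfolding norm_values_def by blast
  have mem: "1 \<in> norm_values" "2 \<in> norm_values" "4 \<in> norm_values" "7 \<in> norm_values" "8 \<in> norm_values"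
    "9 \<in> norm_values" "14 \<in> norm_values" "16 \<in> norm_values" "17 \<in> norm_values" "18 \<in> norm_values"
    "23 \<in> norm_values" "25 \<in> norm_values"
    using I[of 1 1 0] I[of 2 2 1] I[of 4 2 0] I[of 7 3 1] I[of 8 4 2] I[of 9 3 0] I[of 14 4 1] I[of 16 4 0]
      I[of 17 5 2] I[of 18 6 3] I[of 23 5 1] I[of 25 5 0] by simp_all
  have prime: "prime (3::nat)" "prime (5::nat)" "prime (11::nat)" "prime (13::nat)" "prime (19::nat)"
    by (simp_all add: prime_nat_numeral_eq)
  have "0 \<notin> norm_values" by (simp add: norm_values_def)
  moreover have "3 \<notin> norm_values" "6 \<notin> norm_values" "12 \<notin> norm_values" "15 \<notin> norm_values"
    "21 \<notin> norm_values" "24 \<notin> norm_values"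
    using prime by (simp_all add: not_norm_value[of 3])
  moreover have "5 \<notin> norm_values" "10 \<notin> norm_values" "20 \<notin> norm_values"
    using prime by (simp_all add: not_norm_value[of 5])
  moreover have "11 \<notin> norm_values" "22 \<notin> norm_values" using prime by (simp_all add: not_norm_value[of 11])
  moreover have "13 \<notin> norm_values" using prime by (simp_all add: not_norm_value[of 13])
  moreover have "19 \<notin> norm_values" using prime by (simp_all add: not_norm_value[of 19])
  ultimately have not_mem: "0 \<notin> norm_values" "3 \<notin> norm_values" "5 \<notin> norm_values" "6 \<notin> norm_values"
    "10 \<notin> norm_values" "11 \<notin> norm_values" "12 \<notin> norm_values" "13 \<notin> norm_values" "15 \<notin> norm_values"
    "19 \<notin> norm_values" "20 \<notin> norm_values" "21 \<notin> norm_values" "22 \<notin> norm_values" "24 \<notin> norm_values"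
    by simp_all
  have "{..25} = {25, 24, 23, 22, 21, 20, 19, 18, 17, 16, 15, 14, 13, 12, 11, 10, 9, 8, 7, 6, 5, 4, 3, 2, 1, 0 :: nat}"
    by (simp add: atMost_nat_numeral atMost_Suc)
  moreover have "{m \<in> norm_values. m \<le> 25} = {..25} \<inter> norm_values" by auto
  ultimately show ?thesis using mem not_mem by (simp add: Int_insert_left insert_commute)
qed

theorem corollary5:
  shows "coincidence_spectrum Im_K = coincidence_index Im_K ` SO3 Q_sqrt2
    \<and> coincidence_index Im_K ` SO3 Q_sqrt2
        = {m::nat. m \<ge> 1 \<and> (\<exists>k l::int. int m = k\<^sup>2 - 2 * l\<^sup>2)}
    \<and> {m \<in> coincidence_spectrum Im_K. m \<le> 25} = {1, 2, 4, 7, 8, 9, 14, 16, 17, 18, 23, 25}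
    \<and> Group.monoid \<lparr>carrier = coincidence_spectrum Im_K, monoid.mult = (*), one = 1\<rparr>
    \<and> coincidence_spectrum Im_K
        = {m::nat. m \<ge> 1 \<and>
            (\<forall>p::nat. prime p \<and> ([int p = 3] (mod 8) \<or> [int p = - 3] (mod 8))
                 \<longrightarrow> even (multiplicity p m))}"
proof -
  have spec: "coincidence_spectrum Im_K = coincidence_index Im_K ` SO3 Q_sqrt2"
    unfolding coincidence_spectrum_def SOC_Im_K ..
  have img: "coincidence_index Im_K ` SO3 Q_sqrt2 = norm_values"
    using coincidence_index_in_norm_values norm_values_are_coincidence_indices by blast
  have "int p mod 8 = int (p mod 8)" for p by (simp add: zmod_int)
  then have cong: "[int p = 3] (mod 8) \<longleftrightarrow> p mod 8 = 3" "[int p = - 3] (mod 8) \<longleftrightarrow> p mod 8 = 5" for p :: nat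
    unfolding cong_def by auto
  have "Group.monoid \<lparr>carrier = norm_values, monoid.mult = (*), one = 1\<rparr>"
    by (rule monoidI) (use norm_values_mult norm_values_upto_25 in \<open>auto simp: mult.assoc\<close>)
  then show ?thesis
    unfolding spec img cong norm_values_prime_characterisation[symmetric]
    using norm_values_upto_25 by (simp add: norm_values_def)
qed

end
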